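(* Let $X\subset\mathbb{R}^n$ be a locally closed set that is pure $d$-dimensional and locally definable in an o-minimal structure on $\mathbb{R}$. Suppose that $C_3(X)$ and $C_4(X)$ coincide linearly. Then, for a fixed nonnegative integer $k$, the Nash mapping $\eta\colon\mathcal{N}(X)\to X$ is a homeomorphism such that $\eta^{-1}$ is $C^{k,\mathrm{log\text{-}Lip}}$ smooth if and only if $X$ is a $C^{k+1,\mathrm{log\text{-}Lip}}$ smooth submanifold of $\mathbb{R}^n$.
   Context: A structure on $\mathbb{R}$ is a family $\mathcal{S}=\{\mathcal{S}_m\}_{m\ge1}$, with each $\mathcal{S}_m$ a Boolean algebra of subsets of $\mathbb{R}^m$ containing all algebraic subsets, closed under Cartesian products and under the projections $\mathbb{R}^{m+1}\to\mathbb{R}^m$ onto the first $m$ coordinates; it is o-minimal if $\mathcal{S}_1$ consists exactly of finite unions of points and intervals. Elements of the $\mathcal{S}_m$ are called definable. A set $X\subset\mathbb{R}^n$ is locally definable if every $x\in\overline{X}$ has a neighbourhood $U\subset\mathbb{R}^n$ with $X\cap U$ definable. $\mathrm{Sing}_1(X)$ is the set of $x\in X$ such that $X$ is not a $C^1$ submanifold around $x$. The Nash transformation $\mathcal{N}(X)$ is the closure in $X\times Gr_{\mathbb{R}}(d,n)$ of the graph of the Gauss mapping $x\mapsto T_xX$ on $X\setminus\mathrm{Sing}_1(X)$, where $Gr_{\mathbb{R}}(d,n)$ is the Grassmannian of $d$-dimensional linear subspaces of $\mathbb{R}^n$; the Nash mapping $\eta\colon\mathcal{N}(X)\to X$ is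 the restriction of the projection onto the first factor. For $p\in X$: $C_3(X,p)$ is the set of $v\in\mathbb{R}^n$ for which there are $x_j\in X$ and $t_j>0$ with $t_j\to0$ and $\frac{1}{t_j}(x_j-p)\to v$; $C_4(X,p)$ is the union of all $d$-dimensional linear subspaces $T$ for which there is a sequence $x_j\in X\setminus\mathrm{Sing}_1(X)$ with $x_j\to p$ and $T_{x_j}X\to T$. We say that $C_3(X)$ and $C_4(X)$ coincide linearly if $C_3(X,p)=C_4(X,p)$ for every $p\in X$ such that $C_4(X,p)$ is a $d$-dimensional linear subspace. A map $f\colon(M_1,d_1)\to(M_2,d_2)$ of metric spaces is log-Lipschitz if there is $C>0$ with $d_2(f(x),f(y))\le C\,d_1(x,y)\,|\log d_1(x,y)|$ for all $x\neq y$ with $d_1(x,y)\le 1/2$. A map between open subsets of $C^\infty$ manifolds is $C^{k,\mathrm{log\text{-}Lip}}$ smooth if in local charts it is $C^k$ and its partial derivatives of order $k$ are locally log-Lipschitz ($C^{0,\mathrm{log\text{-}Lip}}$ smooth means locally log-Lipschitz). If $A_1\subset M_1$ and $A_2\subset M_2$ are subsets of $C^\infty$ manifolds, a map $f\colon A_1\to A_2$ is $C^{k,\mathrm{log\text{-}Lip}}$ smooth if each $p\in A_1$ has an open neighbourhood $U\subset M_1$ and a $C^{k,\mathrm{log\text{-}Lip}}$ smooth map $F\colon U\to M_2$ with $F=f$ on $A_1\cap U$. Here $X\subset\mathbb{R}^n$ and $\mathcal{N}(X)\subset\mathbb{R}^n\times Gr_{\mathbb{R}}(d,n)$. A $C^{k+1,\mathrm{log\text{-}Lip}}$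 smooth submanifold is an embedded submanifold (without boundary) which is locally, after a linear change of coordinates, the graph of a $C^{k+1,\mathrm{log\text{-}Lip}}$ smooth map from an open subset of $\mathbb{R}^d$ to $\mathbb{R}^{n-d}$. *)

theory Defs
  imports "HOL-Analysis.Analysis"
begin

section \<open>O-minimal structures on the real field\<close>

text \<open>Points of \<open>\<real>\<^sup>m\<close>, with \<open>m\<close> varying, are real lists of length \<open>m\<close>.\<close>

definition Rpow :: "nat \<Rightarrow> real list set" where
  "Rpow m = {xs. length xs = m}"

inductive polynomial_fun :: "nat \<Rightarrow> (real list \<Rightarrow> real) \<Rightarrow> bool" for m where
  const: "polynomial_fun m (\<lambda>xs. c)"
| coord: "i < m \<Longrightarrow> polynomial_fun m (\<lambda>xs. xs ! i)"
| add: "polynomial_fun m p \<Longrightarrow> polynomial_fun m q \<Longrightarrow> polynomial_fun m (\<lambda>xs. p xs + q xs)"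
| mult: "polynomial_fun m p \<Longrightarrow> polynomial_fun m q \<Longrightarrow> polynomial_fun m (\<lambda>xs. p xs * q xs)"

definition algebraic_subset :: "nat \<Rightarrow> real list set \<Rightarrow> bool" where
  "algebraic_subset m Z \<longleftrightarrow>
     (\<exists>P. finite P \<and> (\<forall>p\<in>P. polynomial_fun m p) \<and> Z = {xs \<in> Rpow m. \<forall>p\<in>P. p xs = 0})"

text \<open>The family is indexed by \<open>m \<ge> 1\<close>; the value at \<open>0\<close> is irrelevant.\<close>

definition structure_on_reals :: "(nat \<Rightarrow> real list set set) \<Rightarrow> bool" where
  "structure_on_reals S \<longleftrightarrow>
     (\<forall>m\<ge>1. algebra (Rpow m) (S m)) \<and>
     (\<forall>m\<ge>1. \<forall>Z. algebraic_subset m Z \<longrightarrow> Z \<in> S m) \<and>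
     (\<forall>m\<ge>1. \<forall>n\<ge>1. \<forall>A\<in>S m. \<forall>B\<in>S n. {xs @ ys |xs ys. xs \<in> A \<and> ys \<in> B} \<in> S (m + n)) \<and>
     (\<forall>m\<ge>1. \<forall>A\<in>S (m + 1). take m ` A \<in> S m)"

definition o_minimal :: "(nat \<Rightarrow> real list set set) \<Rightarrow> bool" where
  "o_minimal S \<longleftrightarrow> structure_on_reals S \<and>
     S 1 = {(\<lambda>x. [x]) ` (\<Union>\<I>) |\<I>. finite \<I> \<and> (\<forall>I\<in>\<I>. (\<exists>a. I = {a}) \<or> is_interval I)}"

text \<open>The index type \<open>'n\<close> has no distinguished order. A structure is closed under permutations
  of the coordinates, so the enumeration of \<open>'n\<close> chosen below does not matter.\<close>

definition definable :: "(nat \<Rightarrow> real list set set) \<Rightarrow> (real ^ 'n) set \<Rightarrow> bool" where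
  "definable S A \<longleftrightarrow>
     (\<exists>e. bij_betw e {..<CARD('n)} (UNIV :: 'n set) \<and>
        (\<lambda>x. map (\<lambda>i. x $ e i) [0..<CARD('n)]) ` A \<in> S CARD('n))"

definition locally_definable :: "(nat \<Rightarrow> real list set set) \<Rightarrow> (real ^ 'n) set \<Rightarrow> bool" where
  "locally_definable S X \<longleftrightarrow> (\<forall>x\<in>closure X. \<exists>U. x \<in> interior U \<and> definable S (X \<inter> U))"


section \<open>\<open>C\<^sup>k\<close> and \<open>C\<^sup>k\<close>-log-Lipschitz maps\<close>

definition log_lipschitz_on :: "'a::metric_space set \<Rightarrow> ('a \<Rightarrow> 'b::metric_space) \<Rightarrow> bool" where
  "log_lipschitz_on A f \<longleftrightarrow>
     (\<exists>C>0. \<forall>x\<in>A. \<forall>y\<in>A. x \<noteq> y \<and> dist x y \<le> 1 / 2 \<longrightarrow>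
        dist (f x) (f y) \<le> C * dist x y * \<bar>ln (dist x y)\<bar>)"

definition locally_log_lipschitz_on :: "'a::metric_space set \<Rightarrow> ('a \<Rightarrow> 'b::metric_space) \<Rightarrow> bool" where
  "locally_log_lipschitz_on U f \<longleftrightarrow>
     (\<forall>p\<in>U. \<exists>N. open N \<and> p \<in> N \<and> log_lipschitz_on (U \<inter> N) f)"

definition partial_derivative ::
    "'a::real_normed_vector \<Rightarrow> ('a \<Rightarrow> 'b::real_normed_vector) \<Rightarrow> 'a \<Rightarrow> 'b" where
  "partial_derivative b f x = vector_derivative (\<lambda>t. f (x + t *\<^sub>R b)) (at 0)"

definition iterated_partial ::
    "'a::real_normed_vector list \<Rightarrow> ('a \<Rightarrow> 'b::real_normed_vector) \<Rightarrow> 'a \<Rightarrow> 'b" where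
  "iterated_partial bs f = foldr partial_derivative bs f"

text \<open>The set \<open>U\<close> is meant to be open in \<open>Ck_on\<close> and \<open>CkLL_on\<close>.\<close>

definition Ck_on :: "nat \<Rightarrow> 'a::euclidean_space set \<Rightarrow> ('a \<Rightarrow> 'b::real_normed_vector) \<Rightarrow> bool" where
  "Ck_on k U f \<longleftrightarrow>
     (\<forall>bs. set bs \<subseteq> Basis \<and> length bs \<le> k \<longrightarrow> continuous_on U (iterated_partial bs f)) \<and>
     (\<forall>bs. set bs \<subseteq> Basis \<and> length bs < k \<longrightarrow>
        (\<forall>b\<in>Basis. \<forall>x\<in>U. (\<lambda>t. iterated_partial bs f (x + t *\<^sub>R b)) differentiable (at 0)))"

definition CkLL_on :: "nat \<Rightarrow> 'a::euclidean_space set \<Rightarrow> ('a \<Rightarrow> 'b::real_normed_vector) \<Rightarrow> bool" where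
  "CkLL_on k U f \<longleftrightarrow> Ck_on k U f \<and>
     (\<forall>bs. set bs \<subseteq> Basis \<and> length bs = k \<longrightarrow> locally_log_lipschitz_on U (iterated_partial bs f))"

text \<open>Smoothness on an arbitrary subset: \<open>f\<close> is, around each point of \<open>A\<close>, the restriction of a
  map that is smooth (in the sense of \<open>R\<close>) on an open set.\<close>

definition smooth_on_subset ::
    "('a::topological_space set \<Rightarrow> ('a \<Rightarrow> 'b) \<Rightarrow> bool) \<Rightarrow> 'a set \<Rightarrow> ('a \<Rightarrow> 'b) \<Rightarrow> bool" where
  "smooth_on_subset R A f \<longleftrightarrow>
     (\<forall>p\<in>A. \<exists>U F. open U \<and> p \<in> U \<and> R U F \<and> (\<forall>x\<in>A \<inter> U. F x = f x))"


section \<open>Submanifolds, dimension, tangent spaces\<close>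

text \<open>Around \<open>p\<close>, after a linear change of coordinates, \<open>X\<close> is the graph of a smooth map from an
  open subset of \<open>\<real>\<^sup>d\<close> to \<open>\<real>\<^sup>n\<^sup>-\<^sup>d\<close>. The change of coordinates is encoded by the splitting
  \<open>\<real>\<^sup>n = V \<oplus> W\<close> into the images of \<open>\<real>\<^sup>d\<close> and \<open>\<real>\<^sup>n\<^sup>-\<^sup>d\<close>, which allows \<open>d = 0\<close> and \<open>d = n\<close>. Since \<open>D\<close>
  is open in \<open>V\<close> only, smoothness of \<open>f\<close> is expressed by local extensions to open sets of
  \<open>\<real>\<^sup>n\<close>; they exist for every map smooth on \<open>D\<close>, namely \<open>f\<close> composed with the projection
  to \<open>V\<close> along \<open>W\<close>.\<close>

definition smooth_graph_at ::
    "((real ^ 'n) set \<Rightarrow> (real ^ 'n \<Rightarrow> real ^ 'n) \<Rightarrow> bool) \<Rightarrow> nat \<Rightarrow> (real ^ 'n) set \<Rightarrow> real ^ 'n \<Rightarrow> bool"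
  where
  "smooth_graph_at R d X p \<longleftrightarrow>
     (\<exists>V W U D f. subspace V \<and> subspace W \<and> V \<inter> W = {0} \<and> {v + w |v w. v \<in> V \<and> w \<in> W} = UNIV \<and>
        dim V = d \<and> open U \<and> p \<in> U \<and> openin (top_of_set V) D \<and>
        f ` D \<subseteq> W \<and> smooth_on_subset R D f \<and> X \<inter> U = (\<lambda>v. v + f v) ` D)"

definition C1_submanifold :: "nat \<Rightarrow> (real ^ 'n) set \<Rightarrow> bool" where
  "C1_submanifold d X \<longleftrightarrow> (\<forall>p\<in>X. smooth_graph_at (Ck_on 1) d X p)"

definition CkLL_submanifold :: "nat \<Rightarrow> nat \<Rightarrow> (real ^ 'n) set \<Rightarrow> bool" where
  "CkLL_submanifold k d X \<longleftrightarrow> (\<forall>p\<in>X. smooth_graph_at (CkLL_on k) d X p)"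

definition Sing1 :: "(real ^ 'n) set \<Rightarrow> (real ^ 'n) set" where
  "Sing1 X = {x \<in> X. \<not> (\<exists>e. smooth_graph_at (Ck_on 1) e X x)}"

text \<open>The dimension of a set is the largest dimension of a nonempty \<open>C\<^sup>1\<close> submanifold contained in
  it; on definable sets this is the o-minimal dimension.\<close>

definition has_dimension :: "(real ^ 'n) set \<Rightarrow> nat \<Rightarrow> bool" where
  "has_dimension A d \<longleftrightarrow>
     (\<exists>M. M \<subseteq> A \<and> M \<noteq> {} \<and> C1_submanifold d M) \<and>
     (\<forall>e M. M \<subseteq> A \<and> M \<noteq> {} \<and> C1_submanifold e M \<longrightarrow> e \<le> d)"

definition local_dimension :: "(real ^ 'n) set \<Rightarrow> real ^ 'n \<Rightarrow> nat \<Rightarrow> bool" where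
  "local_dimension X p d \<longleftrightarrow> (\<forall>\<^sub>F r in at_right 0. has_dimension (X \<inter> ball p r) d)"

definition pure_dimensional :: "nat \<Rightarrow> (real ^ 'n) set \<Rightarrow> bool" where
  "pure_dimensional d X \<longleftrightarrow> (\<forall>p\<in>X. local_dimension X p d)"

definition tangent_space :: "(real ^ 'n) set \<Rightarrow> real ^ 'n \<Rightarrow> (real ^ 'n) set" where
  "tangent_space X x =
     {v. \<exists>\<gamma> \<epsilon>. \<epsilon> > 0 \<and> \<gamma> C1_differentiable_on {-\<epsilon><..<\<epsilon>} \<and> \<gamma> ` {-\<epsilon><..<\<epsilon>} \<subseteq> X \<and> \<gamma> 0 = x \<and>
          (\<gamma> has_vector_derivative v) (at 0)}"


section \<open>The Grassmannian\<close>

definition Gr :: "nat \<Rightarrow> (real ^ 'n) set set" where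
  "Gr d = {T. subspace T \<and> dim T = d}"

text \<open>The matrix of the orthogonal projection onto \<open>T\<close>. The topology of the Grassmannian is the
  one for which \<open>orth_proj\<close> is an embedding into the space of matrices.\<close>

definition orth_proj :: "(real ^ 'n) set \<Rightarrow> real ^ 'n ^ 'n" where
  "orth_proj T = matrix (closest_point T)"

definition Gr_topology :: "nat \<Rightarrow> (real ^ 'n) set topology" where
  "Gr_topology d = pullback_topology (Gr d) orth_proj euclidean"

text \<open>The standard atlas, indexed by \<open>V \<in> Gr d\<close>: a subspace \<open>T\<close> with \<open>T \<inter> V\<^sup>\<bottom> = 0\<close> is the graph of
  a unique linear map \<open>V \<rightarrow> V\<^sup>\<bottom>\<close>, which is recorded as the matrix extending it by \<open>0\<close> on \<open>V\<^sup>\<bottom>\<close>.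
  The chart takes values in the linear subspace of matrices that vanish on \<open>V\<^sup>\<bottom>\<close> and map \<open>V\<close> into
  \<open>V\<^sup>\<bottom>\<close>, a copy of \<open>Hom(V, V\<^sup>\<bottom>)\<close>.\<close>

definition Gr_chart_domain :: "(real ^ 'n) set \<Rightarrow> (real ^ 'n) set set" where
  "Gr_chart_domain V = {T \<in> Gr (dim V). T \<inter> orthogonal_comp V = {0}}"

definition Gr_chart :: "(real ^ 'n) set \<Rightarrow> (real ^ 'n) set \<Rightarrow> real ^ 'n ^ 'n" where
  "Gr_chart V T =
     (THE A. (\<forall>v\<in>V. A *v v \<in> orthogonal_comp V) \<and> (\<forall>w\<in>orthogonal_comp V. A *v w = 0) \<and>
             T = (\<lambda>v. v + A *v v) ` V)"

text \<open>\<open>C\<^sup>k\<close>-log-Lipschitz maps from an open set \<open>U\<close> to the manifold \<open>\<real>\<^sup>n \<times> Gr d\<close>, in the product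
  charts.\<close>

definition CkLL_into_RGr ::
    "nat \<Rightarrow> nat \<Rightarrow> (real ^ 'n) set \<Rightarrow> (real ^ 'n \<Rightarrow> (real ^ 'n) \<times> (real ^ 'n) set) \<Rightarrow> bool" where
  "CkLL_into_RGr k d U F \<longleftrightarrow>
     F ` U \<subseteq> UNIV \<times> Gr d \<and>
     (\<forall>p\<in>U. \<exists>N V. open N \<and> p \<in> N \<and> N \<subseteq> U \<and> V \<in> Gr d \<and> (\<forall>x\<in>N. snd (F x) \<in> Gr_chart_domain V) \<and>
        CkLL_on k N (\<lambda>x. (fst (F x), Gr_chart V (snd (F x)))))"


section \<open>Nash transformation and tangent cones\<close>

definition nash_transformation ::
    "nat \<Rightarrow> (real ^ 'n) set \<Rightarrow> ((real ^ 'n) \<times> (real ^ 'n) set) set" where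
  "nash_transformation d X =
     prod_topology (top_of_set X) (Gr_topology d) closure_of
       ((\<lambda>x. (x, tangent_space X x)) ` (X - Sing1 X))"

definition nash_topology :: "nat \<Rightarrow> (real ^ 'n) set \<Rightarrow> ((real ^ 'n) \<times> (real ^ 'n) set) topology" where
  "nash_topology d X =
     subtopology (prod_topology (top_of_set X) (Gr_topology d)) (nash_transformation d X)"

text \<open>The Nash mapping is \<open>fst\<close>, regarded as a map from \<open>nash_transformation d X\<close> to \<open>X\<close>.\<close>

definition nash_inverse :: "nat \<Rightarrow> (real ^ 'n) set \<Rightarrow> real ^ 'n \<Rightarrow> (real ^ 'n) \<times> (real ^ 'n) set" where
  "nash_inverse d X = inv_into (nash_transformation d X) fst"

definition C3 :: "(real ^ 'n) set \<Rightarrow> real ^ 'n \<Rightarrow> (real ^ 'n) set" where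
  "C3 X p =
     {v. \<exists>x t. (\<forall>j::nat. x j \<in> X \<and> t j > 0) \<and> t \<longlonglongrightarrow> 0 \<and> (\<lambda>j. (1 / t j) *\<^sub>R (x j - p)) \<longlonglongrightarrow> v}"

definition C4 :: "nat \<Rightarrow> (real ^ 'n) set \<Rightarrow> real ^ 'n \<Rightarrow> (real ^ 'n) set" where
  "C4 d X p =
     \<Union>{T \<in> Gr d. \<exists>x. (\<forall>j::nat. x j \<in> X - Sing1 X) \<and> x \<longlonglongrightarrow> p \<and>
          limitin (Gr_topology d) (\<lambda>j. tangent_space X (x j)) T sequentially}"

definition coincide_linearly :: "nat \<Rightarrow> (real ^ 'n) set \<Rightarrow> bool" where
  "coincide_linearly d X \<longleftrightarrow>
     (\<forall>p\<in>X. subspace (C4 d X p) \<and> dim (C4 d X p) = d \<longrightarrow> C3 X p = C4 d X p)"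

end

theory Submission
  imports Defs
begin

text \<open>If \<open>\<eta>\<close> is a homeomorphism, every \<open>x \<in> X\<close> has a single limit \<open>T\<^sub>x\<close> of tangent spaces, so
  \<open>C\<^sub>3(X,x) = C\<^sub>4(X,x) = T\<^sub>x\<close>. In a chart of the Grassmannian at \<open>V\<close>, \<open>T\<^sub>x\<close> is the graph of a linear map
  \<open>A(x): V \<rightarrow> V\<^sup>\<bottom>\<close>, where \<open>A\<close> is \<open>C\<^sup>k\<close>-log-Lipschitz. Since the tangent cones of \<open>X\<close> are graphs over \<open>V\<close>,
  the orthogonal projection \<open>X \<rightarrow> V\<close> is locally surjective and the fibre through a point is isolated
  there. Two points of \<open>X\<close> in one fibre are lifted along a ray towards an isolated fibre; their distance
  \<open>u\<close> satisfies \<open>u' \<le> C u \<bar>log u\<bar>\<close>, and Osgood's criterion forces \<open>u = 0\<close>. Hence \<open>X\<close> is locally the graph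
  of a map whose parametrisation \<open>G\<close> satisfies \<open>dG(h) = h + A(G) h\<close>, and the smoothness of \<open>A\<close> bootstraps
  to \<open>C\<^sup>k\<^sup>+\<^sup>1\<close>-log-Lipschitz smoothness of \<open>G\<close>. Conversely, the tangent spaces of a graph are obtained from the derivative of the
  parametrisation by linear algebra that preserves \<open>C\<^sup>k\<close>-log-Lipschitz smoothness.\<close>

section \<open>Calculus of \<open>C\<^sup>k\<close>-log-Lipschitz maps\<close>

text \<open>Two points in one fibre cannot simply be followed as functions of the time along the
  ray: lifting gives existence only, with no continuous dependence on the parameter, so there is no
  curve \<open>u\<close> to differentiate. The differential inequality is therefore tested at a
  first failure. The triples (time, point, point) whose distance reaches a comparison function form
  a compact set, because \<open>X\<close> is locally closed. At the earliest such time, lifts to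
  slightly earlier times still lie strictly below the comparison function, which contradicts the
  growth rate. The comparison functions exp(-a exp(-(C+1)t)) use \<open>C + 1\<close> instead of
  \<open>C\<close> to leave room for the lifting errors. They are positive at time 0, where the
  fibre is a single point, and arbitrarily small for large \<open>a\<close>. Such a family exists
  because the integral of 1/(t|log t|) diverges at 0, which is Osgood's condition. The modulus t|log
  t| has a price: it is not stable under composition. The section \<open>G\<close> must therefore
  first be shown to be \<open>C^1\<close>, using continuity of \<open>A\<close> alone, before the
  smoothness of \<open>A(G)\<close> can be exploited.\<close>

lemma iterated_partial_Nil [simp]: "iterated_partial [] f = f"
  by (simp add: iterated_partial_def)

section \<open>Recursion over the order of differentiation\<close>

lemma iterated_partial_snoc:
  "iterated_partial (bs @ [b]) f = iterated_partial bs (partial_derivative b f)"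
  by (simp add: iterated_partial_def)

text \<open>Since \<open>foldr\<close> applies the last entry of the list first, splitting a list at
  its end turns a statement about \<open>f\<close> into one about its first partial derivatives.
  This and the next two lemmas do so for the three length conditions in the smoothness
  predicates.\<close>

lemma all_lists_le_Suc:
  "(\<forall>bs. set bs \<subseteq> B \<and> length bs \<le> Suc k \<longrightarrow> P bs) \<longleftrightarrow>
     P [] \<and> (\<forall>b\<in>B. \<forall>bs. set bs \<subseteq> B \<and> length bs \<le> k \<longrightarrow> P (bs @ [b]))"
  (is "?L \<longleftrightarrow> ?R")
proof
  assume ?R
  show ?L
  proof (intro allI impI)
    fix bs assume "set bs \<subseteq> B \<and> length bs \<le> Suc k"
    then show "P bs"
      using \<open>?R\<close> by (cases bs rule: rev_cases) auto
  qed
qed auto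

lemma all_lists_less_Suc:
  "(\<forall>bs. set bs \<subseteq> B \<and> length bs < Suc k \<longrightarrow> P bs) \<longleftrightarrow>
     P [] \<and> (\<forall>b\<in>B. \<forall>bs. set bs \<subseteq> B \<and> length bs < k \<longrightarrow> P (bs @ [b]))"
  (is "?L \<longleftrightarrow> ?R")
proof
  assume ?R
  show ?L
  proof (intro allI impI)
    fix bs assume "set bs \<subseteq> B \<and> length bs < Suc k"
    then show "P bs"
      using \<open>?R\<close> by (cases bs rule: rev_cases) auto
  qed
qed auto

lemma all_lists_eq_Suc:
  "(\<forall>bs. set bs \<subseteq> B \<and> length bs = Suc k \<longrightarrow> P bs) \<longleftrightarrow>
     (\<forall>b\<in>B. \<forall>bs. set bs \<subseteq> B \<and> length bs = k \<longrightarrow> P (bs @ [b]))"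
  (is "?L \<longleftrightarrow> ?R")
proof
  assume ?R
  show ?L
  proof (intro allI impI)
    fix bs assume "set bs \<subseteq> B \<and> length bs = Suc k"
    then show "P bs"
      using \<open>?R\<close> by (cases bs rule: rev_cases) auto
  qed
qed auto

lemma Ck_on_0: "Ck_on 0 U f \<longleftrightarrow> continuous_on U f"
  by (auto simp: Ck_on_def)

text \<open>Together with its log-Lipschitz analogue, this replaces the definition by iterated
  partials: inductions on \<open>k\<close> generalise over \<open>f\<close> and pass to its first
  partial derivatives.\<close>

lemma Ck_on_Suc:
  "Ck_on (Suc k) U f \<longleftrightarrow> continuous_on U f \<and>
     (\<forall>b\<in>Basis. \<forall>x\<in>U. (\<lambda>t. f (x + t *\<^sub>R b)) differentiable (at 0)) \<and>
     (\<forall>b\<in>Basis. Ck_on k U (partial_derivative b f))"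
  unfolding Ck_on_def all_lists_le_Suc all_lists_less_Suc
  by (simp add: iterated_partial_snoc) blast

lemma Ck_on_1:
  "Ck_on 1 U f \<longleftrightarrow> continuous_on U f \<and>
     (\<forall>b\<in>Basis. \<forall>x\<in>U. (\<lambda>t. f (x + t *\<^sub>R b)) differentiable (at 0)) \<and>
     (\<forall>b\<in>Basis. continuous_on U (partial_derivative b f))"
  unfolding One_nat_def Ck_on_Suc Ck_on_0 ..

lemma CkLL_on_0: "CkLL_on 0 U f \<longleftrightarrow> continuous_on U f \<and> locally_log_lipschitz_on U f"
  by (auto simp: CkLL_on_def Ck_on_0)

lemma CkLL_on_Suc:
  "CkLL_on (Suc k) U f \<longleftrightarrow> continuous_on U f \<and>
     (\<forall>b\<in>Basis. \<forall>x\<in>U. (\<lambda>t. f (x + t *\<^sub>R b)) differentiable (at 0)) \<and>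
     (\<forall>b\<in>Basis. CkLL_on k U (partial_derivative b f))"
  unfolding CkLL_on_def Ck_on_Suc all_lists_eq_Suc
  by (auto simp: iterated_partial_snoc)

lemma Ck_on_mono: "Ck_on k U f \<Longrightarrow> j \<le> k \<Longrightarrow> Ck_on j U f"
  by (auto simp: Ck_on_def)

lemma locally_log_lipschitz_on_subset:
  assumes "locally_log_lipschitz_on U f" "N \<subseteq> U"
  shows "locally_log_lipschitz_on N f"
  unfolding locally_log_lipschitz_on_def
proof
  fix p assume "p \<in> N"
  then obtain M where M: "open M" "p \<in> M" "log_lipschitz_on (U \<inter> M) f"
    using assms unfolding locally_log_lipschitz_on_def by blast
  have "log_lipschitz_on (N \<inter> M) f"
  proof -
    obtain C where "C > 0" "\<And>x y. x \<in> U \<inter> M \<Longrightarrow> y \<in> U \<inter> M \<Longrightarrow> x \<noteq> y \<and> dist x y \<le> 1/2 \<Longrightarrow>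
        dist (f x) (f y) \<le> C * dist x y * \<bar>ln (dist x y)\<bar>"
      using M(3) unfolding log_lipschitz_on_def by metis
    then show ?thesis
      using assms(2) unfolding log_lipschitz_on_def by (intro exI[of _ C]) (simp add: subset_iff)
  qed
  then show "\<exists>M. open M \<and> p \<in> M \<and> log_lipschitz_on (N \<inter> M) f" using M by blast
qed

lemma CkLL_on_subset: "CkLL_on k U f \<Longrightarrow> N \<subseteq> U \<Longrightarrow> CkLL_on k N f"
proof (induction k arbitrary: f)
  case 0
  then show ?case
    using locally_log_lipschitz_on_subset continuous_on_subset by (auto simp: CkLL_on_0)
next
  case (Suc k)
  then show ?case
    using continuous_on_subset[of U f N] by (simp add: CkLL_on_Suc subset_iff)
qed

lemma has_derivative_partial:
  assumes "(f has_derivative f') (at x)"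
  shows "((\<lambda>t. f (x + t *\<^sub>R b)) has_vector_derivative f' b) (at 0)"
proof -
  have "((\<lambda>t. f (x + t *\<^sub>R b)) has_derivative (\<lambda>t. f' (t *\<^sub>R b))) (at 0)"
    by (rule has_derivative_compose[where g = f and x = 0 and s = UNIV and f = "\<lambda>t. x + t *\<^sub>R b", simplified])
      (auto intro!: derivative_eq_intros assms)
  then show ?thesis
    using linear_scale[OF has_derivative_linear[OF assms]] by (simp add: has_vector_derivative_def)
qed

lemma partial_derivative_eq:
  "(f has_derivative f') (at x) \<Longrightarrow> partial_derivative b f x = f' b"
  unfolding partial_derivative_def by (rule vector_derivative_at[OF has_derivative_partial])

lemma partial_derivative_cong:
  assumes "open U" "x \<in> U" "\<And>y. y \<in> U \<Longrightarrow> f y = g y"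
  shows "partial_derivative b f x = partial_derivative b g x"
    and "(\<lambda>t. f (x + t *\<^sub>R b)) differentiable (at 0) \<longleftrightarrow> (\<lambda>t. g (x + t *\<^sub>R b)) differentiable (at 0)"
proof -
  have "((\<lambda>t. x + t *\<^sub>R b) \<longlongrightarrow> x + 0 *\<^sub>R b) (at 0)"
    by (intro tendsto_intros)
  then have "\<forall>\<^sub>F t in at 0. x + t *\<^sub>R b \<in> U"
    using assms(1,2) topological_tendstoD by fastforce
  \<comment> \<open>The unpunctured neighbourhood filter is used because a derivative at
    \<open>0\<close> also depends on the value at \<open>0\<close>.\<close>
  then have ev: "\<forall>\<^sub>F t in nhds 0. f (x + t *\<^sub>R b) = g (x + t *\<^sub>R b)"
    using assms(2,3) by (simp add: eventually_nhds_conv_at eventually_mono)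
  have *: "((\<lambda>t. f (x + t *\<^sub>R b)) has_derivative D) (at 0) \<longleftrightarrow>
      ((\<lambda>t. g (x + t *\<^sub>R b)) has_derivative D) (at 0)" for D
    using ev has_derivative_transform_eventually[of _ D 0 UNIV]
    unfolding eventually_nhds_conv_at by (auto simp: eq_commute)
  \<comment> \<open>\<open>vector_derivative\<close> chooses among the vectors satisfying a
    predicate; equal predicates give equal choices even where no derivative exists.\<close>
  show "partial_derivative b f x = partial_derivative b g x"
    unfolding partial_derivative_def vector_derivative_def has_vector_derivative_def * ..
  show "(\<lambda>t. f (x + t *\<^sub>R b)) differentiable (at 0) \<longleftrightarrow> (\<lambda>t. g (x + t *\<^sub>R b)) differentiable (at 0)"
    unfolding differentiable_def * ..
qed

lemma Ck_on_cong:
  assumes "open U" "\<And>x. x \<in> U \<Longrightarrow> f x = g x" "Ck_on k U f"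
  shows "Ck_on k U g"
  using assms(2,3)
proof (induction k arbitrary: f g)
  case 0
  then show ?case by (simp add: Ck_on_0 cong: continuous_on_cong)
next
  case (Suc k)
  have "Ck_on k U (partial_derivative b g)" if "b \<in> Basis" for b
    by (rule Suc.IH[of "partial_derivative b f"])
      (use Suc.prems that partial_derivative_cong(1)[OF assms(1), of _ f g] in \<open>simp_all add: Ck_on_Suc\<close>)
  then show ?case
    using Suc.prems partial_derivative_cong(2)[OF assms(1), of _ f g]
    by (simp add: Ck_on_Suc cong: continuous_on_cong)
qed

lemma locally_log_lipschitz_on_cong:
  assumes "\<And>x. x \<in> U \<Longrightarrow> f x = g x" "locally_log_lipschitz_on U f"
  shows "locally_log_lipschitz_on U g"
  using assms unfolding locally_log_lipschitz_on_def log_lipschitz_on_def by simp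

lemma CkLL_on_cong:
  assumes "open U" "\<And>x. x \<in> U \<Longrightarrow> f x = g x" "CkLL_on k U f"
  shows "CkLL_on k U g"
  using assms(2,3)
proof (induction k arbitrary: f g)
  case 0
  then show ?case
    using locally_log_lipschitz_on_cong by (simp add: CkLL_on_0 cong: continuous_on_cong) blast
next
  case (Suc k)
  have "CkLL_on k U (partial_derivative b g)" if "b \<in> Basis" for b
    by (rule Suc.IH[of "partial_derivative b f"])
      (use Suc.prems that partial_derivative_cong(1)[OF assms(1), of _ f g] in \<open>simp_all add: CkLL_on_Suc\<close>)
  then show ?case
    using Suc.prems partial_derivative_cong(2)[OF assms(1), of _ f g]
    by (simp add: CkLL_on_Suc cong: continuous_on_cong)
qed

section \<open>Total differentiability from continuous partial derivatives\<close>

lemma norm_partial_sum_le: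
  fixes h :: "'a::euclidean_space"
  assumes "S \<subseteq> Basis"
  shows "norm (\<Sum>b\<in>S. (h \<bullet> b) *\<^sub>R b) \<le> real (card S) * norm h"
proof -
  have "norm (\<Sum>b\<in>S. (h \<bullet> b) *\<^sub>R b) \<le> (\<Sum>b\<in>S. norm h)"
    using assms by (intro order_trans[OF norm_sum] sum_mono) (auto simp: Basis_le_norm subset_iff)
  then show ?thesis by simp
qed

text \<open>The increments of the coordinates are taken one at a time, and each one is handled by the
  mean value inequality along a line.\<close>

lemma partial_increments_estimate:
  fixes f :: "'a::euclidean_space \<Rightarrow> 'b::real_normed_vector"
  assumes "open U" "x \<in> U" "finite S" "S \<subseteq> Basis" "e > 0"
    and diff: "\<And>b y. b \<in> Basis \<Longrightarrow> y \<in> U \<Longrightarrow> ((\<lambda>t. f (y + t *\<^sub>R b)) has_vector_derivative g b y) (at 0)"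
    and cont: "\<And>b. b \<in> Basis \<Longrightarrow> continuous_on U (g b)"
  shows "\<exists>r>0. \<forall>y h. dist y x < r \<and> norm h < r \<longrightarrow>
    norm (f (y + (\<Sum>b\<in>S. (h \<bullet> b) *\<^sub>R b)) - f y - (\<Sum>b\<in>S. (h \<bullet> b) *\<^sub>R g b x)) \<le> e * norm h"
  using assms(3-5)
proof (induction S arbitrary: e)
  case empty
  then show ?case by (auto intro!: exI[of _ 1])
next
  case (insert c S)
  then have c: "c \<in> Basis" "S \<subseteq> Basis" by auto
  obtain r1 where r1: "r1 > 0" and IH: "\<And>y h. dist y x < r1 \<Longrightarrow> norm h < r1 \<Longrightarrow>
      norm (f (y + (\<Sum>b\<in>S. (h \<bullet> b) *\<^sub>R b)) - f y - (\<Sum>b\<in>S. (h \<bullet> b) *\<^sub>R g b x)) \<le> e/2 * norm h"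
    using insert.IH[of "e/2"] c insert.prems(2) by auto
  have "\<forall>\<^sub>F z in nhds x. z \<in> U"
    using assms(1,2) eventually_nhds by blast
  moreover have "\<forall>\<^sub>F z in nhds x. dist (g c z) (g c x) < e/2"
    using cont[OF c(1)] assms(1,2) half_gt_zero[OF insert.prems(2)]
    by (simp add: continuous_on_eq_continuous_at continuous_at tendsto_iff eventually_nhds_conv_at
        del: less_divide_eq_numeral1)
  ultimately have "\<forall>\<^sub>F z in nhds x. z \<in> U \<and> dist (g c z) (g c x) < e/2"
    by eventually_elim simp
  then obtain r2 where r2: "r2 > 0" and near: "\<And>z. dist z x < r2 \<Longrightarrow> z \<in> U \<and> dist (g c z) (g c x) < e/2"
    unfolding eventually_nhds_metric by blast
  \<comment> \<open>The points met below differ from \<open>x\<close> by at most \<open>r\<close>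
    (from \<open>y\<close>), \<open>card S * r\<close> (from the earlier coordinates) and
    \<open>r\<close> (from the last one); the divisor \<open>card S + 3\<close> makes the total
    strictly less than \<open>r2\<close>.\<close>
  define r where "r = min r1 (r2 / (real (card S) + 3))"
  have r: "r > 0" "r \<le> r1" "(real (card S) + 3) * r \<le> r2"
  proof -
    have "(real (card S) + 3) * r \<le> (real (card S) + 3) * (r2 / (real (card S) + 3))"
      unfolding r_def by (intro mult_left_mono) auto
    moreover have "(real (card S) + 3) * (r2 / (real (card S) + 3)) = r2" by simp
    ultimately show "(real (card S) + 3) * r \<le> r2" by simp
  qed (use r1 r2 in \<open>auto simp: r_def\<close>)
  have "norm (f (y + (\<Sum>b\<in>insert c S. (h \<bullet> b) *\<^sub>R b)) - f y - (\<Sum>b\<in>insert c S. (h \<bullet> b) *\<^sub>R g b x)) \<le> e * norm h"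
    if yh: "dist y x < r" "norm h < r" for y h
  proof -
    define z where "z = y + (\<Sum>b\<in>S. (h \<bullet> b) *\<^sub>R b)"
    \<comment> \<open>Subtracting the expected linear growth leaves a function whose derivative is
      the oscillation of \<open>g c\<close>, at most \<open>e/2\<close> near
      \<open>x\<close>.\<close>
    define \<phi> where "\<phi> t = f (z + t *\<^sub>R c) - t *\<^sub>R g c x" for t
    define a where "a = h \<bullet> c"
    have a: "\<bar>a\<bar> \<le> norm h" unfolding a_def using c(1) by (simp add: Basis_le_norm)
    have zt: "dist (z + t *\<^sub>R c) x < r2" if "t \<in> closed_segment 0 a" for t
    proof -
      have "\<bar>t\<bar> \<le> \<bar>a\<bar>" using that by (auto simp: closed_segment_eq_real_ivl split: if_splits)
      have "dist (z + t *\<^sub>R c) x = norm ((y - x) + (\<Sum>b\<in>S. (h \<bullet> b) *\<^sub>R b) + t *\<^sub>R c)"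
        by (simp add: z_def dist_norm algebra_simps)
      also have "\<dots> \<le> norm (y - x) + norm (\<Sum>b\<in>S. (h \<bullet> b) *\<^sub>R b) + norm (t *\<^sub>R c)"
        by (intro order_trans[OF norm_triangle_ineq] add_right_mono norm_triangle_ineq)
      also have "\<dots> \<le> r + real (card S) * r + r"
      proof (intro add_mono)
        show "norm (\<Sum>b\<in>S. (h \<bullet> b) *\<^sub>R b) \<le> real (card S) * r"
          using norm_partial_sum_le[OF c(2), of h] yh
          by (meson less_eq_real_def mult_left_mono of_nat_0_le_iff order_trans)
      qed (use yh \<open>\<bar>t\<bar> \<le> \<bar>a\<bar>\<close> a c(1) in \<open>auto simp: dist_norm\<close>)
      also have "\<dots> < r2" using r by (simp add: algebra_simps)
      finally show ?thesis .
    qed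
    have "norm (\<phi> a - \<phi> 0) \<le> e/2 * norm (a - 0)"
    proof (rule differentiable_bound[of "closed_segment 0 a" \<phi> "\<lambda>t s. s *\<^sub>R (g c (z + t *\<^sub>R c) - g c x)"])
      fix t assume t: "t \<in> closed_segment 0 a"
      have "((\<lambda>s. f ((z + t *\<^sub>R c) + (s - t) *\<^sub>R c)) has_vector_derivative g c (z + t *\<^sub>R c)) (at t)"
      proof -
        have "((\<lambda>s. s - t) has_vector_derivative 1) (at t)"
          by (auto intro!: derivative_eq_intros)
        moreover have "((\<lambda>s. f ((z + t *\<^sub>R c) + s *\<^sub>R c)) has_vector_derivative g c (z + t *\<^sub>R c)) (at (t - t))"
          using diff[OF c(1), of "z + t *\<^sub>R c"] near[OF zt[OF t]] by simp
        ultimately show ?thesis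
          using vector_diff_chain_at[of "\<lambda>s. s - t" 1 t "\<lambda>s. f ((z + t *\<^sub>R c) + s *\<^sub>R c)"]
          by (simp add: o_def)
      qed
      then have "((\<lambda>s. f (z + s *\<^sub>R c)) has_vector_derivative g c (z + t *\<^sub>R c)) (at t)"
        by (simp add: algebra_simps)
      then have "(\<phi> has_vector_derivative (g c (z + t *\<^sub>R c) - g c x)) (at t)"
        unfolding \<phi>_def by (auto intro!: derivative_eq_intros)
      then show "(\<phi> has_derivative (\<lambda>s. s *\<^sub>R (g c (z + t *\<^sub>R c) - g c x))) (at t within closed_segment 0 a)"
        unfolding has_vector_derivative_def using has_derivative_at_withinI by blast
      show "onorm (\<lambda>s. s *\<^sub>R (g c (z + t *\<^sub>R c) - g c x)) \<le> e / 2"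
      proof (rule onorm_bound)
        show "norm (s *\<^sub>R (g c (z + t *\<^sub>R c) - g c x)) \<le> e / 2 * norm s" for s :: real
          using near[OF zt[OF t]] mult_left_mono[of "dist (g c (z + t *\<^sub>R c)) (g c x)" "e/2" "\<bar>s\<bar>"]
          by (simp add: dist_norm mult.commute)
      qed (use insert.prems in auto)
    qed auto
    moreover have "\<phi> a - \<phi> 0 = f (z + a *\<^sub>R c) - f z - a *\<^sub>R g c x"
      by (simp add: \<phi>_def)
    moreover have "e/2 * norm (a - 0) \<le> e/2 * norm h"
      using a insert.prems(2) by (intro mult_left_mono) auto
    ultimately have 1: "norm (f (z + a *\<^sub>R c) - f z - a *\<^sub>R g c x) \<le> e/2 * norm h"
      by simp
    have 2: "norm (f z - f y - (\<Sum>b\<in>S. (h \<bullet> b) *\<^sub>R g b x)) \<le> e/2 * norm h"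
      unfolding z_def using IH[of y h] yh r by simp
    have "f (y + (\<Sum>b\<in>insert c S. (h \<bullet> b) *\<^sub>R b)) - f y - (\<Sum>b\<in>insert c S. (h \<bullet> b) *\<^sub>R g b x)
       = (f (z + a *\<^sub>R c) - f z - a *\<^sub>R g c x) + (f z - f y - (\<Sum>b\<in>S. (h \<bullet> b) *\<^sub>R g b x))"
      using insert.hyps by (simp add: z_def a_def algebra_simps)
    then show ?thesis
      using norm_triangle_le[OF order_trans[OF add_mono[OF 1 2]], of "e * norm h"] by (simp only:)
  qed
  then show ?case using r(1) by blast
qed

text \<open>Over the full basis the coordinate increments add up to the whole increment, so the
  preceding estimate becomes the definition of the total derivative.\<close>

lemma Ck_on_1_has_derivative:
  fixes f :: "'a::euclidean_space \<Rightarrow> 'b::real_normed_vector"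
  assumes "open U" "Ck_on 1 U f" "x \<in> U"
  shows "(f has_derivative (\<lambda>h. \<Sum>b\<in>Basis. (h \<bullet> b) *\<^sub>R partial_derivative b f x)) (at x)"
  unfolding has_derivative_at_alt
proof (intro conjI allI impI)
  fix e :: real assume "e > 0"
  have "((\<lambda>t. f (y + t *\<^sub>R b)) has_vector_derivative partial_derivative b f y) (at 0)"
    if "b \<in> Basis" "y \<in> U" for b y
    using assms(2) that unfolding Ck_on_1 partial_derivative_def by (simp add: vector_derivative_works)
  then obtain r where "r > 0" and r: "\<And>y h. dist y x < r \<Longrightarrow> norm h < r \<Longrightarrow>
    norm (f (y + (\<Sum>b\<in>Basis. (h \<bullet> b) *\<^sub>R b)) - f y - (\<Sum>b\<in>Basis. (h \<bullet> b) *\<^sub>R partial_derivative b f x)) \<le> e * norm h"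
    using partial_increments_estimate[OF assms(1,3) finite_Basis order_refl \<open>e > 0\<close>, of f "\<lambda>b. partial_derivative b f"]
      assms(2) unfolding Ck_on_1 by blast
  have "norm (f y - f x - (\<Sum>b\<in>Basis. ((y - x) \<bullet> b) *\<^sub>R partial_derivative b f x)) \<le> e * norm (y - x)"
    if "norm (y - x) < r" for y
    using r[of x "y - x"] that \<open>r > 0\<close> by (simp add: euclidean_representation)
  then show "\<exists>r>0. \<forall>y. norm (y - x) < r \<longrightarrow>
      norm (f y - f x - (\<Sum>b\<in>Basis. ((y - x) \<bullet> b) *\<^sub>R partial_derivative b f x)) \<le> e * norm (y - x)"
    using \<open>r > 0\<close> by blast
qed (intro bounded_linear_sum bounded_linear_scaleR_left[THEN bounded_linear_compose] bounded_linear_inner_left)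

lemma Ck_on_SucI:
  assumes "open U" "\<And>x. x \<in> U \<Longrightarrow> (f has_derivative f' x) (at x)"
    and "\<And>b. b \<in> Basis \<Longrightarrow> Ck_on k U (\<lambda>x. f' x b)"
  shows "Ck_on (Suc k) U f"
  unfolding Ck_on_Suc
proof (intro conjI ballI)
  show "continuous_on U f"
    using assms(2) has_derivative_continuous by (blast intro: continuous_at_imp_continuous_on)
  show "(\<lambda>t. f (x + t *\<^sub>R b)) differentiable at 0" if "x \<in> U" for b x
    using has_derivative_partial[OF assms(2)[OF that]] by (rule differentiableI_vector)
  show "Ck_on k U (partial_derivative b f)" if "b \<in> Basis" for b
    by (rule Ck_on_cong[OF assms(1) _ assms(3)[OF that]]) (simp add: partial_derivative_eq[OF assms(2)])
qed

text \<open>The induction step of the closure properties: a total derivative, supplied by the usual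
  differentiation rules, has to be examined at basis vectors only.\<close>

lemma CkLL_on_SucI:
  assumes "open U" "\<And>x. x \<in> U \<Longrightarrow> (f has_derivative f' x) (at x)"
    and "\<And>b. b \<in> Basis \<Longrightarrow> CkLL_on k U (\<lambda>x. f' x b)"
  shows "CkLL_on (Suc k) U f"
  unfolding CkLL_on_Suc
proof (intro conjI ballI)
  show "continuous_on U f"
    using assms(2) has_derivative_continuous by (blast intro: continuous_at_imp_continuous_on)
  show "(\<lambda>t. f (x + t *\<^sub>R b)) differentiable at 0" if "x \<in> U" for b x
    using has_derivative_partial[OF assms(2)[OF that]] by (rule differentiableI_vector)
  show "CkLL_on k U (partial_derivative b f)" if "b \<in> Basis" for b
    by (rule CkLL_on_cong[OF assms(1) _ assms(3)[OF that]]) (simp add: partial_derivative_eq[OF assms(2)])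
qed

lemma CkLL_on_SucD:
  assumes "CkLL_on (Suc k) U f"
  shows "Ck_on 1 U f" "b \<in> Basis \<Longrightarrow> CkLL_on k U (partial_derivative b f)" "continuous_on U f"
proof -
  show "Ck_on 1 U f"
    using assms Ck_on_mono[of "Suc k" U f 1] by (simp add: CkLL_on_def)
qed (use assms in \<open>simp_all add: CkLL_on_Suc\<close>)

section \<open>Lipschitz and log-Lipschitz bounds\<close>

lemma Ck_on_1_locally_lipschitz:
  fixes f :: "'a::euclidean_space \<Rightarrow> 'b::real_normed_vector"
  assumes "open U" "Ck_on 1 U f" "x \<in> U"
  obtains r C where "r > 0" "ball x r \<subseteq> U" "C > 0"
    "\<And>y z. y \<in> ball x r \<Longrightarrow> z \<in> ball x r \<Longrightarrow> dist (f y) (f z) \<le> C * dist y z"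
proof -
  define D where "D y h = (\<Sum>b\<in>Basis. (h \<bullet> b) *\<^sub>R partial_derivative b f y)" for y h
  \<comment> \<open>\<open>m y\<close> bounds the operator norm of the derivative at
    \<open>y\<close>. By continuity it stays below \<open>m x + 1\<close> on a ball, whose convexity
    permits the mean value inequality.\<close>
  define m where "m y = (\<Sum>b\<in>Basis. norm (partial_derivative b f y))" for y
  have "continuous_on U m"
    using assms(2) unfolding Ck_on_1 m_def by (intro continuous_intros) auto
  then have "\<forall>\<^sub>F y in nhds x. dist (m y) (m x) < 1"
    using assms(1,3) by (simp add: continuous_on_eq_continuous_at continuous_at tendsto_iff eventually_nhds_conv_at)
  moreover have "\<forall>\<^sub>F y in nhds x. y \<in> U"
    using assms(1,3) eventually_nhds by blast
  ultimately have "\<forall>\<^sub>F y in nhds x. y \<in> U \<and> dist (m y) (m x) < 1"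
    by eventually_elim simp
  then obtain r where r: "r > 0" "\<And>y. dist y x < r \<Longrightarrow> y \<in> U \<and> dist (m y) (m x) < 1"
    unfolding eventually_nhds_metric by blast
  have m0: "m x \<ge> 0" unfolding m_def by (simp add: sum_nonneg)
  have "dist (f y) (f z) \<le> (m x + 1) * dist y z" if "y \<in> ball x r" "z \<in> ball x r" for y z
    unfolding dist_norm
  proof (rule differentiable_bound[of "ball x r" f D])
    fix w assume w: "w \<in> ball x r"
    then have wU: "w \<in> U" and mw: "m w \<le> m x + 1"
      using r(2)[of w] by (auto simp: dist_commute dist_real_def)
    show "(f has_derivative D w) (at w within ball x r)"
      unfolding D_def using Ck_on_1_has_derivative[OF assms(1,2) wU] has_derivative_at_withinI by blast
    show "onorm (D w) \<le> m x + 1"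
    proof (rule onorm_bound)
      fix h
      have "norm (D w h) \<le> (\<Sum>b\<in>Basis. norm h * norm (partial_derivative b f w))"
        unfolding D_def by (intro order_trans[OF norm_sum] sum_mono) (simp add: Basis_le_norm mult_right_mono)
      also have "\<dots> = m w * norm h" by (simp add: m_def sum_distrib_left mult.commute)
      also have "\<dots> \<le> (m x + 1) * norm h" using mw by (simp add: mult_right_mono)
      finally show "norm (D w h) \<le> (m x + 1) * norm h" .
    qed (use m0 in simp)
  qed (use that in auto)
  with r m0 show ?thesis
    by (intro that[of r "m x + 1"]) (auto simp: dist_commute)
qed

text \<open>The cutoff at distance 1/2 keeps the logarithm away from its zero at 1, so a Lipschitz
  bound becomes a log-Lipschitz bound with twice the constant.\<close>

lemma le_abs_ln: "0 < (u::real) \<Longrightarrow> u \<le> 1/2 \<Longrightarrow> 1/2 \<le> \<bar>ln u\<bar>"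
proof -
  assume u: "0 < u" "u \<le> 1/2"
  have "ln u \<le> u - 1" using u by (intro ln_le_minus_one)
  with u show ?thesis by linarith
qed

lemma Ck_on_1_locally_log_lipschitz:
  fixes f :: "'a::euclidean_space \<Rightarrow> 'b::real_normed_vector"
  assumes "open U" "Ck_on 1 U f"
  shows "locally_log_lipschitz_on U f"
  unfolding locally_log_lipschitz_on_def
proof
  fix x assume "x \<in> U"
  obtain r C where r: "r > 0" "ball x r \<subseteq> U" "C > 0"
    and L: "\<And>y z. y \<in> ball x r \<Longrightarrow> z \<in> ball x r \<Longrightarrow> dist (f y) (f z) \<le> C * dist y z"
    using Ck_on_1_locally_lipschitz[OF assms \<open>x \<in> U\<close>] by blast
  have "dist (f y) (f z) \<le> 2 * C * dist y z * \<bar>ln (dist y z)\<bar>"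
    if "y \<in> ball x r" "z \<in> ball x r" "y \<noteq> z" "dist y z \<le> 1/2" for y z
  proof -
    have "C * dist y z * (2 * (1/2)) \<le> C * dist y z * (2 * \<bar>ln (dist y z)\<bar>)"
      using le_abs_ln[of "dist y z"] that r by (intro mult_left_mono) auto
    then show ?thesis using L[OF that(1,2)] by (simp add: algebra_simps)
  qed
  then have "log_lipschitz_on (U \<inter> ball x r) f"
    unfolding log_lipschitz_on_def using r by (intro exI[of _ "2 * C"]) auto
  then show "\<exists>N. open N \<and> x \<in> N \<and> log_lipschitz_on (U \<inter> N) f"
    using r by (intro exI[of _ "ball x r"]) auto
qed

text \<open>The log-Lipschitz condition is imposed at the top order only. One order lower the
  derivatives are \<open>C^1\<close>, hence locally Lipschitz, and so satisfy it as well.\<close>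

lemma CkLL_on_SucD':
  fixes f :: "'a::euclidean_space \<Rightarrow> 'b::real_normed_vector"
  assumes "open U" "CkLL_on (Suc k) U f"
  shows "CkLL_on k U f"
  using assms(2)
proof (induction k arbitrary: f)
  case 0
  then show ?case
    using Ck_on_1_locally_log_lipschitz[OF assms(1)] CkLL_on_SucD by (auto simp: CkLL_on_0)
next
  case (Suc k)
  then show ?case by (subst CkLL_on_Suc) (auto simp: CkLL_on_Suc[of "Suc k"])
qed

lemma CkLL_on_mono:
  fixes f :: "'a::euclidean_space \<Rightarrow> 'b::real_normed_vector"
  assumes "open U" "CkLL_on k U f" "j \<le> k"
  shows "CkLL_on j U f"
  using assms(3,2) by (induction rule: inc_induct) (auto intro: CkLL_on_SucD'[OF assms(1)])

lemma CkLL_on_locally_log_lipschitz: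
  fixes f :: "'a::euclidean_space \<Rightarrow> 'b::real_normed_vector"
  assumes "open U" "CkLL_on k U f"
  shows "locally_log_lipschitz_on U f"
  using assms Ck_on_1_locally_log_lipschitz[OF assms(1) CkLL_on_SucD(1)]
  by (cases k) (simp_all add: CkLL_on_0)

lemma CkLL_on_continuous: "CkLL_on k U f \<Longrightarrow> continuous_on U f"
  by (cases k) (auto simp: CkLL_on_0 CkLL_on_Suc)

text \<open>Positivity of the constant is not asked for: \<open>max C 1\<close> restores it, so zero
  and compound constants can be supplied directly.\<close>

lemma locally_log_lipschitz_onI:
  assumes "\<And>p. p \<in> U \<Longrightarrow> \<exists>C. \<exists>N. open N \<and> p \<in> N \<and> (\<forall>x\<in>U \<inter> N. \<forall>y\<in>U \<inter> N. x \<noteq> y \<and> dist x y \<le> 1/2 \<longrightarrow>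
     dist (f x) (f y) \<le> C * (dist x y * \<bar>ln (dist x y)\<bar>))"
  shows "locally_log_lipschitz_on U f"
  unfolding locally_log_lipschitz_on_def log_lipschitz_on_def
proof
  fix p assume "p \<in> U"
  then obtain C N where N: "open N" "p \<in> N" and C: "\<And>x y. x\<in>U \<inter> N \<Longrightarrow> y\<in>U \<inter> N \<Longrightarrow> x \<noteq> y \<Longrightarrow> dist x y \<le> 1/2 \<Longrightarrow>
     dist (f x) (f y) \<le> C * (dist x y * \<bar>ln (dist x y)\<bar>)"
    using assms[OF \<open>p \<in> U\<close>] by (elim exE conjE) auto
  have "dist (f x) (f y) \<le> max C 1 * dist x y * \<bar>ln (dist x y)\<bar>"
    if "x\<in>U \<inter> N" "y\<in>U \<inter> N" "x \<noteq> y" "dist x y \<le> 1/2" for x y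
    using C[OF that] mult_right_mono[of C "max C 1" "dist x y * \<bar>ln (dist x y)\<bar>"]
    by (simp add: mult.assoc)
  then show "\<exists>N. open N \<and> p \<in> N \<and>
      (\<exists>C>0. \<forall>x\<in>U \<inter> N. \<forall>y\<in>U \<inter> N. x \<noteq> y \<and> dist x y \<le> 1 / 2 \<longrightarrow> dist (f x) (f y) \<le> C * dist x y * \<bar>ln (dist x y)\<bar>)"
    using N by (intro exI[of _ N]) (auto intro!: exI[of _ "max C 1"])
qed

lemma locally_log_lipschitz_onE:
  assumes "locally_log_lipschitz_on U f" "p \<in> U"
  obtains C N where "C > 0" "open N" "p \<in> N"
    "\<And>x y. x \<in> U \<inter> N \<Longrightarrow> y \<in> U \<inter> N \<Longrightarrow> x \<noteq> y \<Longrightarrow> dist x y \<le> 1/2 \<Longrightarrow>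
       dist (f x) (f y) \<le> C * (dist x y * \<bar>ln (dist x y)\<bar>)"
  using assms unfolding locally_log_lipschitz_on_def log_lipschitz_on_def
  by (metis (no_types, lifting) mult.assoc)

lemma continuous_on_locally_bounded:
  fixes f :: "'a::topological_space \<Rightarrow> 'b::real_normed_vector"
  assumes "continuous_on U f" "p \<in> U"
  obtains N M where "open N" "p \<in> N" "M > 0" "\<And>x. x \<in> U \<inter> N \<Longrightarrow> norm (f x) \<le> M"
proof -
  have "open (ball (f p) 1)" by simp
  then obtain N where N: "open N" "N \<inter> U = f -` ball (f p) 1 \<inter> U"
    using assms(1) unfolding continuous_on_open_invariant by blast
  have "norm (f x) \<le> norm (f p) + 1" if "x \<in> U \<inter> N" for x
  proof -
    have "norm (f p - f x) < 1" using that N by (auto simp: dist_norm)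
    then show ?thesis using norm_triangle_ineq2[of "f x" "f p"] by (simp add: norm_minus_commute)
  qed
  moreover have "p \<in> N" using N assms(2) by auto
  moreover have "norm (f p) + 1 > 0" by (simp add: add_nonneg_pos)
  ultimately show ?thesis using that[of N "norm (f p) + 1"] N(1) by blast
qed

section \<open>Closure under algebraic operations, composition and inversion\<close>

lemma CkLL_on_const: "open U \<Longrightarrow> CkLL_on k U (\<lambda>x. c)"
proof (induction k arbitrary: c)
  case 0
  show ?case by (auto simp: CkLL_on_0 intro!: locally_log_lipschitz_onI exI[of _ 0] exI[of _ UNIV])
next
  case (Suc k)
  then show ?case by (intro CkLL_on_SucI[where f' = "\<lambda>x h. 0"]) auto
qed

lemma inner_Basis_sum_partials:
  fixes b :: "'a::euclidean_space" and g :: "'a \<Rightarrow> 'b::real_vector"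
  assumes "b \<in> Basis"
  shows "(\<Sum>c\<in>Basis. (b \<bullet> c) *\<^sub>R g c) = g b"
proof -
  have "(\<Sum>c\<in>Basis. (b \<bullet> c) *\<^sub>R g c) = (\<Sum>c\<in>Basis. if c = b then g c else 0)"
    using assms by (intro sum.cong) (auto simp: inner_Basis)
  then show ?thesis using assms by simp
qed

lemma (in bounded_linear) CkLL_on:
  assumes "open U" "CkLL_on k U g"
  shows "CkLL_on k U (\<lambda>x. f (g x))"
  using assms(2)
proof (induction k arbitrary: g)
  case 0
  have "locally_log_lipschitz_on U (\<lambda>x. f (g x))"
  proof (rule locally_log_lipschitz_onI)
    fix p assume "p \<in> U"
    then obtain C N where CN: "C > 0" "open N" "p \<in> N"
      and C: "\<And>x y. x \<in> U \<inter> N \<Longrightarrow> y \<in> U \<inter> N \<Longrightarrow> x \<noteq> y \<Longrightarrow> dist x y \<le> 1/2 \<Longrightarrow>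
        dist (g x) (g y) \<le> C * (dist x y * \<bar>ln (dist x y)\<bar>)"
      using 0 locally_log_lipschitz_onE by (metis CkLL_on_0)
    obtain K where K: "K > 0" "\<And>x. norm (f x) \<le> norm x * K" using pos_bounded by blast
    have "dist (f (g x)) (f (g y)) \<le> (C * K) * (dist x y * \<bar>ln (dist x y)\<bar>)"
      if "x \<in> U \<inter> N" "y \<in> U \<inter> N" "x \<noteq> y" "dist x y \<le> 1/2" for x y
    proof -
      have "dist (f (g x)) (f (g y)) \<le> dist (g x) (g y) * K"
        using K(2)[of "g x - g y"] by (simp add: dist_norm diff)
      also have "\<dots> \<le> C * (dist x y * \<bar>ln (dist x y)\<bar>) * K"
        using C[OF that] K(1) by (simp add: mult_right_mono)
      finally show ?thesis by (simp add: algebra_simps)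
    qed
    then show "\<exists>C N. open N \<and> p \<in> N \<and> (\<forall>x\<in>U \<inter> N. \<forall>y\<in>U \<inter> N. x \<noteq> y \<and> dist x y \<le> 1/2 \<longrightarrow>
        dist (f (g x)) (f (g y)) \<le> C * (dist x y * \<bar>ln (dist x y)\<bar>))"
      using CN(2,3) by blast
  qed
  then show ?case using 0 continuous_on by (auto simp: CkLL_on_0)
next
  case (Suc k)
  show ?case
  proof (rule CkLL_on_SucI[OF assms(1)])
    fix x assume "x \<in> U"
    show "((\<lambda>x. f (g x)) has_derivative (\<lambda>h. f (\<Sum>b\<in>Basis. (h \<bullet> b) *\<^sub>R partial_derivative b g x))) (at x)"
      by (rule has_derivative[OF Ck_on_1_has_derivative[OF assms(1) CkLL_on_SucD(1)[OF Suc.prems] \<open>x \<in> U\<close>]])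
  next
    fix b :: 'c assume b: "b \<in> Basis"
    show "CkLL_on k U (\<lambda>x. f (\<Sum>c\<in>Basis. (b \<bullet> c) *\<^sub>R partial_derivative c g x))"
      using Suc.IH[OF CkLL_on_SucD(2)[OF Suc.prems b]] b by (simp add: inner_Basis_sum_partials)
  qed
qed


lemma CkLL_on_add:
  fixes f g :: "'a::euclidean_space \<Rightarrow> 'b::real_normed_vector"
  assumes "open U" "CkLL_on k U f" "CkLL_on k U g"
  shows "CkLL_on k U (\<lambda>x. f x + g x)"
  using assms(2,3)
proof (induction k arbitrary: f g)
  case 0
  have "locally_log_lipschitz_on U (\<lambda>x. f x + g x)"
  proof (rule locally_log_lipschitz_onI)
    fix p assume "p \<in> U"
    have f: "locally_log_lipschitz_on U f" and g: "locally_log_lipschitz_on U g"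
      using 0 by (auto simp: CkLL_on_0)
    obtain C N where N: "open N" "p \<in> N"
      and C: "\<And>x y. x \<in> U \<inter> N \<Longrightarrow> y \<in> U \<inter> N \<Longrightarrow> x \<noteq> y \<Longrightarrow> dist x y \<le> 1/2 \<Longrightarrow>
        dist (f x) (f y) \<le> C * (dist x y * \<bar>ln (dist x y)\<bar>)"
      using locally_log_lipschitz_onE[OF f \<open>p \<in> U\<close>] by metis
    obtain C' N' where N': "open N'" "p \<in> N'"
      and C': "\<And>x y. x \<in> U \<inter> N' \<Longrightarrow> y \<in> U \<inter> N' \<Longrightarrow> x \<noteq> y \<Longrightarrow> dist x y \<le> 1/2 \<Longrightarrow>
        dist (g x) (g y) \<le> C' * (dist x y * \<bar>ln (dist x y)\<bar>)"
      using locally_log_lipschitz_onE[OF g \<open>p \<in> U\<close>] by metis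
    have "dist (f x + g x) (f y + g y) \<le> (C + C') * (dist x y * \<bar>ln (dist x y)\<bar>)"
      if "x \<in> U \<inter> (N \<inter> N')" "y \<in> U \<inter> (N \<inter> N')" "x \<noteq> y" "dist x y \<le> 1/2" for x y
      using C[of x y] C'[of x y] that dist_triangle_add[of "f x" "g x" "f y" "g y"]
      by (auto simp: algebra_simps)
    then show "\<exists>C N. open N \<and> p \<in> N \<and> (\<forall>x\<in>U \<inter> N. \<forall>y\<in>U \<inter> N. x \<noteq> y \<and> dist x y \<le> 1/2 \<longrightarrow>
        dist (f x + g x) (f y + g y) \<le> C * (dist x y * \<bar>ln (dist x y)\<bar>))"
      using N N' by (intro exI[of _ "C + C'"] exI[of _ "N \<inter> N'"]) auto
  qed
  then show ?case using 0 by (auto simp: CkLL_on_0 intro: continuous_on_add)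
next
  case (Suc k)
  show ?case
  proof (rule CkLL_on_SucI[OF assms(1)])
    fix x assume "x \<in> U"
    show "((\<lambda>x. f x + g x) has_derivative (\<lambda>h. (\<Sum>b\<in>Basis. (h \<bullet> b) *\<^sub>R partial_derivative b f x) +
        (\<Sum>b\<in>Basis. (h \<bullet> b) *\<^sub>R partial_derivative b g x))) (at x)"
      by (intro has_derivative_add Ck_on_1_has_derivative[OF assms(1) CkLL_on_SucD(1) \<open>x \<in> U\<close>]; rule Suc.prems)
  next
    fix b :: 'a assume b: "b \<in> Basis"
    show "CkLL_on k U (\<lambda>x. (\<Sum>c\<in>Basis. (b \<bullet> c) *\<^sub>R partial_derivative c f x) +
        (\<Sum>c\<in>Basis. (b \<bullet> c) *\<^sub>R partial_derivative c g x))"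
      using Suc.IH[OF CkLL_on_SucD(2)[OF Suc.prems(1) b] CkLL_on_SucD(2)[OF Suc.prems(2) b]] b
      by (simp add: inner_Basis_sum_partials)
  qed
qed

lemma CkLL_on_sum:
  fixes f :: "'i \<Rightarrow> 'a::euclidean_space \<Rightarrow> 'b::real_normed_vector"
  assumes "open U" "\<And>i. i \<in> I \<Longrightarrow> CkLL_on k U (f i)"
  shows "CkLL_on k U (\<lambda>x. \<Sum>i\<in>I. f i x)"
  using assms(2)
  by (induction I rule: infinite_finite_induct) (auto intro: CkLL_on_add CkLL_on_const assms(1))

text \<open>At order zero the increment of the product splits into two terms, each a log-Lipschitz
  increment times a locally bounded factor. In the induction step the undifferentiated factor of the
  product rule is used with one order of smoothness less.\<close>

lemma CkLL_on_bilinear: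
  fixes f :: "'a::euclidean_space \<Rightarrow> 'b::real_normed_vector" and g :: "'a \<Rightarrow> 'c::real_normed_vector"
    and m :: "'b \<Rightarrow> 'c \<Rightarrow> 'd::real_normed_vector" (infixl \<open>\<odot>\<close> 70)
  assumes "bounded_bilinear m" "open U" "CkLL_on k U f" "CkLL_on k U g"
  shows "CkLL_on k U (\<lambda>x. f x \<odot> g x)"
  using assms(3,4)
proof (induction k arbitrary: f g)
  case 0
  have "locally_log_lipschitz_on U (\<lambda>x. f x \<odot> g x)"
  proof (rule locally_log_lipschitz_onI)
    fix p assume "p \<in> U"
    have f: "locally_log_lipschitz_on U f" "continuous_on U f"
      and g: "locally_log_lipschitz_on U g" "continuous_on U g"
      using 0 by (auto simp: CkLL_on_0)
    obtain C N where N: "open N" "p \<in> N" "C > 0"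
      and C: "\<And>x y. x \<in> U \<inter> N \<Longrightarrow> y \<in> U \<inter> N \<Longrightarrow> x \<noteq> y \<Longrightarrow> dist x y \<le> 1/2 \<Longrightarrow>
        dist (f x) (f y) \<le> C * (dist x y * \<bar>ln (dist x y)\<bar>)"
      using locally_log_lipschitz_onE[OF f(1) \<open>p \<in> U\<close>] by metis
    obtain C' N' where N': "open N'" "p \<in> N'" "C' > 0"
      and C': "\<And>x y. x \<in> U \<inter> N' \<Longrightarrow> y \<in> U \<inter> N' \<Longrightarrow> x \<noteq> y \<Longrightarrow> dist x y \<le> 1/2 \<Longrightarrow>
        dist (g x) (g y) \<le> C' * (dist x y * \<bar>ln (dist x y)\<bar>)"
      using locally_log_lipschitz_onE[OF g(1) \<open>p \<in> U\<close>] by metis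
    obtain B M where B: "open B" "p \<in> B" "M > 0" "\<And>x. x \<in> U \<inter> B \<Longrightarrow> norm (f x) \<le> M"
      using continuous_on_locally_bounded[OF f(2) \<open>p \<in> U\<close>] by metis
    obtain B' M' where B': "open B'" "p \<in> B'" "M' > 0" "\<And>x. x \<in> U \<inter> B' \<Longrightarrow> norm (g x) \<le> M'"
      using continuous_on_locally_bounded[OF g(2) \<open>p \<in> U\<close>] by metis
    obtain K where K: "K > 0" "\<And>a b. norm (a \<odot> b) \<le> norm a * norm b * K" using bounded_bilinear.pos_bounded[OF assms(1)] by blast
    have "dist (f x \<odot> g x) (f y \<odot> g y) \<le> (C * M' * K + M * C' * K) * (dist x y * \<bar>ln (dist x y)\<bar>)"
      if xy: "x \<in> U \<inter> (N \<inter> N' \<inter> B \<inter> B')" "y \<in> U \<inter> (N \<inter> N' \<inter> B \<inter> B')" "x \<noteq> y" "dist x y \<le> 1/2" for x y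
    proof -
      define L where "L = dist x y * \<bar>ln (dist x y)\<bar>"
      have L: "L \<ge> 0" by (simp add: L_def)
      have nf: "norm (f x - f y) \<le> C * L" and ng: "norm (g x - g y) \<le> C' * L"
        using C[of x y] C'[of x y] xy by (auto simp: L_def dist_norm)
      have "f x \<odot> g x - f y \<odot> g y = (f x - f y) \<odot> g x + f y \<odot> (g x - g y)"
        by (simp add: bounded_bilinear.diff_left[OF assms(1)] bounded_bilinear.diff_right[OF assms(1)])
      then have "dist (f x \<odot> g x) (f y \<odot> g y) \<le>
          norm (f x - f y) * norm (g x) * K + norm (f y) * norm (g x - g y) * K"
        using norm_triangle_le[OF add_mono[OF K(2) K(2)]] by (simp add: dist_norm)
      also have "\<dots> \<le> (C * L) * M' * K + M * (C' * L) * K"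
        using nf ng B(3) B(4)[of y] B'(3) B'(4)[of x] xy N N' K(1) L
        by (intro add_mono mult_right_mono mult_mono) auto
      finally show ?thesis by (simp add: L_def algebra_simps)
    qed
    then show "\<exists>C N. open N \<and> p \<in> N \<and> (\<forall>x\<in>U \<inter> N. \<forall>y\<in>U \<inter> N. x \<noteq> y \<and> dist x y \<le> 1/2 \<longrightarrow>
        dist (f x \<odot> g x) (f y \<odot> g y) \<le> C * (dist x y * \<bar>ln (dist x y)\<bar>))"
      using N N' B B'
      by (intro exI[of _ "C * M' * K + M * C' * K"] exI[of _ "N \<inter> N' \<inter> B \<inter> B'"]) auto
  qed
  then show ?case using 0 by (auto simp: CkLL_on_0 intro: bounded_bilinear.continuous_on[OF assms(1)])
next
  case (Suc k)
  show ?case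
  proof (rule CkLL_on_SucI[OF assms(2)])
    fix x assume "x \<in> U"
    show "((\<lambda>x. f x \<odot> g x) has_derivative (\<lambda>h. f x \<odot> (\<Sum>b\<in>Basis. (h \<bullet> b) *\<^sub>R partial_derivative b g x) +
        (\<Sum>b\<in>Basis. (h \<bullet> b) *\<^sub>R partial_derivative b f x) \<odot> g x)) (at x)"
      by (intro bounded_bilinear.FDERIV[OF assms(1)] Ck_on_1_has_derivative[OF assms(2) CkLL_on_SucD(1) \<open>x \<in> U\<close>];
          rule Suc.prems)
  next
    fix b :: 'a assume b: "b \<in> Basis"
    show "CkLL_on k U (\<lambda>x. f x \<odot> (\<Sum>c\<in>Basis. (b \<bullet> c) *\<^sub>R partial_derivative c g x) +
        (\<Sum>c\<in>Basis. (b \<bullet> c) *\<^sub>R partial_derivative c f x) \<odot> g x)"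
      unfolding inner_Basis_sum_partials[OF b]
      using CkLL_on_SucD'[OF assms(2) Suc.prems(1)] CkLL_on_SucD'[OF assms(2) Suc.prems(2)]
        CkLL_on_SucD(2)[OF Suc.prems(1) b] CkLL_on_SucD(2)[OF Suc.prems(2) b]
      by (intro CkLL_on_add[OF assms(2)] Suc.IH)
  qed
qed

lemma CkLL_on_prod:
  fixes f :: "'i \<Rightarrow> 'a::euclidean_space \<Rightarrow> real"
  assumes "open U" "\<And>i. i \<in> I \<Longrightarrow> CkLL_on k U (f i)"
  shows "CkLL_on k U (\<lambda>x. \<Prod>i\<in>I. f i x)"
  using assms(2)
  by (induction I rule: infinite_finite_induct)
    (auto intro: CkLL_on_bilinear[OF bounded_bilinear_mult] CkLL_on_const assms(1))

text \<open>For \<open>k = 0\<close> the inner map has to be locally Lipschitz, since the modulus \<open>t \<bar>log t\<bar>\<close> is not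
  stable under composition.\<close>

lemma CkLL_on_compose:
  fixes f :: "'b::euclidean_space \<Rightarrow> 'c::real_normed_vector" and g :: "'a::euclidean_space \<Rightarrow> 'b"
  assumes "open U" "open V" "g ` U \<subseteq> V" "Ck_on 1 U g" "CkLL_on k V f" "CkLL_on k U g"
  shows "CkLL_on k U (\<lambda>x. f (g x))"
  using assms(5,6)
proof (induction k arbitrary: f)
  case 0
  have cg: "continuous_on U g" using 0 by (simp add: CkLL_on_0)
  have "locally_log_lipschitz_on U (\<lambda>x. f (g x))"
  proof (rule locally_log_lipschitz_onI)
    fix p assume p: "p \<in> U"
    then have gp: "g p \<in> V" using assms(3) by auto
    have "locally_log_lipschitz_on V f" using 0 by (simp add: CkLL_on_0)
    then obtain C N where N: "open N" "g p \<in> N" "C > 0"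
      and C: "\<And>x y. x \<in> V \<inter> N \<Longrightarrow> y \<in> V \<inter> N \<Longrightarrow> x \<noteq> y \<Longrightarrow> dist x y \<le> 1/2 \<Longrightarrow>
        dist (f x) (f y) \<le> C * (dist x y * \<bar>ln (dist x y)\<bar>)"
      using locally_log_lipschitz_onE[OF _ gp] by metis
    obtain r L where r: "r > 0" "ball p r \<subseteq> U" "L > 0"
      and L: "\<And>y z. y \<in> ball p r \<Longrightarrow> z \<in> ball p r \<Longrightarrow> dist (g y) (g z) \<le> L * dist y z"
      using Ck_on_1_locally_lipschitz[OF assms(1,4) p] by metis
    \<comment> \<open>A Lipschitz constant of at least 1 makes \<open>ln K\<close>
      nonnegative.\<close>
    define K where "K = max L 1"
    have K: "K \<ge> 1" "K \<ge> L" by (auto simp: K_def)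
    \<comment> \<open>Two points in this ball have distance \<open>v\<close> at most
      \<open>1 / (4 * K)\<close>, so their images have distance at most
      \<open>K * v \<le> 1/4\<close>. Up to 1/4, which is below 1/e, the modulus -t log t is
      increasing.\<close>
    define r' where "r' = min r (1 / (8 * K))"
    have r': "r' > 0" "r' \<le> r" "r' \<le> 1 / (8 * K)" using r K by (auto simp: r'_def)
    have "open (U \<inter> g -` N)"
      using continuous_open_preimage[OF cg assms(1) N(1)] .
    let ?N = "(U \<inter> g -` N) \<inter> ball p r'"
    have "dist (f (g x)) (f (g y)) \<le> (C * K * (1 + 2 * ln K)) * (dist x y * \<bar>ln (dist x y)\<bar>)"
      if xy: "x \<in> U \<inter> ?N" "y \<in> U \<inter> ?N" "x \<noteq> y" "dist x y \<le> 1/2" for x y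
    proof (cases "g x = g y")
      case True
      then show ?thesis using K N(3) by simp
    next
      case False
      define u where "u = dist (g x) (g y)"
      define v where "v = dist x y"
      have u: "u > 0" and v: "v > 0" using False xy by (auto simp: u_def v_def)
      have "x \<in> ball p r" "y \<in> ball p r" using xy r' by auto
      from L[OF this] have uv: "u \<le> K * v"
        unfolding u_def v_def using K(2) mult_right_mono[of L K "dist x y"] by simp
      have "v \<le> 2 * r'"
        unfolding v_def using xy dist_triangle_half_r[of p x "4 * r'" y] dist_triangle3[of x y p] by auto
      then have "v \<le> 1 / (4 * K)" using r'(3) by simp
      then have Kv: "K * v \<le> 1/4" using K(1) by (simp add: field_simps)
      have mono: "u * \<bar>ln u\<bar> \<le> (K * v) * \<bar>ln (K * v)\<bar>"
      proof -
        have "u * \<bar>ln u\<bar> = - (u * ln u)" using u uv Kv by (simp add: abs_if)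
        moreover have "(K * v) * \<bar>ln (K * v)\<bar> = - ((K * v) * ln (K * v))"
        proof -
          have "0 < K * v" using K v by simp
          then show ?thesis using Kv by (simp add: abs_if)
        qed
        moreover have "- (u * ln u) \<le> - ((K * v) * ln (K * v))"
        proof (rule DERIV_nonneg_imp_nondecreasing[OF uv])
          fix t assume t: "u \<le> t" "t \<le> K * v"
          have "ln t \<le> ln (1/4)" using t u Kv by simp
          also have "ln (1/4) = - (2 * ln (2::real))"
            using ln_realpow[of 2 2] by (simp add: ln_div)
          also have "\<dots> \<le> -1"
            using ln_le_minus_one[of "1/2"] by (simp add: ln_div)
          finally have "- (ln t + 1) \<ge> 0" by simp
          moreover have "((\<lambda>t. - (t * ln t)) has_real_derivative - (ln t + 1)) (at t)"
            using t u by (auto intro!: derivative_eq_intros)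
          ultimately show "\<exists>y. ((\<lambda>t. - (t * ln t)) has_real_derivative y) (at t) \<and> 0 \<le> y" by blast
        qed
        ultimately show ?thesis by simp
      qed
      \<comment> \<open>Since \<open>2 * \<bar>ln v\<bar>\<close> is at least 1, the additive term
        \<open>ln K\<close> is absorbed into a multiple of \<open>\<bar>ln v\<bar>\<close>.\<close>
      have v2: "1/2 \<le> \<bar>ln v\<bar>" using le_abs_ln[of v] v xy(4) by (simp add: v_def)
      have "\<bar>ln (K * v)\<bar> \<le> ln K + \<bar>ln v\<bar>"
        using K v abs_triangle_ineq[of "ln K" "ln v"] by (simp add: ln_mult)
      also have "\<dots> \<le> (1 + 2 * ln K) * \<bar>ln v\<bar>"
        using v2 K mult_left_mono[OF v2, of "2 * ln K"] by (simp add: algebra_simps)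
      finally have lnK: "\<bar>ln (K * v)\<bar> \<le> (1 + 2 * ln K) * \<bar>ln v\<bar>" .
      have "dist (f (g x)) (f (g y)) \<le> C * (u * \<bar>ln u\<bar>)"
        unfolding u_def using xy assms(3) False uv Kv by (intro C) (auto simp: u_def)
      also have "\<dots> \<le> C * ((K * v) * ((1 + 2 * ln K) * \<bar>ln v\<bar>))"
        using mono lnK N(3) K v
        by (intro mult_left_mono order_trans[OF mono]) auto
      finally show ?thesis by (simp add: v_def algebra_simps)
    qed
    then show "\<exists>C N. open N \<and> p \<in> N \<and> (\<forall>x\<in>U \<inter> N. \<forall>y\<in>U \<inter> N. x \<noteq> y \<and> dist x y \<le> 1/2 \<longrightarrow>
        dist (f (g x)) (f (g y)) \<le> C * (dist x y * \<bar>ln (dist x y)\<bar>))"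
      using N p r' \<open>open (U \<inter> g -` N)\<close>
      by (intro exI[of _ "C * K * (1 + 2 * ln K)"] exI[of _ ?N]) auto
  qed
  then show ?case
    using 0 continuous_on_compose2[of V f U g] assms(3) by (auto simp: CkLL_on_0)
next
  case (Suc k)
  define Df where "Df y h = (\<Sum>c\<in>Basis. (h \<bullet> c) *\<^sub>R partial_derivative c f y)" for y h
  define Dg where "Dg x h = (\<Sum>c\<in>Basis. (h \<bullet> c) *\<^sub>R partial_derivative c g x)" for x h
  show ?case
  proof (rule CkLL_on_SucI[OF assms(1)])
    fix x assume x: "x \<in> U"
    have "(g has_derivative Dg x) (at x)"
      unfolding Dg_def by (rule Ck_on_1_has_derivative[OF assms(1,4) x])
    moreover have "(f has_derivative Df (g x)) (at (g x))"
      unfolding Df_def using x assms(3)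
      by (intro Ck_on_1_has_derivative[OF assms(2) CkLL_on_SucD(1)[OF Suc.prems(1)]]) auto
    ultimately show "((\<lambda>x. f (g x)) has_derivative (\<lambda>h. Df (g x) (Dg x h))) (at x)"
      by (rule has_derivative_compose)
  next
    fix b :: 'a assume b: "b \<in> Basis"
    have "CkLL_on k U (\<lambda>x. \<Sum>c\<in>Basis. (partial_derivative b g x \<bullet> c) *\<^sub>R partial_derivative c f (g x))"
      by (intro CkLL_on_sum[OF assms(1)] CkLL_on_bilinear[OF bounded_bilinear_scaleR assms(1)]
          bounded_linear.CkLL_on[OF bounded_linear_inner_left assms(1)] Suc.IH
          CkLL_on_SucD(2)[OF Suc.prems(1)] CkLL_on_SucD(2)[OF Suc.prems(2) b]
          CkLL_on_SucD'[OF assms(1) Suc.prems(2)])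
    then show "CkLL_on k U (\<lambda>x. Df (g x) (Dg x b))"
      using b by (simp add: Df_def Dg_def inner_Basis_sum_partials)
  qed
qed

text \<open>At order zero \<open>f\<close> is merely log-Lipschitz, so it is not an admissible inner
  map for the composition rule. The identity 1/a - 1/b = (b - a)/(ab) and local boundedness of 1/f
  preserve the modulus directly.\<close>

lemma CkLL_on_inverse:
  fixes f :: "'a::euclidean_space \<Rightarrow> real"
  assumes "open U" "CkLL_on k U f" "\<And>x. x \<in> U \<Longrightarrow> f x \<noteq> 0"
  shows "CkLL_on k U (\<lambda>x. inverse (f x))"
  using assms(2)
proof (induction k)
  case 0
  have cf: "continuous_on U f" and lf: "locally_log_lipschitz_on U f" using 0 by (auto simp: CkLL_on_0)
  have ci: "continuous_on U (\<lambda>x. inverse (f x))" using cf assms(3) by (intro continuous_intros) auto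
  have "locally_log_lipschitz_on U (\<lambda>x. inverse (f x))"
  proof (rule locally_log_lipschitz_onI)
    fix p assume "p \<in> U"
    obtain C N where N: "open N" "p \<in> N" "C > 0"
      and C: "\<And>x y. x \<in> U \<inter> N \<Longrightarrow> y \<in> U \<inter> N \<Longrightarrow> x \<noteq> y \<Longrightarrow> dist x y \<le> 1/2 \<Longrightarrow>
        dist (f x) (f y) \<le> C * (dist x y * \<bar>ln (dist x y)\<bar>)"
      using locally_log_lipschitz_onE[OF lf \<open>p \<in> U\<close>] by metis
    obtain B M where B: "open B" "p \<in> B" "M > 0" "\<And>x. x \<in> U \<inter> B \<Longrightarrow> norm (inverse (f x)) \<le> M"
      using continuous_on_locally_bounded[OF ci \<open>p \<in> U\<close>] by metis
    have "dist (inverse (f x)) (inverse (f y)) \<le> (M * C * M) * (dist x y * \<bar>ln (dist x y)\<bar>)"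
      if xy: "x \<in> U \<inter> (N \<inter> B)" "y \<in> U \<inter> (N \<inter> B)" "x \<noteq> y" "dist x y \<le> 1/2" for x y
    proof -
      define L where "L = dist x y * \<bar>ln (dist x y)\<bar>"
      have L: "L \<ge> 0" by (simp add: L_def)
      have "dist (inverse (f x)) (inverse (f y)) = \<bar>inverse (f x)\<bar> * \<bar>f x - f y\<bar> * \<bar>inverse (f y)\<bar>"
        using inverse_diff_inverse[of "f x" "f y"] assms(3) xy by (simp add: dist_real_def abs_mult)
      also have "\<dots> \<le> M * (C * L) * M"
      proof (intro mult_mono)
        show "\<bar>f x - f y\<bar> \<le> C * L" using C[of x y] xy by (auto simp: L_def dist_real_def)
      qed (use B(3) B(4)[of x] B(4)[of y] xy L N(3) in auto)
      finally show ?thesis by (simp add: L_def algebra_simps)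
    qed
    then show "\<exists>C N. open N \<and> p \<in> N \<and> (\<forall>x\<in>U \<inter> N. \<forall>y\<in>U \<inter> N. x \<noteq> y \<and> dist x y \<le> 1/2 \<longrightarrow>
        dist (inverse (f x)) (inverse (f y)) \<le> C * (dist x y * \<bar>ln (dist x y)\<bar>))"
      using N B by (intro exI[of _ "M * C * M"] exI[of _ "N \<inter> B"]) auto
  qed
  then show ?case using ci by (simp add: CkLL_on_0)
next
  case (Suc k)
  have IH: "CkLL_on k U (\<lambda>x. inverse (f x))" by (rule Suc.IH[OF CkLL_on_SucD'[OF assms(1) Suc.prems]])
  show ?case
  proof (rule CkLL_on_SucI[OF assms(1)])
    fix x assume x: "x \<in> U"
    show "((\<lambda>x. inverse (f x)) has_derivative
        (\<lambda>h. - (inverse (f x) * (\<Sum>c\<in>Basis. (h \<bullet> c) *\<^sub>R partial_derivative c f x) * inverse (f x)))) (at x)"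
      using Ck_on_1_has_derivative[OF assms(1) CkLL_on_SucD(1)[OF Suc.prems] x] assms(3)[OF x]
      by (auto intro!: derivative_eq_intros)
  next
    fix b :: 'a assume b: "b \<in> Basis"
    have "CkLL_on k U (\<lambda>x. - (inverse (f x) * partial_derivative b f x * inverse (f x)))"
      by (intro bounded_linear.CkLL_on[OF bounded_linear_minus[OF bounded_linear_ident]]
          CkLL_on_bilinear[OF bounded_bilinear_mult] assms(1) IH CkLL_on_SucD(2)[OF Suc.prems b])
    then show "CkLL_on k U (\<lambda>x. - (inverse (f x) * (\<Sum>c\<in>Basis. (b \<bullet> c) *\<^sub>R partial_derivative c f x) * inverse (f x)))"
      unfolding inner_Basis_sum_partials[OF b] .
  qed
qed

lemma CkLL_on_linear:
  fixes f :: "'a::euclidean_space \<Rightarrow> 'b::real_normed_vector"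
  assumes "open U" "bounded_linear f"
  shows "CkLL_on k U f" "Ck_on 1 U f"
proof -
  have "CkLL_on (Suc k) U f" for k
    by (rule CkLL_on_SucI[where f' = "\<lambda>x. f"])
      (auto intro: assms bounded_linear_imp_has_derivative CkLL_on_const)
  then show "CkLL_on k U f" "Ck_on 1 U f" using CkLL_on_SucD'[OF assms(1)] CkLL_on_SucD(1) by blast+
qed

lemma CkLL_on_Pair:
  fixes f :: "'a::euclidean_space \<Rightarrow> 'b::real_normed_vector" and g :: "'a \<Rightarrow> 'c::real_normed_vector"
  assumes "open U" "CkLL_on k U f" "CkLL_on k U g"
  shows "CkLL_on k U (\<lambda>x. (f x, g x))"
proof -
  have "CkLL_on k U (\<lambda>x. (f x, 0) + (0, g x))"
    by (intro CkLL_on_add assms bounded_linear.CkLL_on[where f = "\<lambda>y. (y, 0)"]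
        bounded_linear.CkLL_on[where f = "\<lambda>y. (0, y)"] bounded_linear_Pair bounded_linear_ident bounded_linear_zero)
  then show ?thesis by simp
qed

text \<open>A vector is the sum of its entries placed on the axes, and each placement is a bounded
  linear map.\<close>

lemma CkLL_on_vec:
  fixes f :: "'a::euclidean_space \<Rightarrow> 'b::real_normed_vector ^ 'n"
  assumes "open U" "\<And>i. CkLL_on k U (\<lambda>x. f x $ i)"
  shows "CkLL_on k U f"
proof -
  have lin: "bounded_linear (\<lambda>y::'b. axis i y)" for i :: 'n
  proof (rule bounded_linear_intro[where K = 1])
    fix y :: 'b
    have "norm (axis i y) \<le> (\<Sum>j\<in>UNIV. norm (axis i y $ j))"
      unfolding norm_vec_def by (rule L2_set_le_sum) simp
    also have "\<dots> = (\<Sum>j\<in>UNIV. if j = i then norm y else 0)"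
      by (intro sum.cong) (auto simp: axis_def)
    finally show "norm (axis i y) \<le> norm y * 1" by simp
  qed (auto simp: axis_def vec_eq_iff)
  have "CkLL_on k U (\<lambda>x. \<Sum>i\<in>UNIV. axis i (f x $ i))"
    by (intro CkLL_on_sum bounded_linear.CkLL_on[OF lin] assms)
  moreover have "(\<Sum>i\<in>UNIV. axis i (f x $ i)) = f x" for x
    by (simp add: vec_eq_iff axis_def sum.delta)
  ultimately show ?thesis by simp
qed

lemma CkLL_on_vec_nth:
  fixes f :: "'a::euclidean_space \<Rightarrow> 'b::real_normed_vector ^ 'n"
  assumes "open U" "CkLL_on k U f"
  shows "CkLL_on k U (\<lambda>x. f x $ i)"
  by (rule bounded_linear.CkLL_on[OF bounded_linear_vec_nth assms])

lemma CkLL_on_det: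
  fixes M :: "'a::euclidean_space \<Rightarrow> real ^ 'n ^ 'n"
  assumes "open U" "\<And>i j. CkLL_on k U (\<lambda>x. M x $ i $ j)"
  shows "CkLL_on k U (\<lambda>x. det (M x))"
  unfolding det_def
  by (intro CkLL_on_sum CkLL_on_prod CkLL_on_bilinear[OF bounded_bilinear_mult] CkLL_on_const assms)

lemma CkLL_on_matrix_mult:
  fixes M :: "'a::euclidean_space \<Rightarrow> real ^ 'm ^ 'n" and N :: "'a \<Rightarrow> real ^ 'l ^ 'm"
  assumes "open U" "CkLL_on k U M" "CkLL_on k U N"
  shows "CkLL_on k U (\<lambda>x. M x ** N x)"
  by (rule CkLL_on_vec[OF assms(1)], rule CkLL_on_vec[OF assms(1)])
    (simp add: matrix_matrix_mult_def,
     intro CkLL_on_sum CkLL_on_bilinear[OF bounded_bilinear_mult] CkLL_on_vec_nth assms)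

text \<open>Cramer's rule expresses the inverse by determinants.\<close>

lemma CkLL_on_matrix_inv:
  fixes M :: "'a::euclidean_space \<Rightarrow> real ^ 'n ^ 'n"
  assumes "open U" "CkLL_on k U M" "\<And>x. x \<in> U \<Longrightarrow> det (M x) \<noteq> 0"
  obtains R where "CkLL_on k U R" "\<And>x. x \<in> U \<Longrightarrow> M x ** R x = mat 1"
proof
  \<comment> \<open>\<open>B j i x\<close> is \<open>M x\<close> with column \<open>i\<close>
    replaced by the \<open>j\<close>-th unit vector. Cramer's rule then makes column
    \<open>j\<close> of \<open>R x\<close> the solution of
    \<open>M x *v y = axis j 1\<close>.\<close>
  define B where "B j i x = (\<chi> a c. if c = i then axis j 1 $ a else M x $ a $ c)" for i j :: 'n and x
  define R where "R x = (\<chi> i j. det (B j i x) * inverse (det (M x)))" for x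
  have entry: "CkLL_on k U (\<lambda>x. M x $ a $ c)" for a c
    by (intro CkLL_on_vec_nth assms)
  have "CkLL_on k U (\<lambda>x. B j i x $ a $ c)" for i j a c
    by (cases "c = i") (simp_all add: B_def entry CkLL_on_const[OF assms(1)])
  then have "CkLL_on k U (\<lambda>x. det (B j i x) * inverse (det (M x)))" for i j
    by (intro CkLL_on_bilinear[OF bounded_bilinear_mult] CkLL_on_inverse CkLL_on_det entry assms)
  then show "CkLL_on k U R"
    by (intro CkLL_on_vec[OF assms(1)]) (simp add: R_def)
  fix x assume x: "x \<in> U"
  have "M x *v (\<chi> i. R x $ i $ j) = axis j 1" for j
    using cramer[OF assms(3)[OF x], of "\<chi> i. R x $ i $ j" "axis j 1"]
    by (simp add: R_def B_def divide_inverse)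
  then have "(M x *v (\<chi> i. R x $ i $ j)) $ i = mat 1 $ i $ j" for i j
    by (simp add: axis_def mat_def)
  then show "M x ** R x = mat 1"
    by (simp add: vec_eq_iff matrix_matrix_mult_def matrix_vector_mult_def)
qed

section \<open>Orthogonal projections and charts of the Grassmannian\<close>

text \<open>For a convex set the residual has nonpositive inner product with every feasible
  direction; in a subspace \<open>z\<close> and \<open>-z\<close> are both feasible, which forces
  equality with 0.\<close>

lemma closest_point_subspace:
  fixes T :: "'a::euclidean_space set"
  assumes "subspace T"
  shows "closest_point T x \<in> T" "x - closest_point T x \<in> T\<^sup>\<bottom>"
proof -
  have T: "closed T" "T \<noteq> {}" "convex T"
    using assms closed_subspace subspace_0 subspace_imp_convex by auto
  show c: "closest_point T x \<in> T" using T by (simp add: closest_point_in_set)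
  have "inner y (x - closest_point T x) = 0" if "y \<in> T" for y
  proof -
    have le: "inner (x - closest_point T x) z \<le> 0" if "z \<in> T" for z
      using closest_point_dot[OF T(3,1), of "closest_point T x + z" x] subspace_add[OF assms c that] by simp
    show ?thesis using le[OF that] le[OF subspace_neg[OF assms that]] by (simp add: inner_commute)
  qed
  then show "x - closest_point T x \<in> T\<^sup>\<bottom>" by (auto simp: orthogonal_comp_def orthogonal_def)
qed

lemma orthogonal_comp_inner: "u \<in> T \<Longrightarrow> w \<in> T\<^sup>\<bottom> \<Longrightarrow> u \<bullet> w = 0"
  by (auto simp: orthogonal_comp_def orthogonal_def)

lemma closest_point_subspace_unique:
  fixes T :: "'a::euclidean_space set"
  assumes "subspace T" "u \<in> T" "x - u \<in> T\<^sup>\<bottom>"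
  shows "closest_point T x = u"
proof -
  let ?c = "closest_point T x"
  have "u - ?c \<in> T" using assms closest_point_subspace by (blast intro: subspace_diff)
  moreover have "(x - ?c) - (x - u) \<in> T\<^sup>\<bottom>"
    by (intro subspace_diff subspace_orthogonal_comp closest_point_subspace assms)
  ultimately have "(u - ?c) \<bullet> (u - ?c) = 0"
    using orthogonal_comp_inner by fastforce
  then show ?thesis by simp
qed

lemma linear_closest_point:
  fixes T :: "'a::euclidean_space set"
  assumes "subspace T"
  shows "linear (closest_point T)"
proof (rule linearI)
  note cp = closest_point_subspace[OF assms]
  show "closest_point T (x + y) = closest_point T x + closest_point T y" for x y
  proof (rule closest_point_subspace_unique[OF assms])
    have "(x - closest_point T x) + (y - closest_point T y) \<in> T\<^sup>\<bottom>"
      by (intro subspace_add subspace_orthogonal_comp cp)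
    then show "x + y - (closest_point T x + closest_point T y) \<in> T\<^sup>\<bottom>" by (simp add: algebra_simps)
  qed (use cp assms in \<open>auto intro: subspace_add\<close>)
  show "closest_point T (c *\<^sub>R x) = c *\<^sub>R closest_point T x" for c x
  proof (rule closest_point_subspace_unique[OF assms])
    have "c *\<^sub>R (x - closest_point T x) \<in> T\<^sup>\<bottom>"
      by (intro subspace_scale subspace_orthogonal_comp cp)
    then show "c *\<^sub>R x - c *\<^sub>R closest_point T x \<in> T\<^sup>\<bottom>" by (simp add: algebra_simps)
  qed (use cp assms in \<open>auto intro: subspace_scale\<close>)
qed

lemma closest_point_subspace_self: "subspace T \<Longrightarrow> x \<in> T \<Longrightarrow> closest_point T x = x"
  for T :: "'a::euclidean_space set"
  by (simp add: closest_point_self)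

lemma closest_point_orthogonal_comp:
  fixes T :: "'a::euclidean_space set"
  shows "subspace T \<Longrightarrow> x \<in> T\<^sup>\<bottom> \<Longrightarrow> closest_point T x = 0"
  by (rule closest_point_subspace_unique) (auto simp: subspace_0)

lemma closest_point_add_orthogonal:
  fixes T :: "'a::euclidean_space set"
  shows "subspace T \<Longrightarrow> u \<in> T \<Longrightarrow> w \<in> T\<^sup>\<bottom> \<Longrightarrow> closest_point T (u + w) = u"
  by (rule closest_point_subspace_unique) auto

lemma norm_closest_point_le:
  fixes T :: "'a::euclidean_space set"
  assumes "subspace T"
  shows "norm (closest_point T x) \<le> norm x" "norm (x - closest_point T x) \<le> norm x"
proof -
  let ?c = "closest_point T x"
  have "?c \<bullet> (x - ?c) = 0" using closest_point_subspace[OF assms] orthogonal_comp_inner by blast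
  then have "(norm (?c + (x - ?c)))\<^sup>2 = (norm ?c)\<^sup>2 + (norm (x - ?c))\<^sup>2"
    by (intro norm_add_Pythagorean) (simp add: orthogonal_def)
  then have "(norm ?c)\<^sup>2 \<le> (norm x)\<^sup>2" "(norm (x - ?c))\<^sup>2 \<le> (norm x)\<^sup>2" by auto
  then show "norm ?c \<le> norm x" "norm (x - ?c) \<le> norm x" by (auto intro: power2_le_imp_le)
qed

lemma bounded_linear_closest_point:
  fixes T :: "'a::euclidean_space set"
  shows "subspace T \<Longrightarrow> bounded_linear (closest_point T)"
  by (intro linear_conv_bounded_linear[THEN iffD1] linear_closest_point)

lemma orth_proj_works: "subspace T \<Longrightarrow> orth_proj T *v x = closest_point T x"
  unfolding orth_proj_def
  by (rule matrix_works) (simp add: linear_matrix_vector_mul_eq linear_closest_point)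

text \<open>A subspace is the fixed-point set of its projection. This injectivity is what makes the
  topology of the Grassmannian Hausdorff.\<close>

lemma orth_proj_inject:
  assumes "subspace S" "subspace T" "orth_proj S = orth_proj T"
  shows "S = T"
proof -
  have *: "closest_point S x = closest_point T x" for x
    using assms orth_proj_works by metis
  have "x \<in> S \<longleftrightarrow> x \<in> T" for x
    using closest_point_subspace(1)[OF assms(1), of x] closest_point_subspace(1)[OF assms(2), of x]
      closest_point_subspace_self[OF assms(1), of x] closest_point_subspace_self[OF assms(2), of x] *[of x]
    by metis
  then show ?thesis by blast
qed

section \<open>Subspaces as graphs and the dependence of their projections on the slope\<close>

definition graph_over :: "(real ^ 'n) set \<Rightarrow> real ^ 'n ^ 'n \<Rightarrow> (real ^ 'n) set" where
  "graph_over V A = (\<lambda>v. v + A *v v) ` V"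

lemma graph_over_normal:
  assumes "subspace V" "\<And>v. v \<in> V \<Longrightarrow> A *v v \<in> V\<^sup>\<bottom>"
  shows "subspace (graph_over V A)" "dim (graph_over V A) = dim V" "graph_over V A \<inter> V\<^sup>\<bottom> = {0}"
    "graph_over V A \<in> Gr_chart_domain V"
proof -
  have lin: "linear (\<lambda>v. v + A *v v)" by (intro linear_compose_add linear_ident matrix_vector_mul_linear)
  show sub: "subspace (graph_over V A)"
    unfolding graph_over_def using lin assms(1) by (rule linear_subspace_image)
  have cp: "closest_point V (v + A *v v) = v" if "v \<in> V" for v
    using closest_point_add_orthogonal assms that by blast
  have "inj_on (\<lambda>v. v + A *v v) V"
    by (rule inj_on_inverseI) (rule cp)
  then show dim: "dim (graph_over V A) = dim V"
    unfolding graph_over_def using lin assms(1) by (intro dim_image_eq) (simp_all add: span_eq_iff[THEN iffD2])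
  show "graph_over V A \<inter> V\<^sup>\<bottom> = {0}"
  proof
    show "graph_over V A \<inter> V\<^sup>\<bottom> \<subseteq> {0}"
    proof
      fix t assume t: "t \<in> graph_over V A \<inter> V\<^sup>\<bottom>"
      then obtain v where v: "v \<in> V" "t = v + A *v v" by (auto simp: graph_over_def)
      have "v = 0"
        using closest_point_orthogonal_comp[OF assms(1), of t] cp[OF v(1)] v(2) t by simp
      then show "t \<in> {0}" using v(2) by simp
    qed
    show "{0} \<subseteq> graph_over V A \<inter> V\<^sup>\<bottom>"
      using sub subspace_0 subspace_orthogonal_comp by blast
  qed
  with sub dim show "graph_over V A \<in> Gr_chart_domain V"
    by (simp add: Gr_chart_domain_def Gr_def)
qed

text \<open>The graph sees \<open>A\<close> only on \<open>V\<close>; the prescribed value 0 on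
  \<open>V\<^sup>\<bottom>\<close> fixes the rest. This is the uniqueness behind the definite
  description in \<open>Gr_chart\<close>.\<close>

lemma graph_over_inject:
  assumes "subspace V" "\<And>v. v \<in> V \<Longrightarrow> A *v v \<in> V\<^sup>\<bottom>" "\<And>w. w \<in> V\<^sup>\<bottom> \<Longrightarrow> A *v w = 0"
    "\<And>v. v \<in> V \<Longrightarrow> B *v v \<in> V\<^sup>\<bottom>" "\<And>w. w \<in> V\<^sup>\<bottom> \<Longrightarrow> B *v w = 0"
    "graph_over V A = graph_over V B"
  shows "A = B"
proof -
  have onV: "A *v v = B *v v" if v: "v \<in> V" for v
  proof -
    have "v + A *v v \<in> graph_over V B" using v assms(6) by (auto simp: graph_over_def)
    then obtain u where u: "u \<in> V" "v + A *v v = u + B *v u" by (auto simp: graph_over_def)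
    then have "v = u"
      using closest_point_add_orthogonal[OF assms(1)] assms(2,4) v by metis
    with u show ?thesis by simp
  qed
  have "A *v x = B *v x" for x
  proof -
    let ?c = "closest_point V x"
    note cp = closest_point_subspace[OF assms(1), of x]
    have "A *v (?c + (x - ?c)) = B *v (?c + (x - ?c))"
      unfolding matrix_vector_right_distrib using cp onV assms(3,5) by simp
    then show ?thesis by simp
  qed
  then show ?thesis by (simp add: matrix_eq)
qed

text \<open>The projection of \<open>T\<close> to \<open>V\<close> is injective because
  \<open>T\<close> meets \<open>V\<^sup>\<bottom>\<close> trivially, hence bijective by dimension.
  The slope is its inverse minus the identity, precomposed with the projection so that it kills
  \<open>V\<^sup>\<bottom>\<close>.\<close>

lemma Gr_chart_domain_graph:
  assumes "subspace V" "T \<in> Gr_chart_domain V"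
  obtains A where "\<And>v. v \<in> V \<Longrightarrow> A *v v \<in> V\<^sup>\<bottom>" "\<And>w. w \<in> V\<^sup>\<bottom> \<Longrightarrow> A *v w = 0" "T = graph_over V A"
proof -
  have T: "subspace T" "dim T = dim V" "T \<inter> V\<^sup>\<bottom> = {0}"
    using assms(2) by (auto simp: Gr_chart_domain_def Gr_def)
  let ?P = "closest_point V"
  note cp = closest_point_subspace[OF assms(1)]
  have linP: "linear ?P" using assms(1) by (rule linear_closest_point)
  have inj: "inj_on ?P T"
    unfolding linear_inj_on_iff_eq_0[OF linP T(1)]
  proof (intro ballI impI)
    fix x assume "x \<in> T" "?P x = 0"
    then show "x = 0" using cp(2)[of x] T(3) by auto
  qed
  have img: "?P ` T = V"
  proof (rule subspace_dim_equal)
    show "subspace (?P ` T)" using linP T(1) by (rule linear_subspace_image)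
    show "?P ` T \<subseteq> V" using cp by blast
    show "dim V \<le> dim (?P ` T)"
      using dim_image_eq[OF linP, of T] inj T(2) by (simp add: span_eq_iff[THEN iffD2, OF T(1)])
  qed (rule assms(1))
  obtain g where g: "linear g" "\<And>t. t \<in> T \<Longrightarrow> g (?P t) = t"
    using linear_exists_left_inverse_on[OF linP T(1) inj] by blast
  define A where "A = matrix (\<lambda>x. g (?P x) - ?P x)"
  have A: "A *v x = g (?P x) - ?P x" for x
    unfolding A_def
  proof (rule matrix_works)
    have "linear (\<lambda>x. g (?P x) - ?P x)"
      using linP g(1) linear_compose[OF linP g(1)] by (intro linear_compose_sub) (simp_all add: o_def)
    then show "Vector_Spaces.linear (*s) (*s) (\<lambda>x. g (?P x) - ?P x)"
      by (simp add: linear_matrix_vector_mul_eq)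
  qed
  have AV: "\<exists>t\<in>T. v = ?P t \<and> A *v v = t - v" if "v \<in> V" for v
  proof -
    have "v \<in> ?P ` T" using img that by blast
    then obtain t where t: "t \<in> T" "v = ?P t" by blast
    then show ?thesis
      using A[of v] g(2)[OF t(1)] closest_point_subspace_self[OF assms(1) that] by auto
  qed
  show ?thesis
  proof
    show "A *v v \<in> V\<^sup>\<bottom>" if "v \<in> V" for v using AV[OF that] cp by auto
    show "A *v w = 0" if "w \<in> V\<^sup>\<bottom>" for w
      using A[of w] closest_point_orthogonal_comp[OF assms(1) that] linear_0[OF g(1)] by simp
    show "T = graph_over V A"
    proof
      show "graph_over V A \<subseteq> T" unfolding graph_over_def using AV by force
      show "T \<subseteq> graph_over V A"
      proof
        fix t assume t: "t \<in> T"
        have "A *v ?P t = t - ?P t"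
          using A[of "?P t"] g(2)[OF t] closest_point_subspace_self[OF assms(1) cp(1)] by simp
        then have "t = ?P t + A *v ?P t" by simp
        then show "t \<in> graph_over V A" unfolding graph_over_def using cp(1) by blast
      qed
    qed
  qed
qed

lemma Gr_chart_graph_over:
  assumes "subspace V" "\<And>v. v \<in> V \<Longrightarrow> A *v v \<in> V\<^sup>\<bottom>" "\<And>w. w \<in> V\<^sup>\<bottom> \<Longrightarrow> A *v w = 0"
  shows "Gr_chart V (graph_over V A) = A"
  unfolding Gr_chart_def graph_over_def[symmetric]
  by (rule the_equality) (use assms graph_over_inject[OF assms(1)] in \<open>blast+\<close>)

lemma Gr_chart_works:
  assumes "subspace V" "T \<in> Gr_chart_domain V"
  shows "v \<in> V \<Longrightarrow> Gr_chart V T *v v \<in> V\<^sup>\<bottom>" "w \<in> V\<^sup>\<bottom> \<Longrightarrow> Gr_chart V T *v w = 0"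
    "T = graph_over V (Gr_chart V T)"
proof -
  obtain A where A: "\<And>v. v \<in> V \<Longrightarrow> A *v v \<in> V\<^sup>\<bottom>" "\<And>w. w \<in> V\<^sup>\<bottom> \<Longrightarrow> A *v w = 0" "T = graph_over V A"
    using Gr_chart_domain_graph[OF assms] by blast
  then have "Gr_chart V T = A" using Gr_chart_graph_over[OF assms(1) A(1,2)] by simp
  with A show "v \<in> V \<Longrightarrow> Gr_chart V T *v v \<in> V\<^sup>\<bottom>" "w \<in> V\<^sup>\<bottom> \<Longrightarrow> Gr_chart V T *v w = 0"
    "T = graph_over V (Gr_chart V T)" by auto
qed

text \<open>Split \<open>u\<close> into its projection \<open>c\<close> to the second graph and the
  remainder \<open>u'\<close>. The first graph passes within \<open>K * norm u\<close> of
  \<open>c\<close>, and the projection of \<open>u'\<close> to it is no longer than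
  \<open>K * norm u\<close>; the two contributions give the factor 2.\<close>

lemma closest_point_graph_over_diff:
  assumes V: "subspace V" and A: "\<And>v. v \<in> V \<Longrightarrow> A *v v \<in> V\<^sup>\<bottom>" and B: "\<And>v. v \<in> V \<Longrightarrow> B *v v \<in> V\<^sup>\<bottom>"
    and K: "\<And>v. v \<in> V \<Longrightarrow> norm (A *v v - B *v v) \<le> K * norm v" "K \<ge> 0"
  shows "norm (closest_point (graph_over V A) u - closest_point (graph_over V B) u) \<le> 2 * K * norm u"
proof -
  let ?PA = "closest_point (graph_over V A)" and ?PB = "closest_point (graph_over V B)"
  have sA: "subspace (graph_over V A)" and sB: "subspace (graph_over V B)"
    using graph_over_normal(1)[OF V] A B by auto
  have vle: "norm v \<le> norm (v + w)" if "v \<in> V" "w \<in> V\<^sup>\<bottom>" for v w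
    using norm_closest_point_le(1)[OF V, of "v + w"] closest_point_add_orthogonal[OF V that] by simp
  define c where "c = ?PB u"
  obtain v where v: "v \<in> V" "c = v + B *v v"
    using closest_point_subspace(1)[OF sB, of u] unfolding c_def graph_over_def by blast
  have nv: "norm v \<le> norm u"
    using vle[OF v(1) B[OF v(1)]] norm_closest_point_le(1)[OF sB, of u] v(2) by (simp add: c_def)
  have "norm (c - ?PA c) \<le> norm (c - (v + A *v v))"
    using closest_point_le[OF closed_subspace[OF sA], of "v + A *v v" c] v(1)
    by (auto simp: graph_over_def dist_norm)
  also have "\<dots> = norm (A *v v - B *v v)" using v(2) by (simp add: norm_minus_commute)
  also have "\<dots> \<le> K * norm u" using K(1)[OF v(1)] mult_left_mono[OF nv K(2)] by linarith
  finally have 1: "norm (?PA c - c) \<le> K * norm u" by (simp add: norm_minus_commute)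
  define u' where "u' = u - c"
  have u': "u' \<in> (graph_over V B)\<^sup>\<bottom>" unfolding u'_def c_def by (rule closest_point_subspace(2)[OF sB])
  obtain w where w: "w \<in> V" "?PA u' = w + A *v w"
    using closest_point_subspace(1)[OF sA, of u'] unfolding graph_over_def by blast
  have nw: "norm w \<le> norm (?PA u')" using vle[OF w(1) A[OF w(1)]] w(2) by simp
  have "?PA u' \<bullet> (u' - ?PA u') = 0"
    using closest_point_subspace[OF sA] orthogonal_comp_inner by blast
  then have "(norm (?PA u'))\<^sup>2 = ?PA u' \<bullet> u'" by (simp add: inner_diff_right power2_norm_eq_inner)
  \<comment> \<open>\<open>w + B *v w\<close> lies in the second graph and is orthogonal to
    \<open>u'\<close>, so only the difference of the slopes survives.\<close>
  also have "\<dots> = (A *v w - B *v w) \<bullet> u'"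
  proof -
    have "(w + B *v w) \<bullet> u' = 0"
      using u' w(1) by (intro orthogonal_comp_inner[of _ "graph_over V B"]) (auto simp: graph_over_def)
    then show ?thesis by (simp add: w(2) inner_simps)
  qed
  also have "\<dots> \<le> norm (A *v w - B *v w) * norm u'" by (rule norm_cauchy_schwarz)
  also have "\<dots> \<le> (K * norm w) * norm u'" using K(1)[OF w(1)] by (simp add: mult_right_mono)
  also have "\<dots> \<le> (K * norm (?PA u')) * norm u'" using nw K(2) by (intro mult_right_mono mult_left_mono) auto
  finally have "norm (?PA u') * norm (?PA u') \<le> norm (?PA u') * (K * norm u')"
    by (simp add: power2_eq_square algebra_simps)
  then have "norm (?PA u') \<le> K * norm u'"
    using K(2) by (cases "?PA u' = 0") (auto dest: mult_left_le_imp_le)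
  also have "\<dots> \<le> K * norm u"
    using norm_closest_point_le(2)[OF sB, of u] K(2) by (simp add: u'_def c_def mult_left_mono)
  finally have 2: "norm (?PA u') \<le> K * norm u" .
  have "?PA u = ?PA c + ?PA u'"
    using linear_add[OF linear_closest_point[OF sA], of c u'] by (simp add: u'_def)
  then have "?PA u - ?PB u = (?PA c - c) + ?PA u'" by (simp add: c_def)
  then have "norm (?PA u - ?PB u) = norm ((?PA c - c) + ?PA u')" by (rule arg_cong)
  also have "\<dots> \<le> K * norm u + K * norm u" by (rule norm_triangle_le) (use 1 2 in linarith)
  finally show ?thesis by simp
qed

lemma norm_matrix_vector_le: "norm (A *v x) \<le> (\<Sum>i\<in>UNIV. \<Sum>j\<in>UNIV. \<bar>A $ i $ j\<bar>) * norm x"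
  for A :: "real ^ 'n ^ 'm"
  using onorm[OF matrix_vector_mul_bounded_linear[of A], of x]
    mult_right_mono[OF onorm_le_matrix_component_sum[of A], of "norm x"] by simp

text \<open>The columns of the projection matrix are the projections of the unit vectors, so
  continuity of the projection of each fixed \<open>u\<close> is enough.\<close>

lemma continuous_on_orth_proj_graph_over:
  fixes A :: "'a::metric_space \<Rightarrow> real ^ 'n ^ 'n"
  assumes V: "subspace V" and A: "\<And>x v. x \<in> S \<Longrightarrow> v \<in> V \<Longrightarrow> A x *v v \<in> V\<^sup>\<bottom>" and cont: "continuous_on S A"
  shows "continuous_on S (\<lambda>x. orth_proj (graph_over V (A x)))"
proof -
  have "continuous_on S (\<lambda>x. closest_point (graph_over V (A x)) u)" for u
    unfolding continuous_on_def
  proof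
    fix x assume x: "x \<in> S"
    define K where "K y = (\<Sum>i\<in>UNIV. \<Sum>j\<in>UNIV. \<bar>(A y - A x) $ i $ j\<bar>)" for y
    have "continuous_on S K" unfolding K_def by (intro continuous_intros cont)
    then have "(K \<longlongrightarrow> K x) (at x within S)" using x by (simp add: continuous_on_def)
    then have "((\<lambda>y. 2 * K y * norm u) \<longlongrightarrow> 2 * K x * norm u) (at x within S)"
      by (intro tendsto_intros)
    then have lim: "((\<lambda>y. 2 * K y * norm u) \<longlongrightarrow> 0) (at x within S)" by (simp add: K_def)
    have "\<forall>\<^sub>F y in at x within S. norm (closest_point (graph_over V (A y)) u - closest_point (graph_over V (A x)) u)
        \<le> 2 * K y * norm u"
      unfolding eventually_at_filter
    proof (intro always_eventually allI impI)
      fix y assume "y \<in> S"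
      show "norm (closest_point (graph_over V (A y)) u - closest_point (graph_over V (A x)) u) \<le> 2 * K y * norm u"
      proof (rule closest_point_graph_over_diff[OF V])
        show "norm (A y *v v - A x *v v) \<le> K y * norm v" for v
          using norm_matrix_vector_le[of "A y - A x" v] by (simp add: K_def matrix_vector_mult_diff_rdistrib)
      qed (use A x \<open>y \<in> S\<close> in \<open>auto simp: K_def sum_nonneg\<close>)
    qed
    then have "((\<lambda>y. closest_point (graph_over V (A y)) u - closest_point (graph_over V (A x)) u) \<longlongrightarrow> 0) (at x within S)"
      by (rule Lim_null_comparison[OF _ lim])
    then show "((\<lambda>y. closest_point (graph_over V (A y)) u) \<longlongrightarrow> closest_point (graph_over V (A x)) u) (at x within S)"
      by (rule LIM_zero_cancel)
  qed
  then show ?thesis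
    unfolding orth_proj_def matrix_def by (intro continuous_intros)
qed

section \<open>The topology of the Nash transformation\<close>

lemma topspace_Gr: "topspace (Gr_topology d) = Gr d"
  by (simp add: Gr_topology_def topspace_pullback_topology)

lemma Hausdorff_Gr: "Hausdorff_space (Gr_topology d :: (real ^ 'n) set topology)"
proof (rule Hausdorff_space_injective_preimage)
  show "continuous_map (Gr_topology d) euclidean (orth_proj :: (real ^ 'n) set \<Rightarrow> _)"
    unfolding Gr_topology_def using continuous_map_pullback[OF continuous_map_id] by (metis id_comp)
  show "inj_on orth_proj (topspace (Gr_topology d :: (real ^ 'n) set topology))"
    unfolding topspace_Gr Gr_def inj_on_def using orth_proj_inject by blast
qed (simp add: Hausdorff_space_euclidean)

lemma continuous_map_Gr:
  assumes "continuous_on X (\<lambda>x. orth_proj (T x))" "\<And>x. x \<in> X \<Longrightarrow> T x \<in> Gr d"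
  shows "continuous_map (top_of_set X) (Gr_topology d) T"
  unfolding Gr_topology_def
  by (rule continuous_map_pullback') (use assms in \<open>auto simp: o_def\<close>)

text \<open>Closure points are limits of sequences here, since the balls of radius
  \<open>inverse (Suc j)\<close> around the point and, through \<open>orth_proj\<close>, around the
  subspace give a countable family of product neighbourhoods.\<close>

lemma nash_transformationD:
  assumes "(x, T) \<in> nash_transformation d X"
  shows "x \<in> X" "T \<in> Gr d"
    "\<exists>s. (\<forall>j::nat. s j \<in> X - Sing1 X) \<and> s \<longlonglongrightarrow> x \<and>
       limitin (Gr_topology d) (\<lambda>j. tangent_space X (s j)) T sequentially"
proof -
  let ?Y = "prod_topology (top_of_set X) (Gr_topology d)"
  have "(x, T) \<in> topspace ?Y"
    using assms unfolding nash_transformation_def by (rule subsetD[OF closure_of_subset_topspace])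
  then show x: "x \<in> X" and T: "T \<in> Gr d" by (auto simp: topspace_Gr)
  have "\<exists>s. s \<in> X - Sing1 X \<and> dist s x < inverse (Suc j) \<and> tangent_space X s \<in> Gr d \<and>
      dist (orth_proj (tangent_space X s)) (orth_proj T) < inverse (Suc j)" for j
  proof -
    define O1 where "O1 = X \<inter> ball x (inverse (Suc j))"
    define O2 where "O2 = orth_proj -` ball (orth_proj T) (inverse (Suc j)) \<inter> Gr d"
    have "openin (Gr_topology d) O2"
      unfolding Gr_topology_def openin_pullback_topology O2_def by (auto simp: open_openin[symmetric])
    moreover have "openin (top_of_set X) O1" by (auto simp: O1_def)
    ultimately have "openin ?Y (O1 \<times> O2)" by (simp add: openin_prod_Times_iff)
    moreover have "(x, T) \<in> O1 \<times> O2" using x T by (auto simp: O1_def O2_def)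
    ultimately obtain y where "y \<in> (\<lambda>x. (x, tangent_space X x)) ` (X - Sing1 X)" "y \<in> O1 \<times> O2"
      using assms unfolding nash_transformation_def in_closure_of by meson
    then show ?thesis by (auto simp: O1_def O2_def dist_commute)
  qed
  then obtain s where s: "\<And>j. s j \<in> X - Sing1 X" "\<And>j. dist (s j) x < inverse (Suc j)"
    "\<And>j. tangent_space X (s j) \<in> Gr d"
    "\<And>j. dist (orth_proj (tangent_space X (s j))) (orth_proj T) < inverse (Suc j)"
    by metis
  have "s \<longlonglongrightarrow> x"
    by (rule metric_tendsto_imp_tendsto[OF LIMSEQ_inverse_real_of_nat])
      (use s(2) in \<open>auto intro!: always_eventually simp: less_imp_le\<close>)
  moreover have lim: "(\<lambda>j. orth_proj (tangent_space X (s j))) \<longlonglongrightarrow> orth_proj T"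
    by (rule metric_tendsto_imp_tendsto[OF LIMSEQ_inverse_real_of_nat])
      (use s(4) in \<open>auto intro!: always_eventually simp: less_imp_le\<close>)
  have "limitin (Gr_topology d) (\<lambda>j. tangent_space X (s j)) T sequentially"
    unfolding limitin_def
  proof (intro conjI allI impI)
    show "T \<in> topspace (Gr_topology d)" using T by (simp add: topspace_Gr)
    fix W assume "openin (Gr_topology d) W \<and> T \<in> W"
    then obtain O' where O': "open O'" "W = orth_proj -` O' \<inter> Gr d" "orth_proj T \<in> O'"
      unfolding Gr_topology_def openin_pullback_topology by auto
    have "\<forall>\<^sub>F j in sequentially. orth_proj (tangent_space X (s j)) \<in> O'"
      using topological_tendstoD[OF lim O'(1,3)] .
    then show "\<forall>\<^sub>F j in sequentially. tangent_space X (s j) \<in> W"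
      by eventually_elim (use s(3) O'(2) in auto)
  qed
  ultimately show "\<exists>s. (\<forall>j::nat. s j \<in> X - Sing1 X) \<and> s \<longlonglongrightarrow> x \<and>
       limitin (Gr_topology d) (\<lambda>j. tangent_space X (s j)) T sequentially"
    using s(1) by blast
qed

lemma nash_transformationI:
  assumes "x \<in> X" "\<And>j::nat. s j \<in> X - Sing1 X" "s \<longlonglongrightarrow> x"
    "limitin (Gr_topology d) (\<lambda>j. tangent_space X (s j)) T sequentially"
  shows "(x, T) \<in> nash_transformation d X"
  unfolding nash_transformation_def in_closure_of
proof (intro conjI allI impI)
  have T: "T \<in> Gr d" using assms(4) by (simp add: limitin_def topspace_Gr)
  show "(x, T) \<in> topspace (prod_topology (top_of_set X) (Gr_topology d))"
    using assms(1) T by (simp add: topspace_Gr)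
  fix W assume "(x, T) \<in> W \<and> openin (prod_topology (top_of_set X) (Gr_topology d)) W"
  then obtain O1 O2 where O: "openin (top_of_set X) O1" "openin (Gr_topology d) O2" "x \<in> O1" "T \<in> O2" "O1 \<times> O2 \<subseteq> W"
    unfolding openin_prod_topology_alt by meson
  obtain O' where O': "open O'" "O1 = X \<inter> O'" using O(1) openin_open by metis
  have "\<forall>\<^sub>F j in sequentially. s j \<in> O'"
    using assms(3) O'(1) O(3) O'(2) by (auto intro: topological_tendstoD)
  moreover have "\<forall>\<^sub>F j in sequentially. tangent_space X (s j) \<in> O2"
    using assms(4) O(2,4) by (simp add: limitin_def)
  ultimately have "\<forall>\<^sub>F j in sequentially. (s j, tangent_space X (s j)) \<in> W"
    by eventually_elim (use assms(2) O'(2) O(5) in auto)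
  then obtain j where "(s j, tangent_space X (s j)) \<in> W"
    by (auto simp: eventually_sequentially)
  then show "\<exists>y. y \<in> (\<lambda>x. (x, tangent_space X x)) ` (X - Sing1 X) \<and> y \<in> W"
    using assms(2) by blast
qed

text \<open>Limits of tangent spaces at \<open>x\<close> are exactly the points of the Nash fibre
  over \<open>x\<close>; if there is one, the union defining \<open>C4\<close> has a single
  member.\<close>

lemma C4_eq_of_unique_limit:
  assumes "x \<in> X" "(x, T) \<in> nash_transformation d X"
    "\<And>T'. (x, T') \<in> nash_transformation d X \<Longrightarrow> T' = T"
  shows "C4 d X x = T"
proof -
  have "{T' \<in> Gr d. \<exists>s. (\<forall>j::nat. s j \<in> X - Sing1 X) \<and> s \<longlonglongrightarrow> x \<and>
      limitin (Gr_topology d) (\<lambda>j. tangent_space X (s j)) T' sequentially} = {T}"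
    using nash_transformationD[OF assms(2)] nash_transformationI[OF assms(1)] assms(3) by blast
  then show ?thesis unfolding C4_def by simp
qed

section \<open>Sets tangent to a log-Lipschitz field of subspaces\<close>

text \<open>Isolates what the cone estimate and the lifting use: local compactness of
  \<open>X\<close> and tangent cones that are graphs over one fixed \<open>V\<close>. No modulus of
  continuity for \<open>A\<close> enters yet.\<close>

locale tangent_cone_field =
  fixes V X :: "(real ^ 'n) set" and A :: "real ^ 'n \<Rightarrow> real ^ 'n ^ 'n" and p :: "real ^ 'n" and r :: real
  assumes subspace_V: "subspace V"
    and compact_X: "compact (X \<inter> cball p r)"
    and normal: "\<And>x v. x \<in> X \<inter> cball p r \<Longrightarrow> v \<in> V \<Longrightarrow> A x *v v \<in> V\<^sup>\<bottom>"
    and cone: "\<And>x. x \<in> X \<inter> cball p r \<Longrightarrow> C3 X x = graph_over V (A x)"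
begin

abbreviation "P \<equiv> closest_point V"

lemma P_in: "P x \<in> V"
  by (rule closest_point_subspace(1)[OF subspace_V])

lemma P_diff: "P (x - y) = P x - P y"
  by (rule linear_diff[OF linear_closest_point[OF subspace_V]])

lemma P_scale: "P (c *\<^sub>R x) = c *\<^sub>R P x"
  by (rule linear_scale[OF linear_closest_point[OF subspace_V]])

lemma continuous_P: "continuous_on S P"
  by (rule linear_continuous_on[OF bounded_linear_closest_point[OF subspace_V]])

lemma tendsto_P: "(f \<longlongrightarrow> a) F \<Longrightarrow> ((\<lambda>x. P (f x)) \<longlongrightarrow> P a) F"
  by (rule bounded_linear.tendsto[OF bounded_linear_closest_point[OF subspace_V]])

text \<open>If it failed, the normalised differences would accumulate at a unit vector of the
  tangent cone, which is the graph of \<open>A x\<close>. The failed inequality then forces the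
  \<open>V\<close>-component of that vector to vanish, and with it the vector. The error is measured
  against the projected increment, so in particular \<open>x\<close> is isolated in its
  fibre.\<close>

lemma cone_estimate:
  assumes x: "x \<in> X \<inter> cball p r" and e: "e > 0"
  shows "\<exists>\<delta>>0. \<forall>y\<in>X. dist y x < \<delta> \<longrightarrow>
    norm (y - x - (P (y - x) + A x *v P (y - x))) \<le> e * norm (P (y - x))"
proof (rule ccontr)
  assume neg: "\<not> ?thesis"
  define L where "L u = u - (P u + A x *v P u)" for u
  have "\<exists>y\<in>X. dist y x < inverse (Suc j) \<and> norm (L (y - x)) > e * norm (P (y - x))" for j
    using neg unfolding L_def by (metis inverse_positive_iff_positive not_le of_nat_0_less_iff zero_less_Suc)
  then obtain y where y: "\<And>j. y j \<in> X" "\<And>j. dist (y j) x < inverse (Suc j)"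
    "\<And>j. norm (L (y j - x)) > e * norm (P (y j - x))"
    by metis
  have P0: "P 0 = 0" using linear_0[OF linear_closest_point[OF subspace_V]] .
  have ne: "y j \<noteq> x" for j
    using y(3)[of j] P0 by (auto simp: L_def matrix_vector_mult_0_right)
  define t where "t j = norm (y j - x)" for j
  have t: "t j > 0" for j using ne by (simp add: t_def)
  define u where "u j = (1 / t j) *\<^sub>R (y j - x)" for j
  have L_scale: "L (c *\<^sub>R w) = c *\<^sub>R L w" for c w
    by (simp add: L_def P_scale matrix_vector_mult_scaleR scaleR_diff_right scaleR_add_right)
  have Lu: "norm (L (u j)) \<ge> e * norm (P (u j))" for j
  proof -
    have "(1 / t j) * (e * norm (P (y j - x))) \<le> (1 / t j) * norm (L (y j - x))"
      using y(3)[of j] t[of j] by (intro mult_left_mono) auto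
    then show ?thesis
      unfolding u_def L_scale P_scale norm_scaleR using t[of j] by (simp add: mult.left_commute)
  qed
  have "u j \<in> sphere 0 1" for j using t[of j] by (simp add: u_def t_def)
  then obtain l \<sigma> where l: "l \<in> sphere 0 1" "strict_mono \<sigma>" "(u \<circ> \<sigma>) \<longlonglongrightarrow> l"
    using compact_sphere[of "0::real^'n" 1] unfolding compact_def by meson
  have "t \<longlonglongrightarrow> 0"
    by (rule metric_tendsto_imp_tendsto[OF LIMSEQ_inverse_real_of_nat])
      (use y(2) in \<open>auto intro!: always_eventually simp: t_def dist_norm less_imp_le\<close>)
  then have "(t \<circ> \<sigma>) \<longlonglongrightarrow> 0" using l(2) by (rule LIMSEQ_subseq_LIMSEQ)
  then have "l \<in> C3 X x"
    unfolding C3_def using y(1) t l(3)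
    by (intro CollectI exI[of _ "y \<circ> \<sigma>"] exI[of _ "t \<circ> \<sigma>"]) (simp add: o_def u_def)
  then obtain v where v: "v \<in> V" "l = v + A x *v v" using cone[OF x] by (auto simp: graph_over_def)
  have Pl: "P l = v"
    unfolding v(2) by (rule closest_point_add_orthogonal[OF subspace_V v(1) normal[OF x v(1)]])
  have "(\<lambda>j. norm (L (u (\<sigma> j)))) \<longlonglongrightarrow> norm (L l)"
    unfolding L_def using l(3)
    by (intro tendsto_intros tendsto_P bounded_linear.tendsto[OF matrix_vector_mul_bounded_linear]) (simp_all add: o_def)
  moreover have "(\<lambda>j. e * norm (P (u (\<sigma> j)))) \<longlonglongrightarrow> e * norm (P l)"
    using l(3) by (intro tendsto_intros tendsto_P) (simp_all add: o_def)
  ultimately have "e * norm (P l) \<le> norm (L l)"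
    using Lu by (blast intro: LIMSEQ_le)
  then have "v = 0" using e by (simp add: L_def Pl v(2)[symmetric] mult_le_0_iff)
  then show False using l(1) v(2) by (simp add: matrix_vector_mult_0_right)
qed

text \<open>A point of \<open>X\<close> near \<open>x\<close> whose projection is closest to \<open>v'\<close> projects to \<open>v'\<close>, since its
  tangent cone surjects onto \<open>V\<close>.\<close>

lemma lift:
  assumes x: "x \<in> X" "dist x p < r" and e: "e > 0"
  shows "\<exists>\<delta>>0. \<forall>v\<in>V. norm (v - P x) < \<delta> \<longrightarrow>
    (\<exists>y\<in>X. P y = v \<and> norm (y - x - ((v - P x) + A x *v (v - P x))) \<le> e * norm (v - P x))"
proof -
  have xr: "x \<in> X \<inter> cball p r" using x by (auto simp: dist_commute)
  obtain \<delta>1 where \<delta>1: "\<delta>1 > 0" and est: "\<And>y. y \<in> X \<Longrightarrow> dist y x < \<delta>1 \<Longrightarrow>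
    norm (y - x - (P (y - x) + A x *v P (y - x))) \<le> e * norm (P (y - x))"
    using cone_estimate[OF xr e] by blast
  define M where "M = (\<Sum>i\<in>UNIV. \<Sum>j\<in>UNIV. \<bar>A x $ i $ j\<bar>)"
  have M: "M \<ge> 0" "\<And>h. norm (A x *v h) \<le> M * norm h"
    unfolding M_def by (auto intro: sum_nonneg norm_matrix_vector_le)
  define c where "c = e + 1 + M"
  have c: "c > 0" using e M by (simp add: c_def)
  have near: "norm (y - x) \<le> c * norm (P (y - x))" if "y \<in> X" "dist y x < \<delta>1" for y
  proof -
    let ?h = "P (y - x)"
    have "norm (y - x) \<le> norm (y - x - q) + norm q" for q
      using norm_triangle_ineq[of "y - x - q" q] by simp
    from this[of "?h + A x *v ?h"]
    have "norm (y - x) \<le> norm (y - x - (?h + A x *v ?h)) + (norm ?h + norm (A x *v ?h))"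
      using norm_triangle_ineq[of ?h "A x *v ?h"] by linarith
    then show ?thesis using est[OF that] M(2)[of ?h] by (simp add: c_def algebra_simps)
  qed
  define \<delta>2 where "\<delta>2 = min (\<delta>1 / 2) ((r - dist x p) / 2)"
  have \<delta>2: "\<delta>2 > 0" "\<delta>2 < \<delta>1" "\<delta>2 + dist x p < r"
  proof -
    have "\<delta>2 \<le> \<delta>1 / 2" "\<delta>2 \<le> (r - dist x p) / 2"
      by (simp_all only: \<delta>2_def min.cobounded1 min.cobounded2)
    then show "\<delta>2 < \<delta>1" "\<delta>2 + dist x p < r" using \<delta>1 x(2) by simp_all
  qed (use \<delta>1 x(2) in \<open>auto simp: \<delta>2_def\<close>)
  have sub: "cball x \<delta>2 \<subseteq> cball p r"
  proof
    fix y assume "y \<in> cball x \<delta>2"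
    then show "y \<in> cball p r" using \<delta>2(3) dist_triangle[of p y x] by (simp add: dist_commute)
  qed
  define K where "K = X \<inter> cball x \<delta>2"
  have "K = (X \<inter> cball p r) \<inter> cball x \<delta>2" using sub by (auto simp: K_def)
  then have "compact K" using compact_X by (simp add: compact_Int_closed)
  \<comment> \<open>The minimiser \<open>y\<close> below satisfies
    \<open>norm (P (y - x)) < 2 * \<delta>\<close>, so it lies at distance less than
    \<open>c * (2 * \<delta>) = \<delta>2\<close> from \<open>x\<close>. Hence it is interior to the
    ball, and points of \<open>X\<close> near it compete in the minimisation.\<close>
  define \<delta> where "\<delta> = \<delta>2 / (2 * c)"
  have \<delta>: "\<delta> > 0" using \<delta>2 c by (simp add: \<delta>_def)
  have "\<exists>y\<in>X. P y = v \<and> norm (y - x - ((v - P x) + A x *v (v - P x))) \<le> e * norm (v - P x)"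
    if v: "v \<in> V" "norm (v - P x) < \<delta>" for v
  proof -
    have "x \<in> K" using x \<delta>2 by (simp add: K_def)
    moreover have "continuous_on K (\<lambda>y. norm (P y - v))" by (intro continuous_intros continuous_P)
    ultimately obtain y where y: "y \<in> K" "\<And>y'. y' \<in> K \<Longrightarrow> norm (P y - v) \<le> norm (P y' - v)"
      using continuous_attains_inf[OF \<open>compact K\<close>] by blast
    have yX: "y \<in> X" "dist y x < \<delta>1" using y(1) \<delta>2 by (auto simp: K_def dist_commute)
    have Pyv: "norm (P y - v) < \<delta>"
      using y(2)[OF \<open>x \<in> K\<close>] v(2) by (simp add: norm_minus_commute)
    have "norm (P (y - x)) < 2 * \<delta>"
      using norm_triangle_ineq[of "P y - v" "v - P x"] Pyv v(2) by (simp add: P_diff)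
    then have "c * norm (P (y - x)) < c * (2 * \<delta>)" using c by (rule mult_strict_left_mono)
    then have "norm (y - x) < \<delta>2" using near[OF yX] c by (simp add: \<delta>_def)
    have "P y = v"
    proof (rule ccontr)
      assume neq: "P y \<noteq> v"
      define h where "h = v - P y"
      have h: "h \<in> V" "norm h > 0" using neq v(1) P_in subspace_diff[OF subspace_V] by (auto simp: h_def)
      have yr: "y \<in> X \<inter> cball p r" using y(1) sub by (auto simp: K_def)
      \<comment> \<open>The cone at \<open>y\<close> contains a direction that projects to the
        missing increment \<open>h\<close>; points of \<open>X\<close> approaching \<open>y\<close>
        along it come closer to the fibre over \<open>v\<close>.\<close>
      have "h + A y *v h \<in> C3 X y" using cone[OF yr] h(1) by (auto simp: graph_over_def)
      then obtain s t where s: "\<And>j::nat. s j \<in> X" "\<And>j. t j > 0" "t \<longlonglongrightarrow> 0"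
        "(\<lambda>j. (1 / t j) *\<^sub>R (s j - y)) \<longlonglongrightarrow> h + A y *v h"
        unfolding C3_def by blast
      have "(\<lambda>j. t j *\<^sub>R ((1 / t j) *\<^sub>R (s j - y))) \<longlonglongrightarrow> 0 *\<^sub>R (h + A y *v h)"
        by (intro tendsto_intros s)
      moreover have "t j *\<^sub>R ((1 / t j) *\<^sub>R (s j - y)) = s j - y" for j
        using s(2)[of j] by simp
      ultimately have "(\<lambda>j. s j - y) \<longlonglongrightarrow> 0" by simp
      then have "s \<longlonglongrightarrow> y" by (rule LIM_zero_cancel)
      moreover have "y \<in> ball x \<delta>2" using \<open>norm (y - x) < \<delta>2\<close> by (simp add: dist_norm norm_minus_commute)
      ultimately have evK: "\<forall>\<^sub>F j in sequentially. s j \<in> ball x \<delta>2"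
        by (rule topological_tendstoD[OF _ open_ball])
      have "(\<lambda>j. P ((1 / t j) *\<^sub>R (s j - y))) \<longlonglongrightarrow> P (h + A y *v h)"
        by (intro tendsto_P s)
      moreover have "P (h + A y *v h) = h"
        by (rule closest_point_add_orthogonal[OF subspace_V h(1) normal[OF yr h(1)]])
      ultimately have "(\<lambda>j. P ((1 / t j) *\<^sub>R (s j - y))) \<longlonglongrightarrow> h" by (simp only:)
      then have "\<forall>\<^sub>F j in sequentially. dist (P ((1 / t j) *\<^sub>R (s j - y))) h < norm h"
        using h(2) by (rule tendstoD)
      moreover have "\<forall>\<^sub>F j in sequentially. dist (t j) 0 < 1"
        using s(3) by (rule tendstoD) simp
      ultimately have "\<forall>\<^sub>F j in sequentially. s j \<in> ball x \<delta>2 \<and>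
          dist (P ((1 / t j) *\<^sub>R (s j - y))) h < norm h \<and> dist (t j) 0 < 1"
        using evK by eventually_elim simp
      then obtain j where j: "s j \<in> ball x \<delta>2" "norm (P ((1 / t j) *\<^sub>R (s j - y)) - h) < norm h" "t j < 1"
        by (auto simp: eventually_sequentially dist_norm)
      define q where "q = P ((1 / t j) *\<^sub>R (s j - y))"
      \<comment> \<open>The new defect combines \<open>q - h\<close>, shorter than \<open>h\<close>,
        and \<open>- h\<close> with weights \<open>t j\<close> and \<open>1 - t j\<close>, so it is
        strictly shorter than the old one.\<close>
      have q: "P (s j) - v = t j *\<^sub>R (q - h) - (1 - t j) *\<^sub>R h"
        using s(2)[of j] by (simp add: q_def h_def P_scale P_diff algebra_simps)
      have "norm (P (s j) - v) \<le> t j * norm (q - h) + (1 - t j) * norm h"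
        unfolding q using s(2)[of j] j(3) by (intro order_trans[OF norm_triangle_ineq4]) simp
      also have "\<dots> < t j * norm h + (1 - t j) * norm h"
        using j(2) s(2)[of j] by (simp add: q_def)
      also have "\<dots> = norm (P y - v)" by (simp add: h_def norm_minus_commute algebra_simps)
      finally have "norm (P (s j) - v) < norm (P y - v)" .
      moreover have "s j \<in> K" using j(1) s(1) by (auto simp: K_def)
      ultimately show False using y(2) by fastforce
    qed
    then show ?thesis using est[OF yX] yX(1) by (auto simp: P_diff intro!: bexI[of _ y])
  qed
  then show ?thesis using \<delta> by blast
qed

end

section \<open>Osgood's argument on the fibres and the local section\<close>

locale log_lipschitz_cone_field = tangent_cone_field +
  fixes C :: real
  assumes C_pos: "C > 0"
    and log_lipschitz: "\<And>x y v. x \<in> X \<inter> cball p r \<Longrightarrow> y \<in> X \<inter> cball p r \<Longrightarrow> x \<noteq> y \<Longrightarrow> dist x y \<le> 1/2 \<Longrightarrow>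
      v \<in> V \<Longrightarrow> norm (A x *v v - A y *v v) \<le> C * (dist x y * \<bar>ln (dist x y)\<bar>) * norm v"
begin

text \<open>The comparison function solves \<open>z' = -(C + 1) z log z\<close>, while the distance \<open>u\<close> of two points of
  \<open>X\<close> with the same projection grows at rate at most \<open>- C u log u\<close> along a ray.\<close>

lemma fibre_distance_bound:
  assumes \<rho>: "\<rho> < r" "\<rho> \<le> 1/4" and c: "\<And>y. y \<in> X \<inter> cball p \<rho> \<Longrightarrow> dist y p \<le> c * norm (P y - P p)"
    and w: "w \<in> V" "norm w \<le> 1" "c * norm w < \<rho>" "c > 0"
    and a: "a > 0" and t: "t \<in> {0..1}"
    and y: "y1 \<in> X \<inter> cball p \<rho>" "y2 \<in> X \<inter> cball p \<rho>" "P y1 = P p + t *\<^sub>R w" "P y2 = P p + t *\<^sub>R w"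
  shows "dist y1 y2 < exp (- (a * exp (- ((C + 1) * t))))"
proof (rule ccontr)
  assume neg: "\<not> ?thesis"
  define K where "K = X \<inter> cball p \<rho>"
  \<comment> \<open>The parameter \<open>a\<close> fixes the initial value exp(-a), so this is a
    whole family of comparison functions.\<close>
  define z where "z t = exp (- (a * exp (- ((C + 1) * t))))" for t
  have z_pos: "z t > 0" for t by (simp add: z_def)
  have z_deriv: "(z has_real_derivative - ((C + 1) * (z t * ln (z t)))) (at t)" for t
    unfolding z_def by (auto intro!: derivative_eq_intros simp: algebra_simps)
  have z_cont: "continuous_on S z" for S
    unfolding z_def by (intro continuous_intros)
  have "K = (X \<inter> cball p r) \<inter> cball p \<rho>" using \<rho> by (auto simp: K_def)
  then have compact_K: "compact K" using compact_X by (simp add: compact_Int_closed)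
  \<comment> \<open>The times and pairs of points at which the bound fails. Compactness provides a
    smallest failing time \<open>t0\<close> without any continuous choice of the two points.\<close>
  define Q where "Q = ({0..1} \<times> (K \<times> K)) \<inter>
    ({q. P (fst (snd q)) = P p + fst q *\<^sub>R w} \<inter> {q. P (snd (snd q)) = P p + fst q *\<^sub>R w} \<inter>
     {q. z (fst q) \<le> dist (fst (snd q)) (snd (snd q))})"
  have "compact Q"
    unfolding Q_def
    by (intro compact_Int_closed compact_Times compact_K compact_Icc closed_Int closed_Collect_eq closed_Collect_le
        continuous_intros continuous_on_compose2[OF continuous_P] continuous_on_compose2[OF z_cont]) auto
  then have "compact (fst ` Q)" by (intro compact_continuous_image continuous_intros)
  moreover have "(t, y1, y2) \<in> Q" using neg t y by (auto simp: Q_def K_def z_def not_less)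
  then have "fst ` Q \<noteq> {}" by blast
  ultimately obtain t0 where t0: "t0 \<in> fst ` Q" "\<And>s. s \<in> fst ` Q \<Longrightarrow> t0 \<le> s"
    using compact_attains_inf by metis
  then obtain x1 x2 where xQ: "(t0, x1, x2) \<in> Q" by force
  then have x: "x1 \<in> K" "x2 \<in> K" "P x1 = P p + t0 *\<^sub>R w" "P x2 = P p + t0 *\<^sub>R w" "z t0 \<le> dist x1 x2"
    and t0': "0 \<le> t0" "t0 \<le> 1"
    by (auto simp: Q_def)
  have before: "dist x1' x2' < z s" if "s \<in> {0..1}" "s < t0" "x1' \<in> K" "x2' \<in> K"
    "P x1' = P p + s *\<^sub>R w" "P x2' = P p + s *\<^sub>R w" for s x1' x2'
  proof (rule ccontr)
    assume "\<not> ?thesis"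
    then have "(s, x1', x2') \<in> Q" using that by (auto simp: Q_def)
    then show False using t0(2)[of s] that(2) by force
  qed
  \<comment> \<open>Strict inequality leaves room to move the points backwards along the ray without
    leaving \<open>K\<close>.\<close>
  have inside: "dist x' p < \<rho>" if "x' \<in> K" "P x' = P p + t0 *\<^sub>R w" for x'
  proof -
    have "dist x' p \<le> c * (t0 * norm w)" using c[of x'] that t0' by (simp add: K_def)
    also have "\<dots> \<le> c * (1 * norm w)" using t0' w(4) by (intro mult_left_mono mult_right_mono) auto
    finally show ?thesis using w(3) by simp
  qed
  define u where "u = dist x1 x2"
  have u: "u > 0" "z t0 \<le> u" using x(5) z_pos[of t0] by (auto simp: u_def)
  have "u \<le> 1/2"
    unfolding u_def using inside[OF x(1,3)] inside[OF x(2,4)] \<rho>(2) dist_triangle2[of x1 x2 p] by linarith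
  \<comment> \<open>Over the start of the ray the bound \<open>c\<close> collapses the fibre to
    \<open>p\<close>, whereas the comparison function is positive.\<close>
  have "t0 \<noteq> 0"
  proof
    assume "t0 = 0"
    then have "x1 = p" "x2 = p" using c[of x1] c[of x2] x by (auto simp: K_def)
    then show False using u by (simp add: u_def)
  qed
  then have t0_pos: "t0 > 0" using t0' by simp
  define \<kappa> where "\<kappa> = u * \<bar>ln u\<bar>"
  have "ln u < 0" using u(1) \<open>u \<le> 1/2\<close> by simp
  then have \<kappa>: "\<kappa> > 0" "\<kappa> = - (u * ln u)"
    using u(1) mult_pos_neg[of u "ln u"] by (auto simp: \<kappa>_def)
  \<comment> \<open>The two lifts together err by at most
    \<open>2 * e * \<tau> = \<kappa> * \<tau> / 2\<close>, half of the surplus of the rate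
    \<open>C + 1\<close> over \<open>C\<close>.\<close>
  define e where "e = \<kappa> / 4"
  have e: "e > 0" using \<kappa> by (simp add: e_def)
  have lifts: "\<exists>\<tau>1>0. \<forall>\<tau>. 0 < \<tau> \<and> \<tau> < \<tau>1 \<longrightarrow> (\<exists>x'\<in>K. P x' = P p + (t0 - \<tau>) *\<^sub>R w \<and>
      norm (x' - x + \<tau> *\<^sub>R (w + A x *v w)) \<le> e * \<tau>)"
    if xK: "x \<in> K" "P x = P p + t0 *\<^sub>R w" for x
  proof -
    have "x \<in> X" "dist x p < r" using xK inside[OF xK] \<rho>(1) by (auto simp: K_def)
    then obtain \<delta> where \<delta>: "\<delta> > 0" and L: "\<And>v. v \<in> V \<Longrightarrow> norm (v - P x) < \<delta> \<Longrightarrow>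
      (\<exists>y\<in>X. P y = v \<and> norm (y - x - ((v - P x) + A x *v (v - P x))) \<le> e * norm (v - P x))"
      using lift[OF _ _ e] by blast
    define m where "m = norm (w + A x *v w) + e"
    have m: "m > 0" using e by (simp add: m_def add_nonneg_pos)
    \<comment> \<open>A lift over time \<open>t0 - \<tau>\<close> moves by at most
      \<open>m * \<tau>\<close>; the second bound therefore keeps it in the ball of radius
      \<open>\<rho>\<close>.\<close>
    define \<tau>1 where "\<tau>1 = min \<delta> ((\<rho> - dist x p) / m)"
    have "\<tau>1 > 0" using \<delta> m inside[OF xK] by (simp add: \<tau>1_def)
    moreover have "\<exists>x'\<in>K. P x' = P p + (t0 - \<tau>) *\<^sub>R w \<and> norm (x' - x + \<tau> *\<^sub>R (w + A x *v w)) \<le> e * \<tau>"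
      if \<tau>: "0 < \<tau>" "\<tau> < \<tau>1" for \<tau>
    proof -
      define v where "v = P p + (t0 - \<tau>) *\<^sub>R w"
      have vx: "v - P x = (- \<tau>) *\<^sub>R w" by (simp add: v_def xK(2) algebra_simps)
      have \<tau>w: "\<tau> * norm w \<le> \<tau>" using \<tau>(1) w(2) by (simp add: mult_left_le)
      have "v \<in> V" unfolding v_def using subspace_V P_in w(1) by (intro subspace_add subspace_scale)
      moreover have "norm (v - P x) < \<delta>"
      proof -
        have "norm (v - P x) = \<tau> * norm w" unfolding vx using \<tau>(1) by simp
        also note \<tau>w
        also have "\<tau> < \<delta>" using \<tau>(2) by (simp add: \<tau>1_def)
        finally show ?thesis .
      qed
      ultimately obtain y where y: "y \<in> X" "P y = v"
        "norm (y - x - ((- \<tau>) *\<^sub>R w + A x *v ((- \<tau>) *\<^sub>R w))) \<le> e * norm ((- \<tau>) *\<^sub>R w)"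
        using L[of v] unfolding vx by blast
      have eq: "y - x - ((- \<tau>) *\<^sub>R w + A x *v ((- \<tau>) *\<^sub>R w)) = y - x + \<tau> *\<^sub>R (w + A x *v w)"
        by (simp only: matrix_vector_mult_scaleR) (simp add: algebra_simps)
      have "e * norm ((- \<tau>) *\<^sub>R w) \<le> e * \<tau>" using \<tau>w e \<tau>(1) by simp
      with y(3) have ye: "norm (y - x + \<tau> *\<^sub>R (w + A x *v w)) \<le> e * \<tau>"
        unfolding eq by (rule order_trans)
      have "norm (y - x) \<le> norm (y - x + \<tau> *\<^sub>R (w + A x *v w)) + norm (\<tau> *\<^sub>R (w + A x *v w))"
        using norm_triangle_ineq4[of "y - x + \<tau> *\<^sub>R (w + A x *v w)" "\<tau> *\<^sub>R (w + A x *v w)"] by simp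
      also have "norm (\<tau> *\<^sub>R (w + A x *v w)) = \<tau> * norm (w + A x *v w)" using \<tau>(1) by simp
      also have "norm (y - x + \<tau> *\<^sub>R (w + A x *v w)) + \<tau> * norm (w + A x *v w) \<le> \<tau> * m"
        using ye unfolding m_def distrib_left mult.commute[of e \<tau>] by linarith
      also have "\<dots> < \<tau>1 * m" using \<tau> m by simp
      also have "\<dots> \<le> \<rho> - dist x p"
        using m mult_right_mono[of \<tau>1 "(\<rho> - dist x p) / m" m] by (simp add: \<tau>1_def)
      finally have "dist y p \<le> \<rho>" using dist_triangle[of y p x] by (simp add: dist_norm)
      then have "y \<in> K" using y(1) by (simp add: K_def dist_commute)
      then show ?thesis using y(2) ye by (auto simp: v_def)
    qed
    ultimately show ?thesis by blast
  qed
  obtain \<tau>1 where \<tau>1: "\<tau>1 > 0" and L1: "\<And>\<tau>. 0 < \<tau> \<Longrightarrow> \<tau> < \<tau>1 \<Longrightarrow> \<exists>x'\<in>K. P x' = P p + (t0 - \<tau>) *\<^sub>R w \<and>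
      norm (x' - x1 + \<tau> *\<^sub>R (w + A x1 *v w)) \<le> e * \<tau>"
    using lifts[OF x(1,3)] by blast
  obtain \<tau>2 where \<tau>2: "\<tau>2 > 0" and L2: "\<And>\<tau>. 0 < \<tau> \<Longrightarrow> \<tau> < \<tau>2 \<Longrightarrow> \<exists>x'\<in>K. P x' = P p + (t0 - \<tau>) *\<^sub>R w \<and>
      norm (x' - x2 + \<tau> *\<^sub>R (w + A x2 *v w)) \<le> e * \<tau>"
    using lifts[OF x(2,4)] by blast
  \<comment> \<open>Minimality of \<open>t0\<close> makes this positive for small
    \<open>\<tau> > 0\<close>, while \<open>\<psi> 0 = z t0 - u \<le> 0\<close>. Continuity then
    gives \<open>z t0 = u\<close>, so the slope at 0 is
    \<open>- (C + 1) * \<kappa> + \<kappa> * (C + 1/2)\<close>, which is negative: a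
    contradiction.\<close>
  define \<psi> where "\<psi> \<tau> = z (t0 - \<tau>) - u + \<tau> * (\<kappa> * (C + 1/2))" for \<tau>
  have \<psi>_pos: "\<psi> \<tau> > 0" if \<tau>: "0 < \<tau>" "\<tau> < min t0 (min \<tau>1 \<tau>2)" for \<tau>
  proof -
    obtain x1' where x1': "x1' \<in> K" "P x1' = P p + (t0 - \<tau>) *\<^sub>R w" "norm (x1' - x1 + \<tau> *\<^sub>R (w + A x1 *v w)) \<le> e * \<tau>"
      using L1[of \<tau>] \<tau> by auto
    obtain x2' where x2': "x2' \<in> K" "P x2' = P p + (t0 - \<tau>) *\<^sub>R w" "norm (x2' - x2 + \<tau> *\<^sub>R (w + A x2 *v w)) \<le> e * \<tau>"
      using L2[of \<tau>] \<tau> by auto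
    have "dist x1' x2' < z (t0 - \<tau>)"
      by (rule before) (use \<tau> t0' x1' x2' in auto)
    \<comment> \<open>The common displacement \<open>\<tau> *\<^sub>R w\<close> cancels. What
      remains are the two lifting errors and the difference of the slopes, at most
      \<open>\<tau> * (C * \<kappa>)\<close>.\<close>
    moreover have "u \<le> dist x1' x2' + \<tau> * (\<kappa> * (C + 1/2))"
    proof -
      have "norm (A x1 *v w - A x2 *v w) \<le> C * (u * \<bar>ln u\<bar>) * norm w"
        unfolding u_def using x(1,2) \<rho>(1) u(1) \<open>u \<le> 1/2\<close> w(1)
        by (intro log_lipschitz) (auto simp: K_def u_def)
      also have "\<dots> \<le> C * \<kappa>"
        using mult_left_mono[OF w(2), of "C * \<kappa>"] C_pos \<kappa>(1) by (simp add: \<kappa>_def)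
      finally have A12: "\<tau> * norm (A x1 *v w - A x2 *v w) \<le> \<tau> * (C * \<kappa>)" using \<tau>(1) by simp
      have 4: "norm (a - b + c + d) \<le> norm a + norm b + norm c + norm d" for a b c d :: "real ^ 'n"
        using norm_triangle_ineq[of "a - b + c" d] norm_triangle_ineq[of "a - b" c] norm_triangle_ineq4[of a b]
        by linarith
      have eq: "x1 - x2 = (x1' - x2') - (x1' - x1 + \<tau> *\<^sub>R (w + A x1 *v w)) + (x2' - x2 + \<tau> *\<^sub>R (w + A x2 *v w))
          + \<tau> *\<^sub>R (A x1 *v w - A x2 *v w)"
        by (simp add: algebra_simps)
      have "norm (x1 - x2) \<le> norm (x1' - x2') + norm (x1' - x1 + \<tau> *\<^sub>R (w + A x1 *v w))
          + norm (x2' - x2 + \<tau> *\<^sub>R (w + A x2 *v w)) + norm (\<tau> *\<^sub>R (A x1 *v w - A x2 *v w))"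
        by (subst eq) (rule 4)
      also have "\<dots> \<le> norm (x1' - x2') + e * \<tau> + e * \<tau> + \<tau> * (C * \<kappa>)"
      proof (intro add_mono order_refl)
        show "norm (\<tau> *\<^sub>R (A x1 *v w - A x2 *v w)) \<le> \<tau> * (C * \<kappa>)"
          unfolding norm_scaleR abs_of_pos[OF \<tau>(1)] by (rule A12)
      qed (rule x1'(3) x2'(3))+
      finally show ?thesis by (simp add: u_def dist_norm e_def algebra_simps)
    qed
    ultimately show ?thesis by (simp add: \<psi>_def)
  qed
  have \<psi>_deriv: "(\<psi> has_real_derivative (C + 1) * (z t0 * ln (z t0)) + \<kappa> * (C + 1/2)) (at 0)"
  proof -
    have "((\<lambda>\<tau>. z (t0 - \<tau>)) has_real_derivative - ((C + 1) * (z (t0 - 0) * ln (z (t0 - 0)))) * (- 1)) (at 0)"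
      by (rule DERIV_chain2[of z _ "\<lambda>\<tau>. t0 - \<tau>", OF z_deriv]) (auto intro!: derivative_eq_intros)
    then show ?thesis unfolding \<psi>_def by (auto intro!: derivative_eq_intros)
  qed
  have "\<forall>\<^sub>F \<tau> in at_right 0. 0 \<le> \<psi> \<tau>"
    unfolding eventually_at_right_field
    using \<psi>_pos t0_pos \<tau>1 \<tau>2 by (intro exI[of _ "min t0 (min \<tau>1 \<tau>2)"]) (auto intro: less_imp_le)
  moreover have "(\<psi> \<longlongrightarrow> \<psi> 0) (at_right 0)"
    using DERIV_isCont[OF \<psi>_deriv] unfolding isCont_def by (rule tendsto_within_subset[OF _ subset_UNIV])
  ultimately have "0 \<le> \<psi> 0"
    using tendsto_lowerbound[of \<psi> "\<psi> 0" "at_right 0" 0] by (simp add: trivial_limit_at_right_real)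
  then have zu: "z t0 = u" using u(2) by (simp add: \<psi>_def)
  have "(\<psi> has_real_derivative - (\<kappa> / 2)) (at 0)"
    using \<psi>_deriv by (simp add: zu \<kappa>(2) algebra_simps)
  then obtain d where d: "d > 0" "\<And>h. 0 < h \<Longrightarrow> h < d \<Longrightarrow> \<psi> 0 > \<psi> (0 + h)"
    using DERIV_neg_dec_right[of \<psi> "- (\<kappa> / 2)" 0] \<kappa>(1) by auto
  define h where "h = min d (min t0 (min \<tau>1 \<tau>2)) / 2"
  have "h > 0" "h < d" "h < min t0 (min \<tau>1 \<tau>2)"
    using d(1) t0_pos \<tau>1 \<tau>2 by (auto simp: h_def min_def)
  then show False using d(2)[of h] \<psi>_pos[of h] by (simp add: \<psi>_def zu)
qed

text \<open>The ray ends at \<open>v\<close> at time 1, and \<open>a\<close> is chosen so that the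
  comparison function takes the value \<open>u\<close> there; the strict bound then reads
  \<open>u < u\<close>.\<close>

lemma fibre_unique:
  assumes \<rho>: "\<rho> < r" "\<rho> \<le> 1/4" and c: "\<And>y. y \<in> X \<inter> cball p \<rho> \<Longrightarrow> dist y p \<le> c * norm (P y - P p)"
    and c0: "c > 0" and v: "norm (v - P p) \<le> 1" "c * norm (v - P p) < \<rho>"
    and y: "y1 \<in> X \<inter> cball p \<rho>" "y2 \<in> X \<inter> cball p \<rho>" "P y1 = v" "P y2 = v"
  shows "y1 = y2"
proof (rule ccontr)
  assume "y1 \<noteq> y2"
  define E where "E = exp (- (C + 1))"
  define u where "u = dist y1 y2"
  have "u \<le> 1/2"
    unfolding u_def using y(1,2) \<rho>(2) dist_triangle3[of y1 y2 p] by auto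
  then have u: "0 < u" "ln u < 0" using \<open>y1 \<noteq> y2\<close> by (auto simp: u_def)
  define a where "a = - ln u / E"
  have a: "a > 0" unfolding a_def E_def using u(2) by (intro divide_pos_pos) auto
  have "v - P p \<in> V" using y(3) P_in subspace_diff[OF subspace_V] by blast
  then have "u < exp (- (a * exp (- ((C + 1) * 1))))"
    unfolding u_def by (intro fibre_distance_bound[OF \<rho> c _ v c0 a]) (use y in auto)
  also have "\<dots> = u" using u by (simp add: a_def E_def)
  finally show False by simp
qed

text \<open>Lifting gives existence of \<open>G\<close> and the fibre bound its uniqueness. Lifting
  again at \<open>G (P x)\<close> gives the first-order expansion, since by uniqueness the lifted
  points are values of \<open>G\<close>. The map \<open>G\<close> composed with \<open>P\<close> is
  used because it lives on an open subset of the whole space.\<close>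

lemma local_section:
  assumes p: "p \<in> X" and r: "r > 0"
  obtains \<rho> \<delta> G where "\<rho> > 0" "\<rho> < r" "\<delta> > 0"
    "\<And>v. v \<in> V \<Longrightarrow> norm (v - P p) < \<delta> \<Longrightarrow> G v \<in> X \<inter> ball p \<rho> \<and> P (G v) = v"
    "\<And>y. y \<in> X \<inter> ball p \<rho> \<Longrightarrow> norm (P y - P p) < \<delta> \<Longrightarrow> G (P y) = y"
    "\<And>x. norm (P x - P p) < \<delta> \<Longrightarrow>
      ((\<lambda>x. G (P x)) has_derivative (\<lambda>h. P h + A (G (P x)) *v P h)) (at x)"
proof -
  have pr: "p \<in> X \<inter> cball p r" using p r by simp
  have M: "norm (A x *v h) \<le> (\<Sum>i\<in>UNIV. \<Sum>j\<in>UNIV. \<bar>A x $ i $ j\<bar>) * norm h" for x h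
    by (rule norm_matrix_vector_le)
  define M where "M x = (\<Sum>i\<in>UNIV. \<Sum>j\<in>UNIV. \<bar>A x $ i $ j\<bar>)" for x
  have M0: "M x \<ge> 0" for x by (simp add: M_def sum_nonneg)
  have norm_le: "norm q \<le> (e + 1 + M x) * norm h"
    if "norm (q - (h + A x *v h)) \<le> e * norm h" for q h x e
  proof -
    have "norm q \<le> norm (q - s) + norm s" for s
      using norm_triangle_ineq[of "q - s" s] by simp
    from this[of "h + A x *v h"] show ?thesis
      using that norm_triangle_ineq[of h "A x *v h"] M[of x h] by (simp add: M_def algebra_simps)
  qed
  obtain \<delta>1 where \<delta>1: "\<delta>1 > 0" and est: "\<And>y. y \<in> X \<Longrightarrow> dist y p < \<delta>1 \<Longrightarrow>
    norm (y - p - (P (y - p) + A p *v P (y - p))) \<le> 1 * norm (P (y - p))"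
    using cone_estimate[OF pr zero_less_one] by blast
  define c where "c = 2 + M p"
  have c0: "c > 0" using M0[of p] by (simp add: c_def)
  \<comment> \<open>The bound 1/4 puts any two points of the ball within distance 1/2, where the
    log-Lipschitz estimate applies; the other two serve the cone estimate and the inclusion in
    \<open>cball p r\<close>.\<close>
  define \<rho> where "\<rho> = min (\<delta>1 / 2) (min (r / 2) (1 / 4))"
  have \<rho>: "\<rho> > 0" "\<rho> < r" "\<rho> \<le> 1/4" "\<rho> < \<delta>1" using \<delta>1 r by (auto simp: \<rho>_def min_def)
  have c: "dist y p \<le> c * norm (P y - P p)" if "y \<in> X \<inter> cball p \<rho>" for y
    using norm_le[OF est[of y]] that \<rho>(4) by (simp add: c_def dist_norm P_diff norm_minus_commute)
  obtain \<delta>2 where \<delta>2: "\<delta>2 > 0" and lift_p: "\<And>v. v \<in> V \<Longrightarrow> norm (v - P p) < \<delta>2 \<Longrightarrow>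
    \<exists>y\<in>X. P y = v \<and> norm (y - p - ((v - P p) + A p *v (v - P p))) \<le> 1 * norm (v - P p)"
    using lift[of p 1] p r by (auto simp: dist_commute)
  \<comment> \<open>\<open>\<delta>2\<close> permits lifting from \<open>p\<close>, 1 bounds the
    length of the ray, and \<open>\<rho> / c\<close> keeps the ray's fibres inside the open
    ball.\<close>
  define \<delta> where "\<delta> = min \<delta>2 (min 1 (\<rho> / c))"
  have \<delta>: "\<delta> > 0" "\<delta> \<le> \<delta>2" "\<delta> \<le> 1" "c * \<delta> \<le> \<rho>"
  proof -
    have "\<delta> \<le> \<rho> / c" by (simp add: \<delta>_def)
    then show "c * \<delta> \<le> \<rho>" using c0 by (simp add: pos_le_divide_eq mult.commute)
  qed (use \<delta>2 \<rho> c0 in \<open>auto simp: \<delta>_def\<close>)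
  have small: "c * norm (v - P p) < \<rho>" if "norm (v - P p) < \<delta>" for v
    using mult_strict_left_mono[OF that c0] \<delta>(4) by linarith
  have unique: "y1 = y2" if "norm (v - P p) < \<delta>" "y1 \<in> X \<inter> cball p \<rho>" "y2 \<in> X \<inter> cball p \<rho>" "P y1 = v" "P y2 = v" for v y1 y2
    by (rule fibre_unique[OF \<rho>(2,3) c c0 _ small]) (use that \<delta>(3) in auto)
  have ex: "\<exists>y. y \<in> X \<inter> ball p \<rho> \<and> P y = v" if v: "v \<in> V" "norm (v - P p) < \<delta>" for v
  proof -
    obtain y where y: "y \<in> X" "P y = v" "norm (y - p - ((v - P p) + A p *v (v - P p))) \<le> 1 * norm (v - P p)"
      using lift_p[OF v(1)] v(2) \<delta>(2) by auto
    then have "dist y p < \<rho>" using norm_le[OF y(3)] small[OF v(2)] by (simp add: c_def dist_norm)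
    with y show ?thesis by (auto simp: dist_commute)
  qed
  define G where "G v = (SOME y. y \<in> X \<inter> ball p \<rho> \<and> P y = v)" for v
  have G: "G v \<in> X \<inter> ball p \<rho> \<and> P (G v) = v" if "v \<in> V" "norm (v - P p) < \<delta>" for v
    unfolding G_def by (rule someI_ex[OF ex[OF that]])
  have G_unique: "G (P y) = y" if "y \<in> X \<inter> ball p \<rho>" "norm (P y - P p) < \<delta>" for y
    by (rule unique[OF that(2)]) (use that G[OF P_in that(2)] in auto)
  have deriv: "((\<lambda>x. G (P x)) has_derivative (\<lambda>h. P h + A (G (P x)) *v P h)) (at x)"
    if x: "norm (P x - P p) < \<delta>" for x
    unfolding has_derivative_at_alt
  proof (intro conjI allI impI)
    show "bounded_linear (\<lambda>h. P h + A (G (P x)) *v P h)"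
      by (intro bounded_linear_add bounded_linear_closest_point subspace_V
          bounded_linear_compose[OF matrix_vector_mul_bounded_linear])
    fix e :: real assume e: "e > 0"
    define y where "y = G (P x)"
    have y: "y \<in> X" "dist y p < \<rho>" "P y = P x"
      using G[OF P_in x] by (auto simp: y_def dist_commute)
    obtain \<delta>3 where \<delta>3: "\<delta>3 > 0" and L: "\<And>v. v \<in> V \<Longrightarrow> norm (v - P y) < \<delta>3 \<Longrightarrow>
      (\<exists>y'\<in>X. P y' = v \<and> norm (y' - y - ((v - P y) + A y *v (v - P y))) \<le> e * norm (v - P y))"
      using lift[OF y(1) _ e] y(2) \<rho>(2) by auto
    define m where "m = e + 1 + M y"
    have m: "m > 0" using e M0[of y] by (simp add: m_def)
    \<comment> \<open>The three bounds respectively permit lifting at \<open>y\<close>, keep the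
      lifted point in \<open>ball p \<rho>\<close>, and keep \<open>P x'\<close> in the range where
      uniqueness identifies that point with \<open>G (P x')\<close>.\<close>
    define d where "d = min \<delta>3 (min ((\<rho> - dist y p) / m) (\<delta> - norm (P x - P p)))"
    have d: "d > 0" using \<delta>3 m y(2) x by (simp add: d_def)
    have "norm (G (P x') - y - (P (x' - x) + A y *v P (x' - x))) \<le> e * norm (x' - x)"
      if x': "norm (x' - x) < d" for x'
    proof -
      have le: "norm (P (x' - x)) \<le> norm (x' - x)" by (rule norm_closest_point_le(1)[OF subspace_V])
      have "norm (P x' - P y) < \<delta>3" using le x' by (simp add: d_def y(3) P_diff)
      then obtain y' where y': "y' \<in> X" "P y' = P x'"
        "norm (y' - y - (P (x' - x) + A y *v P (x' - x))) \<le> e * norm (P (x' - x))"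
        using L[OF P_in] by (auto simp: y(3) P_diff)
      have "norm (y' - y) \<le> m * norm (P (x' - x))" unfolding m_def by (rule norm_le[OF y'(3)])
      also have "\<dots> \<le> m * norm (x' - x)" using le m by simp
      also have "\<dots> < m * d" using x' m by simp
      also have "\<dots> \<le> \<rho> - dist y p"
      proof -
        have "m * d \<le> m * ((\<rho> - dist y p) / m)" using m by (intro mult_left_mono) (auto simp: d_def)
        then show ?thesis using m by simp
      qed
      finally have "dist y' p < \<rho>" using dist_triangle[of y' p y] by (simp add: dist_norm)
      then have yb: "y' \<in> X \<inter> ball p \<rho>" using y'(1) by (simp add: dist_commute)
      have "norm (P x' - P p) \<le> norm (P (x' - x)) + norm (P x - P p)"
        using norm_triangle_ineq[of "P x' - P x" "P x - P p"] by (simp add: P_diff)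
      also have "\<dots> < \<delta>" using le x' by (simp add: d_def)
      finally have "G (P x') = y'" using G_unique[OF yb] y'(2) by simp
      then show ?thesis using y'(3) mult_left_mono[OF le less_imp_le[OF e]] by simp
    qed
    then show "\<exists>d>0. \<forall>x'. norm (x' - x) < d \<longrightarrow>
        norm (G (P x') - G (P x) - (P (x' - x) + A (G (P x)) *v P (x' - x))) \<le> e * norm (x' - x)"
      using d unfolding y_def by blast
  qed
  show ?thesis by (rule that[OF \<rho>(1,2) \<delta>(1) G G_unique deriv])
qed

end

section \<open>Bootstrapping the regularity of the section\<close>

lemma bounded_linear_matrix_vector_mult_left: "bounded_linear (\<lambda>M :: real ^ 'n ^ 'm. M *v c)"
  by (intro linear_conv_bounded_linear[THEN iffD1] linearI)
    (simp_all add: matrix_vector_mult_add_rdistrib scaleR_matrix_vector_assoc)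

text \<open>Continuity of \<open>A(G)\<close> already makes \<open>G\<close> of class
  \<open>C^1\<close>, as the composition rule requires of an inner map. From then on each order
  known for \<open>G\<close>, up to \<open>k\<close>, passes to \<open>A(G)\<close>, which is the
  slope of \<open>G\<close>, and so raises the order by one.\<close>

lemma CkLL_on_section:
  fixes A :: "real ^ 'n \<Rightarrow> real ^ 'n ^ 'n" and G :: "real ^ 'n \<Rightarrow> real ^ 'n"
  assumes "open \<Omega>" "open N" "G ` \<Omega> \<subseteq> N" "CkLL_on k N A"
    and deriv: "\<And>x. x \<in> \<Omega> \<Longrightarrow> (G has_derivative (\<lambda>h. L h + A (G x) *v L h)) (at x)"
  shows "CkLL_on (Suc k) \<Omega> G"
proof -
  have contG: "continuous_on \<Omega> G"
    using deriv has_derivative_continuous by (blast intro: continuous_at_imp_continuous_on)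
  have contA: "continuous_on \<Omega> (\<lambda>x. A (G x))"
    by (rule continuous_on_compose2[OF CkLL_on_continuous[OF assms(4)] contG assms(3)])
  have C1: "Ck_on 1 \<Omega> G"
    unfolding One_nat_def
  proof (rule Ck_on_SucI[OF assms(1) deriv])
    show "Ck_on 0 \<Omega> (\<lambda>x. L b + A (G x) *v L b)" for b
      unfolding Ck_on_0
      by (intro continuous_intros bounded_linear.continuous_on[OF bounded_linear_matrix_vector_mult_left] contA)
  qed
  have step: "CkLL_on (Suc j) \<Omega> G" if "CkLL_on j \<Omega> G" "j \<le> k" for j
  proof (rule CkLL_on_SucI[OF assms(1) deriv])
    have "CkLL_on j \<Omega> (\<lambda>x. A (G x))"
      by (rule CkLL_on_compose[OF assms(1,2,3) C1 CkLL_on_mono[OF assms(2,4) that(2)] that(1)])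
    then show "CkLL_on j \<Omega> (\<lambda>x. L b + A (G x) *v L b)" for b
      by (intro CkLL_on_add assms(1) CkLL_on_const bounded_linear.CkLL_on[OF bounded_linear_matrix_vector_mult_left])
  qed
  have "CkLL_on j \<Omega> G" if "j \<le> Suc k" for j
    using that
  proof (induction j)
    case 0
    show ?case using contG Ck_on_1_locally_log_lipschitz[OF assms(1) C1] by (simp add: CkLL_on_0)
  next
    case (Suc j)
    then show ?case by (intro step) auto
  qed
  then show ?thesis by simp
qed

lemma norm_matrix_vector_le_norm: "norm (M *v x) \<le> real (CARD('m) * CARD('n)) * norm M * norm x"
  for M :: "real ^ 'n ^ 'm"
proof -
  have "\<bar>M $ i $ j\<bar> \<le> norm M" for i j
    using component_le_norm_cart[of "M $ i" j] Finite_Cartesian_Product.norm_nth_le[of M i] by linarith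
  then have "(\<Sum>i\<in>UNIV. \<Sum>j\<in>UNIV. \<bar>M $ i $ j\<bar>) \<le> (\<Sum>i\<in>(UNIV::'m set). \<Sum>j\<in>(UNIV::'n set). norm M)"
    by (intro sum_mono) auto
  then have "(\<Sum>i\<in>UNIV. \<Sum>j\<in>UNIV. \<bar>M $ i $ j\<bar>) * norm x \<le> real (CARD('m) * CARD('n)) * norm M * norm x"
    by (intro mult_right_mono) simp_all
  then show ?thesis using norm_matrix_vector_le[of M x] by linarith
qed

section \<open>From a smooth inverse of the Nash mapping to a submanifold\<close>

proposition nash_imp_CkLL_submanifold:
  fixes X :: "(real ^ 'n) set"
  assumes "locally closed X" "coincide_linearly d X"
    and homeo: "homeomorphic_map (nash_topology d X) (top_of_set X) fst"
    and smooth: "smooth_on_subset (CkLL_into_RGr k d) X (nash_inverse d X)"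
  shows "CkLL_submanifold (k + 1) d X"
  unfolding CkLL_submanifold_def
proof
  fix p assume p: "p \<in> X"
  let ?N = "nash_transformation d X"
  have top: "topspace (nash_topology d X) = ?N"
    unfolding nash_topology_def nash_transformation_def
    by (rule topspace_subtopology_subset[OF closure_of_subset_topspace])
  have inj: "inj_on fst ?N" and img: "fst ` ?N = X"
    using homeomorphic_imp_injective_map[OF homeo] homeomorphic_imp_surjective_map[OF homeo] by (simp_all add: top)
  define T where "T x = snd (nash_inverse d X x)" for x
  have inv: "nash_inverse d X x = (x, T x)" "(x, T x) \<in> ?N" if "x \<in> X" for x
  proof -
    have "fst (nash_inverse d X x) = x" "nash_inverse d X x \<in> ?N"
      unfolding nash_inverse_def using that img f_inv_into_f inv_into_into by metis+
    then show "nash_inverse d X x = (x, T x)" "(x, T x) \<in> ?N" unfolding T_def by (metis prod.collapse)+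
  qed
  \<comment> \<open>Injectivity of the Nash mapping makes \<open>T x\<close> the only limit at
    \<open>x\<close>. Hence \<open>C4 d X x\<close> is a \<open>d\<close>-dimensional subspace, and
    linear coincidence applies.\<close>
  have C3: "C3 X x = T x" if x: "x \<in> X" for x
  proof -
    have "T' = T x" if "(x, T') \<in> ?N" for T'
      using inj_onD[OF inj _ that inv(2)[OF x]] by simp
    then have C4: "C4 d X x = T x" using C4_eq_of_unique_limit[OF x inv(2)[OF x]] by blast
    moreover have "T x \<in> Gr d" using nash_transformationD(2)[OF inv(2)[OF x]] .
    ultimately show ?thesis using assms(2) x unfolding coincide_linearly_def by (auto simp: Gr_def)
  qed
  obtain U F where U: "open U" "p \<in> U" and F: "CkLL_into_RGr k d U F" and
    Feq: "\<And>x. x \<in> X \<inter> U \<Longrightarrow> F x = nash_inverse d X x"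
    using smooth p unfolding smooth_on_subset_def by metis
  obtain N V where N: "open N" "p \<in> N" "N \<subseteq> U" and V: "V \<in> Gr d"
    and dom: "\<And>x. x \<in> N \<Longrightarrow> snd (F x) \<in> Gr_chart_domain V"
    and CN: "CkLL_on k N (\<lambda>x. (fst (F x), Gr_chart V (snd (F x))))"
    using bspec[OF conjunct2[OF F[unfolded CkLL_into_RGr_def]] U(2)]
    by (elim exE conjE) (rule that; blast)
  have sV: "subspace V" and dimV: "dim V = d" using V by (auto simp: Gr_def)
  define A where "A x = Gr_chart V (snd (F x))" for x
  have CA: "CkLL_on k N A"
    using bounded_linear.CkLL_on[OF bounded_linear_snd N(1) CN] by (simp add: A_def[abs_def])
  obtain C M where M: "C > 0" "open M" "p \<in> M" and
    LL: "\<And>x y. x \<in> N \<inter> M \<Longrightarrow> y \<in> N \<inter> M \<Longrightarrow> x \<noteq> y \<Longrightarrow> dist x y \<le> 1/2 \<Longrightarrow>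
       dist (A x) (A y) \<le> C * (dist x y * \<bar>ln (dist x y)\<bar>)"
    using locally_log_lipschitz_onE[OF CkLL_on_locally_log_lipschitz[OF N(1) CA] N(2)] by metis
  obtain r1 where r1: "r1 > 0" "cball p r1 \<subseteq> N \<inter> M"
    using open_contains_cball_eq[of "N \<inter> M"] N M by auto
  obtain r2 where r2: "r2 > 0" "closed (cball p r2 \<inter> X)"
    using assms(1) p unfolding locally_closed locally_compact_Int_cball by blast
  define r where "r = min r1 r2"
  have r: "r > 0" "cball p r \<subseteq> cball p r1" "cball p r \<subseteq> cball p r2" using r1 r2 by (auto simp: r_def)
  then have rN: "cball p r \<subseteq> N \<inter> M" using r1 by auto
  \<comment> \<open>The dimension factor passes from the norm of a matrix to its action on
    vectors.\<close>
  define C' where "C' = real (CARD('n) * CARD('n)) * C"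
  have C': "C' > 0" using M(1) by (simp add: C'_def)
  have TA: "T x = graph_over V (A x)" if "x \<in> X \<inter> N" for x
  proof -
    have "snd (F x) = T x" using Feq[of x] inv(1)[of x] that N(3) by auto
    then show ?thesis using Gr_chart_works(3)[OF sV dom[of x]] that by (simp add: A_def)
  qed
  interpret log_lipschitz_cone_field V X A p r C'
  proof
    have "X \<inter> cball p r = cball p r \<inter> (cball p r2 \<inter> X)" using r by auto
    then show "compact (X \<inter> cball p r)" using r2(2) by (simp add: compact_Int_closed)
    fix x assume x: "x \<in> X \<inter> cball p r"
    then have xN: "x \<in> N" using rN by auto
    show "A x *v v \<in> V\<^sup>\<bottom>" if "v \<in> V" for v
      unfolding A_def by (rule Gr_chart_works(1)[OF sV dom[OF xN] that])
    show "C3 X x = graph_over V (A x)" using C3[of x] TA[of x] x xN by auto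
    fix y v assume y: "y \<in> X \<inter> cball p r" "x \<noteq> y" "dist x y \<le> 1/2"
    have "norm (A x *v v - A y *v v) = norm ((A x - A y) *v v)"
      by (simp add: matrix_vector_mult_diff_rdistrib)
    also have "\<dots> \<le> real (CARD('n) * CARD('n)) * dist (A x) (A y) * norm v"
      unfolding dist_norm by (rule norm_matrix_vector_le_norm)
    also have "\<dots> \<le> real (CARD('n) * CARD('n)) * (C * (dist x y * \<bar>ln (dist x y)\<bar>)) * norm v"
      using subsetD[OF rN, of x] subsetD[OF rN, of y] x y by (intro mult_right_mono mult_left_mono LL) auto
    finally show "norm (A x *v v - A y *v v) \<le> C' * (dist x y * \<bar>ln (dist x y)\<bar>) * norm v"
      by (simp add: C'_def algebra_simps)
  qed (rule sV C')+
  obtain \<rho> \<delta> G where \<rho>: "\<rho> > 0" "\<rho> < r" and \<delta>: "\<delta> > 0" and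
    G: "\<And>v. v \<in> V \<Longrightarrow> norm (v - P p) < \<delta> \<Longrightarrow> G v \<in> X \<inter> ball p \<rho> \<and> P (G v) = v" and
    GP: "\<And>y. y \<in> X \<inter> ball p \<rho> \<Longrightarrow> norm (P y - P p) < \<delta> \<Longrightarrow> G (P y) = y" and
    dG: "\<And>x. norm (P x - P p) < \<delta> \<Longrightarrow>
      ((\<lambda>x. G (P x)) has_derivative (\<lambda>h. P h + A (G (P x)) *v P h)) (at x)"
    by (rule local_section[OF p r(1)]) (rule that)
  define \<Omega> where "\<Omega> = {x. norm (P x - P p) < \<delta>}"
  have "open \<Omega>"
    unfolding \<Omega>_def by (intro open_Collect_less continuous_intros continuous_P)
  have CG: "CkLL_on (Suc k) \<Omega> (\<lambda>x. G (P x))"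
  proof (rule CkLL_on_section[OF \<open>open \<Omega>\<close> N(1) _ CA])
    show "(\<lambda>x. G (P x)) ` \<Omega> \<subseteq> N"
      using G[OF P_in] rN \<rho> by (fastforce simp: \<Omega>_def)
  qed (use dG in \<open>auto simp: \<Omega>_def\<close>)
  define D where "D = {v \<in> V. norm (v - P p) < \<delta>}"
  define f where "f v = G v - v" for v
  \<comment> \<open>This extends \<open>f\<close> from \<open>D\<close> to an open set by making it
    constant along \<open>V\<^sup>\<bottom>\<close>, as the definition of smoothness on a subset
    demands.\<close>
  have "CkLL_on (Suc k) \<Omega> (\<lambda>x. G (P x) + - P x)"
    by (intro CkLL_on_add \<open>open \<Omega>\<close> CG CkLL_on_linear(1) bounded_linear_minus bounded_linear_closest_point sV)
  then have "smooth_on_subset (CkLL_on (k + 1)) D f"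
    unfolding smooth_on_subset_def
    by (intro ballI exI[of _ \<Omega>] exI[of _ "\<lambda>x. G (P x) + - P x"])
      (use \<open>open \<Omega>\<close> in \<open>auto simp: D_def \<Omega>_def f_def closest_point_subspace_self[OF sV]\<close>)
  moreover have "{v + w |v w. v \<in> V \<and> w \<in> V\<^sup>\<bottom>} = UNIV"
  proof -
    have "\<exists>v w. x = v + w \<and> v \<in> V \<and> w \<in> V\<^sup>\<bottom>" for x
      using closest_point_subspace[OF sV, of x] by (intro exI[of _ "P x"] exI[of _ "x - P x"]) simp
    then show ?thesis by auto
  qed
  moreover have "openin (top_of_set V) D"
  proof -
    have "D = V \<inter> ball (P p) \<delta>" by (auto simp: D_def dist_norm norm_minus_commute)
    then show ?thesis by (simp add: openin_open_Int)
  qed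
  moreover have "f ` D \<subseteq> V\<^sup>\<bottom>"
  proof
    fix w assume "w \<in> f ` D"
    then obtain v where "v \<in> V" "norm (v - P p) < \<delta>" "w = G v - P (G v)"
      using G by (auto simp: D_def f_def)
    then show "w \<in> V\<^sup>\<bottom>" using closest_point_subspace(2)[OF sV] by simp
  qed
  moreover have "X \<inter> (ball p \<rho> \<inter> \<Omega>) = (\<lambda>v. v + f v) ` D"
  proof (intro equalityI subsetI)
    fix y assume y: "y \<in> X \<inter> (ball p \<rho> \<inter> \<Omega>)"
    then have "y = P y + f (P y)" "P y \<in> D" using GP[of y] P_in by (auto simp: f_def D_def \<Omega>_def)
    then show "y \<in> (\<lambda>v. v + f v) ` D" by blast
  next
    fix y assume "y \<in> (\<lambda>v. v + f v) ` D"
    then obtain v where "v \<in> V" "norm (v - P p) < \<delta>" "y = G v" by (auto simp: D_def f_def)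
    then show "y \<in> X \<inter> (ball p \<rho> \<inter> \<Omega>)" using G[of v] by (auto simp: \<Omega>_def)
  qed
  moreover have "p \<in> ball p \<rho> \<inter> \<Omega>" using \<rho>(1) \<delta> by (simp add: \<Omega>_def)
  moreover have "open (ball p \<rho> \<inter> \<Omega>)" using \<open>open \<Omega>\<close> by blast
  moreover have "V \<inter> V\<^sup>\<bottom> = {0}" using sV by (rule orthogonal_Int_0)
  ultimately show "smooth_graph_at (CkLL_on (k + 1)) d X p"
    unfolding smooth_graph_at_def using sV dimV subspace_orthogonal_comp[of V]
    by (intro exI[of _ V] exI[of _ "V\<^sup>\<bottom>"] exI[of _ "ball p \<rho> \<inter> \<Omega>"] exI[of _ D] exI[of _ f] conjI)
qed

section \<open>The Gauss mapping of a graph\<close>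

text \<open>The splitting in \<open>smooth_graph_at\<close> may be oblique, so it needs its own
  projection. Trivial intersection makes components unique, and uniqueness yields linearity.\<close>

lemma projection_along:
  fixes V W :: "'a::real_vector set"
  assumes "subspace V" "subspace W" "V \<inter> W = {0}" "{v + w |v w. v \<in> V \<and> w \<in> W} = UNIV"
  obtains \<pi> where "linear \<pi>" "\<And>x. \<pi> x \<in> V" "\<And>v w. v \<in> V \<Longrightarrow> w \<in> W \<Longrightarrow> \<pi> (v + w) = v"
proof -
  have "\<exists>v. v \<in> V \<and> x - v \<in> W" for x
  proof -
    have "x \<in> {v + w |v w. v \<in> V \<and> w \<in> W}" using assms(4) by simp
    then obtain v w where "x = v + w" "v \<in> V" "w \<in> W" by blast
    then show ?thesis by (intro exI[of _ v]) simp
  qed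
  then obtain \<pi> where \<pi>: "\<And>x. \<pi> x \<in> V" "\<And>x. x - \<pi> x \<in> W" by metis
  have unique: "\<pi> (v + w) = v" if "v \<in> V" "w \<in> W" for v w
  proof -
    have "\<pi> (v + w) - v \<in> V" using assms(1) \<pi>(1) that(1) by (rule subspace_diff)
    moreover have "w - ((v + w) - \<pi> (v + w)) \<in> W" using assms(2) that(2) \<pi>(2) by (rule subspace_diff)
    then have "\<pi> (v + w) - v \<in> W" by simp
    ultimately have "\<pi> (v + w) - v \<in> V \<inter> W" by blast
    then show ?thesis using assms(3) by simp
  qed
  have "linear \<pi>"
  proof (rule linearI)
    fix x y c
    have "\<pi> ((\<pi> x + \<pi> y) + ((x - \<pi> x) + (y - \<pi> y))) = \<pi> x + \<pi> y"
      by (intro unique subspace_add assms \<pi>)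
    then show "\<pi> (x + y) = \<pi> x + \<pi> y" by (simp add: algebra_simps)
    have "\<pi> (c *\<^sub>R \<pi> x + c *\<^sub>R (x - \<pi> x)) = c *\<^sub>R \<pi> x"
      by (intro unique subspace_scale assms \<pi>)
    then show "\<pi> (c *\<^sub>R x) = c *\<^sub>R \<pi> x" by (simp add: algebra_simps)
  qed
  then show ?thesis using that \<pi>(1) unique by blast
qed

text \<open>The complement \<open>W\<close> is encoded by the projection \<open>\<pi>\<close>:
  values in \<open>W\<close> become \<open>\<pi> (F v) = 0\<close>. \<open>F\<close> is a local
  extension to an open set of the full space, so it has a total derivative there.\<close>

locale C1_graph =
  fixes V D X N U :: "(real ^ 'n) set" and \<pi> F :: "real ^ 'n \<Rightarrow> real ^ 'n"
  assumes subspace_V: "subspace V"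
    and linear_\<pi>: "linear \<pi>" and \<pi>_in: "\<And>x. \<pi> x \<in> V" and \<pi>_id: "\<And>v. v \<in> V \<Longrightarrow> \<pi> v = v"
    and open_U: "open U" and C1_F: "Ck_on 1 U F"
    and open_D: "openin (top_of_set V) D" and D_sub: "D \<subseteq> U"
    and \<pi>_F: "\<And>v. v \<in> D \<Longrightarrow> \<pi> (F v) = 0"
    and open_N: "open N" and graph: "X \<inter> N = (\<lambda>v. v + F v) ` D"
    and \<pi>_N: "\<pi> ` N \<subseteq> U"
begin

definition dF :: "real ^ 'n \<Rightarrow> real ^ 'n \<Rightarrow> real ^ 'n" where
  "dF v h = (\<Sum>b\<in>Basis. (h \<bullet> b) *\<^sub>R partial_derivative b F v)"

text \<open>The derivative of \<open>v + F v\<close> at \<open>\<pi> x\<close>, precomposed with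
  \<open>\<pi>\<close>. It makes sense for all \<open>x\<close> in \<open>N\<close>, not just on
  \<open>X\<close>, so its smooth dependence on \<open>x\<close> can be stated on an open
  set.\<close>

definition param :: "real ^ 'n \<Rightarrow> real ^ 'n \<Rightarrow> real ^ 'n" where
  "param x h = \<pi> h + dF (\<pi> x) (\<pi> h)"

lemma bounded_linear_\<pi>: "bounded_linear \<pi>"
  using linear_\<pi> by (simp add: linear_conv_bounded_linear)

lemma D_V: "D \<subseteq> V"
  using open_D openin_imp_subset by fastforce

lemma dF: "v \<in> U \<Longrightarrow> (F has_derivative dF v) (at v)"
  unfolding dF_def[abs_def] by (rule Ck_on_1_has_derivative[OF open_U C1_F])

lemma linear_dF: "linear (dF v)"
  unfolding dF_def[abs_def]
  by (intro linear_compose_sum ballI linear_conv_bounded_linear[THEN iffD2]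
      bounded_linear_scaleR_left[THEN bounded_linear_compose] bounded_linear_inner_left)

lemma linear_param: "linear (param x)"
  unfolding param_def[abs_def]
  by (intro linear_compose_add linear_\<pi> linear_compose[OF linear_\<pi> linear_dF, unfolded o_def])

lemma graph_point:
  assumes "x \<in> X \<inter> N"
  shows "\<pi> x \<in> D" "x = \<pi> x + F (\<pi> x)"
proof -
  obtain v where v: "v \<in> D" "x = v + F v" using assms graph by auto
  then have "\<pi> x = v" using linear_add[OF linear_\<pi>, of v "F v"] \<pi>_id \<pi>_F D_V by auto
  with v show "\<pi> x \<in> D" "x = \<pi> x + F (\<pi> x)" by auto
qed

lemma line_in_D:
  assumes "v \<in> D" "h \<in> V"
  shows "\<exists>e>0. \<forall>t. \<bar>t\<bar> < e \<longrightarrow> v + t *\<^sub>R h \<in> D"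
proof -
  obtain O' where O': "open O'" "D = V \<inter> O'" using open_D openin_open by metis
  have "((\<lambda>t. v + t *\<^sub>R h) \<longlongrightarrow> v + 0 *\<^sub>R h) (at 0)" by (intro tendsto_intros)
  then have "\<forall>\<^sub>F t in at 0. v + t *\<^sub>R h \<in> O'"
    using O' assms(1) by (auto dest: topological_tendstoD)
  then obtain e where e: "e > 0" "\<And>t. t \<noteq> 0 \<Longrightarrow> \<bar>t\<bar> < e \<Longrightarrow> v + t *\<^sub>R h \<in> O'"
    by (auto simp: eventually_at)
  have "v + t *\<^sub>R h \<in> D" if "\<bar>t\<bar> < e" for t
  proof (cases "t = 0")
    case True
    then show ?thesis using assms(1) by simp
  next
    case False
    have "v + t *\<^sub>R h \<in> V" using assms D_V subspace_V by (blast intro: subspace_add subspace_scale)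
    then show ?thesis using e(2)[OF False that] O'(2) by blast
  qed
  then show ?thesis using e(1) by blast
qed

lemma F_along_line:
  assumes "v + t *\<^sub>R h \<in> U"
  shows "((\<lambda>s. F (v + s *\<^sub>R h)) has_vector_derivative dF (v + t *\<^sub>R h) h) (at t)"
proof -
  have "((\<lambda>s. v + s *\<^sub>R h) has_derivative (\<lambda>s. s *\<^sub>R h)) (at t)"
    by (auto intro!: derivative_eq_intros)
  from has_derivative_compose[OF this dF[OF assms]]
  show ?thesis
    by (simp add: has_vector_derivative_def linear_scale[OF linear_dF])
qed

text \<open>The extension \<open>F\<close> takes values in the kernel of \<open>\<pi>\<close> only
  along \<open>D\<close>; directions in \<open>V\<close> keep short line segments inside
  \<open>D\<close>, so the constraint can be differentiated along them.\<close>

lemma \<pi>_dF: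
  assumes "v \<in> D" "h \<in> V"
  shows "\<pi> (dF v h) = 0"
proof -
  obtain e where e: "e > 0" "\<And>t. \<bar>t\<bar> < e \<Longrightarrow> v + t *\<^sub>R h \<in> D"
    using line_in_D[OF assms] by blast
  have "((\<lambda>s. F (v + s *\<^sub>R h)) has_vector_derivative dF v h) (at 0)"
    using F_along_line[of v 0 h] assms(1) D_sub by auto
  then have 1: "((\<lambda>s. \<pi> (F (v + s *\<^sub>R h))) has_vector_derivative \<pi> (dF v h)) (at 0)"
    by (rule bounded_linear.has_vector_derivative[OF bounded_linear_\<pi>])
  have "((\<lambda>s. \<pi> (F (v + s *\<^sub>R h))) has_vector_derivative 0) (at 0)"
  proof (rule has_vector_derivative_transform_within_open[where f = "\<lambda>s. 0" and S = "{-e<..<e}"])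
    show "0 = \<pi> (F (v + s *\<^sub>R h))" if "s \<in> {-e<..<e}" for s
      using \<pi>_F[OF e(2)[of s]] that by auto
  qed (use e(1) in auto)
  with 1 show ?thesis by (rule vector_derivative_unique_at)
qed

lemma \<pi>_param: "x \<in> X \<inter> N \<Longrightarrow> \<pi> (param x h) = \<pi> h"
  using \<pi>_dF[OF graph_point(1) \<pi>_in] linear_add[OF linear_\<pi>]
  by (simp add: param_def \<pi>_id[OF \<pi>_in])

lemma param_\<pi>: "param x (\<pi> h) = param x h"
  by (simp add: param_def \<pi>_id[OF \<pi>_in])

text \<open>A curve in \<open>X\<close> satisfies the graph equation near its base point, and
  differentiating this equation puts its velocity in the image of \<open>param x\<close>.
  Conversely, straight segments in \<open>D\<close> lift to \<open>C^1\<close> curves in the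
  graph.\<close>

lemma tangent_space_eq:
  assumes x: "x \<in> X \<inter> N"
  shows "tangent_space X x = param x ` V"
proof (intro equalityI subsetI)
  note gx = graph_point[OF x]
  have vU: "\<pi> x \<in> U" using gx(1) D_sub by blast
  fix u assume "u \<in> tangent_space X x"
  then obtain \<gamma> \<epsilon> where e: "\<epsilon> > 0" and \<gamma>: "\<gamma> ` {-\<epsilon><..<\<epsilon>} \<subseteq> X" "\<gamma> 0 = x" and
    d: "(\<gamma> has_vector_derivative u) (at 0)"
    unfolding tangent_space_def by auto
  have "(\<gamma> \<longlongrightarrow> x) (at 0)"
    using has_vector_derivative_continuous[OF d] \<gamma>(2) by (simp add: isCont_def)
  then have "\<forall>\<^sub>F t in at 0. \<gamma> t \<in> N"
    using open_N x by (auto dest: topological_tendstoD)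
  then obtain e' where e': "e' > 0" "\<And>t. t \<noteq> 0 \<Longrightarrow> \<bar>t\<bar> < e' \<Longrightarrow> \<gamma> t \<in> N"
    by (auto simp: eventually_at)
  define m where "m = min \<epsilon> e'"
  have m: "m > 0" using e e' by (simp add: m_def)
  have in_XN: "\<gamma> t \<in> X \<inter> N" if "t \<in> {-m<..<m}" for t
  proof (cases "t = 0")
    case True
    then show ?thesis using x \<gamma>(2) by simp
  next
    case False
    then show ?thesis using e'(2)[OF False] \<gamma>(1) that by (auto simp: m_def)
  qed
  have d\<pi>: "((\<lambda>t. \<pi> (\<gamma> t)) has_derivative (\<lambda>t. t *\<^sub>R \<pi> u)) (at 0)"
    using bounded_linear.has_vector_derivative[OF bounded_linear_\<pi> d] by (simp add: has_vector_derivative_def)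
  have "(F has_derivative dF (\<pi> x)) (at (\<pi> (\<gamma> 0)))" using dF[OF vU] \<gamma>(2) by simp
  from has_derivative_compose[OF d\<pi> this]
  have "((\<lambda>t. F (\<pi> (\<gamma> t))) has_vector_derivative dF (\<pi> x) (\<pi> u)) (at 0)"
    by (simp add: has_vector_derivative_def linear_scale[OF linear_dF])
  then have "((\<lambda>t. \<pi> (\<gamma> t) + F (\<pi> (\<gamma> t))) has_vector_derivative param x u) (at 0)"
    unfolding param_def using d\<pi> by (intro has_vector_derivative_add) (simp_all add: has_vector_derivative_def)
  then have "(\<gamma> has_vector_derivative param x u) (at 0)"
    by (rule has_vector_derivative_transform_within_open[where S = "{-m<..<m}"])
      (use m graph_point(2)[OF in_XN] in auto)
  with d have "u = param x u" by (rule vector_derivative_unique_at)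
  then have "u = param x (\<pi> u)" by (simp add: param_\<pi>)
  then show "u \<in> param x ` V" using \<pi>_in by blast
next
  note gx = graph_point[OF x]
  fix u assume "u \<in> param x ` V"
  then obtain h where h: "h \<in> V" "u = h + dF (\<pi> x) h" by (auto simp: param_def \<pi>_id)
  obtain e where e: "e > 0" "\<And>t. \<bar>t\<bar> < e \<Longrightarrow> \<pi> x + t *\<^sub>R h \<in> D"
    using line_in_D[OF gx(1) h(1)] by blast
  define \<gamma> where "\<gamma> t = \<pi> x + t *\<^sub>R h + F (\<pi> x + t *\<^sub>R h)" for t
  have tU: "\<pi> x + t *\<^sub>R h \<in> U" if "t \<in> {-e<..<e}" for t using e(2)[of t] D_sub that by auto
  have d\<gamma>: "(\<gamma> has_vector_derivative h + dF (\<pi> x + t *\<^sub>R h) h) (at t)" if "t \<in> {-e<..<e}" for t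
    unfolding \<gamma>_def
    by (intro has_vector_derivative_add F_along_line[OF tU[OF that]]) (auto intro!: derivative_eq_intros)
  have cont: "continuous_on {-e<..<e} (\<lambda>t. h + dF (\<pi> x + t *\<^sub>R h) h)"
  proof -
    have "continuous_on {-e<..<e} (\<lambda>t. partial_derivative b F (\<pi> x + t *\<^sub>R h))" if "b \<in> Basis" for b
    proof (rule continuous_on_compose2[of U "partial_derivative b F" _ "\<lambda>t. \<pi> x + t *\<^sub>R h"])
      show "continuous_on U (partial_derivative b F)" using C1_F that unfolding Ck_on_1 by blast
      show "continuous_on {-e<..<e} (\<lambda>t. \<pi> x + t *\<^sub>R h)" by (intro continuous_intros)
    qed (use tU in blast)
    then show ?thesis unfolding dF_def by (intro continuous_intros)
  qed
  have "\<gamma> C1_differentiable_on {-e<..<e}"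
    unfolding C1_differentiable_on_def
    by (intro exI[of _ "\<lambda>t. h + dF (\<pi> x + t *\<^sub>R h) h"] conjI ballI d\<gamma> cont)
  moreover have "\<gamma> ` {-e<..<e} \<subseteq> X"
  proof (rule image_subsetI)
    fix t assume "t \<in> {-e<..<e}"
    then have "\<gamma> t \<in> (\<lambda>v. v + F v) ` D" unfolding \<gamma>_def by (intro imageI e(2)) auto
    then show "\<gamma> t \<in> X" using graph by blast
  qed
  moreover have "\<gamma> 0 = x" using gx(2) by (simp add: \<gamma>_def)
  moreover have "(\<gamma> has_vector_derivative u) (at 0)" using d\<gamma>[of 0] e(1) h(2) by simp
  ultimately show "u \<in> tangent_space X x"
    unfolding tangent_space_def using e(1) by blast
qed

lemma tangent_space_Gr:
  assumes "x \<in> X \<inter> N"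
  shows "subspace (tangent_space X x)" "dim (tangent_space X x) = dim V"
proof -
  show "subspace (tangent_space X x)"
    unfolding tangent_space_eq[OF assms] using linear_param subspace_V by (rule linear_subspace_image)
  have "inj_on (param x) V"
    by (rule inj_on_inverseI[where g = \<pi>]) (simp add: \<pi>_param[OF assms] \<pi>_id)
  then show "dim (tangent_space X x) = dim V"
    unfolding tangent_space_eq[OF assms]
    by (intro dim_image_eq linear_param) (simp add: span_eq_iff[THEN iffD2, OF subspace_V])
qed

text \<open>With \<open>P\<close>, \<open>Q\<close> the orthogonal projections onto \<open>T = T\<^sub>pX\<close> and its complement and \<open>S x\<close> the
  parametrisation of \<open>T\<^sub>xX\<close>, the space \<open>T\<^sub>xX\<close> is the graph of \<open>Q S (P S)\<^sup>-\<^sup>1\<close> over \<open>T\<close>; the matrix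
  \<open>P S P + Q\<close> is the identity at \<open>p\<close> and inverts \<open>P S\<close> on \<open>T\<close>.\<close>

lemma tangent_space_chart:
  assumes p: "p \<in> X \<inter> N" and CF: "CkLL_on (Suc k) U F"
  obtains M A where "open M" "p \<in> M" "CkLL_on k M A"
    "\<And>x v. x \<in> M \<Longrightarrow> v \<in> tangent_space X p \<Longrightarrow> A x *v v \<in> (tangent_space X p)\<^sup>\<bottom>"
    "\<And>x w. x \<in> M \<Longrightarrow> w \<in> (tangent_space X p)\<^sup>\<bottom> \<Longrightarrow> A x *v w = 0"
    "\<And>x. x \<in> X \<inter> M \<Longrightarrow> tangent_space X x = graph_over (tangent_space X p) (A x)"
proof -
  define T where "T = tangent_space X p"
  have sT: "subspace T" and dT: "dim T = dim V" using tangent_space_Gr[OF p] by (auto simp: T_def)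
  define P where "P = orth_proj T"
  define Q where "Q = mat 1 - P"
  have P: "P *v u = closest_point T u" for u unfolding P_def by (rule orth_proj_works[OF sT])
  have Q: "Q *v u = u - closest_point T u" for u
    by (simp add: Q_def matrix_vector_mult_diff_rdistrib P)
  define S where "S x = matrix (param x)" for x
  have S: "S x *v u = param x u" for x u
    unfolding S_def by (rule matrix_works) (simp add: linear_matrix_vector_mul_eq linear_param)
  have Cparam: "CkLL_on k N (\<lambda>x. param x c)" for c
  proof -
    have "CkLL_on k N (\<lambda>x. partial_derivative b F (\<pi> x))" if "b \<in> Basis" for b
      by (rule CkLL_on_compose[OF open_N open_U \<pi>_N CkLL_on_linear(2)[OF open_N bounded_linear_\<pi>]
            CkLL_on_SucD(2)[OF CF that] CkLL_on_linear(1)[OF open_N bounded_linear_\<pi>]])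
    then show ?thesis
      unfolding param_def dF_def
      by (intro CkLL_on_add[OF open_N] CkLL_on_const[OF open_N] CkLL_on_sum[OF open_N]
          bounded_linear.CkLL_on[OF bounded_linear_scaleR_right open_N])
  qed
  have CS: "CkLL_on k N S"
    by (rule CkLL_on_vec[OF open_N], rule CkLL_on_vec[OF open_N])
      (simp add: S_def matrix_def, intro CkLL_on_vec_nth open_N Cparam)
  define E where "E x = P ** S x ** P + Q" for x
  have CE: "CkLL_on k N E"
    unfolding E_def by (intro CkLL_on_add CkLL_on_matrix_mult CS CkLL_on_const open_N)
  have E: "E x *v u = closest_point T (param x (closest_point T u)) + (u - closest_point T u)" for x u
    by (simp add: E_def matrix_vector_mult_add_rdistrib P Q S flip: matrix_vector_mul_assoc)
  \<comment> \<open>\<open>param p\<close> is a linear projection onto \<open>T\<close>: it depends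
    on its argument only through \<open>\<pi>\<close>, and \<open>\<pi>\<close> is unchanged by
    it.\<close>
  have "E p *v u = u" for u
  proof -
    have cT: "closest_point T u \<in> T" by (rule closest_point_subspace(1)[OF sT])
    then obtain h where h: "h \<in> V" "closest_point T u = param p h"
      by (auto simp: T_def tangent_space_eq[OF p])
    have "param p (param p h) = param p (\<pi> (param p h))" by (simp add: param_\<pi>)
    also have "\<dots> = param p h" by (simp add: \<pi>_param[OF p] \<pi>_id[OF h(1)])
    finally have "param p (closest_point T u) = closest_point T u" using h(2) by simp
    then show ?thesis using closest_point_subspace_self[OF sT cT] by (simp add: E)
  qed
  then have Ep: "E p = mat 1" by (simp add: matrix_eq)
  have "continuous_on N (\<lambda>x. det (E x))"
    by (intro CkLL_on_continuous[where k = k] CkLL_on_det CkLL_on_vec_nth CE open_N)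
  \<comment> \<open>Invertibility of \<open>E\<close> holds at \<open>p\<close>, where
    \<open>E\<close> is the identity, and persists on an open set by continuity of the
    determinant.\<close>
  define M where "M = N \<inter> (\<lambda>x. det (E x)) -` (- {0})"
  have "open M" unfolding M_def
    by (rule continuous_open_preimage[OF \<open>continuous_on N (\<lambda>x. det (E x))\<close> open_N]) auto
  have MN: "M \<subseteq> N" by (auto simp: M_def)
  obtain R where CR: "CkLL_on k M R" and R: "\<And>x. x \<in> M \<Longrightarrow> E x ** R x = mat 1"
    using CkLL_on_matrix_inv[OF \<open>open M\<close> CkLL_on_subset[OF CE MN]] by (auto simp: M_def)
  define A where "A x = Q ** S x ** P ** R x ** P" for x
  have A: "A x *v u = Q *v (S x *v (P *v (R x *v (P *v u))))" for x u
    by (simp add: A_def flip: matrix_vector_mul_assoc)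
  have A_normal: "A x *v u \<in> T\<^sup>\<bottom>" for x u
    unfolding A Q by (rule closest_point_subspace(2)[OF sT])
  have A_zero: "A x *v w = 0" if "w \<in> T\<^sup>\<bottom>" for x w
    by (simp add: A P[of w] closest_point_orthogonal_comp[OF sT that] matrix_vector_mult_0_right)
  show ?thesis
  proof
    show "p \<in> M" using p by (simp add: M_def Ep)
    show "CkLL_on k M A"
      unfolding A_def
      by (intro CkLL_on_matrix_mult CkLL_on_const CkLL_on_subset[OF CS MN] CR \<open>open M\<close>)
    show "A x *v v \<in> (tangent_space X p)\<^sup>\<bottom>" for x v using A_normal by (simp add: T_def)
    show "A x *v w = 0" if "w \<in> (tangent_space X p)\<^sup>\<bottom>" for x w using A_zero that by (simp add: T_def)
    fix x assume x: "x \<in> X \<inter> M"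
    then have xN: "x \<in> X \<inter> N" using MN by auto
    have "graph_over T (A x) = tangent_space X x"
    proof (rule subspace_dim_equal)
      show "subspace (graph_over T (A x))" using sT A_normal by (rule graph_over_normal(1))
      show "dim (tangent_space X x) \<le> dim (graph_over T (A x))"
        using graph_over_normal(2)[OF sT A_normal] tangent_space_Gr(2)[OF xN] dT by simp
      show "graph_over T (A x) \<subseteq> tangent_space X x"
        unfolding graph_over_def
      proof
        fix y assume "y \<in> (\<lambda>v. v + A x *v v) ` T"
        then obtain v where v: "v \<in> T" "y = v + A x *v v" by auto
        define u where "u = R x *v v"
        define w where "w = param x (closest_point T u)"
        \<comment> \<open>The two summands of \<open>E x *v u\<close> lie in \<open>T\<close> and
          its complement. As \<open>v\<close> is in \<open>T\<close>, the first one equals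
          \<open>v\<close>: the tangent vector \<open>w\<close> projects to \<open>v\<close>, and
          \<open>A x *v v\<close> is its normal part.\<close>
        have "E x *v u = v"
          using R x by (simp add: u_def matrix_vector_mul_assoc)
        then have "closest_point T w + (u - closest_point T u) = v" by (simp add: E w_def)
        then have "closest_point T w = v"
          using closest_point_add_orthogonal[OF sT closest_point_subspace[OF sT], of w u]
            closest_point_subspace_self[OF sT v(1)] by simp
        then have "A x *v v = w - v"
          by (simp add: A P S Q closest_point_subspace_self[OF sT v(1)] flip: u_def w_def)
        then have "y = param x (\<pi> (closest_point T u))" using v(2) by (simp add: param_\<pi> w_def)
        then show "y \<in> tangent_space X x" unfolding tangent_space_eq[OF xN] using \<pi>_in by blast
      qed
    qed (rule tangent_space_Gr(1)[OF xN])
    then show "tangent_space X x = graph_over (tangent_space X p) (A x)" by (simp add: T_def)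
  qed (rule \<open>open M\<close>)
qed

end

text \<open>\<open>f\<close> is smooth only through local extensions, so \<open>D\<close> is cut
  down to the domain of one extension and the neighbourhood to its preimage under
  \<open>\<pi>\<close>, which preserves the graph identity. The chart is centred at the tangent
  space at \<open>p\<close>, in general different from \<open>V\<close>.\<close>

lemma smooth_graph_at_chart:
  assumes "smooth_graph_at (CkLL_on (Suc k)) d X p" "p \<in> X"
  obtains M T A where "open M" "p \<in> M" "T \<in> Gr d" "CkLL_on k M A"
    "\<And>x v. x \<in> M \<Longrightarrow> v \<in> T \<Longrightarrow> A x *v v \<in> T\<^sup>\<bottom>"
    "\<And>x w. x \<in> M \<Longrightarrow> w \<in> T\<^sup>\<bottom> \<Longrightarrow> A x *v w = 0"
    "\<And>x. x \<in> X \<inter> M \<Longrightarrow> tangent_space X x = graph_over T (A x)"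
proof -
  obtain V W U D f where V: "subspace V" "dim V = d" and W: "subspace W" "V \<inter> W = {0}"
    "{v + w |v w. v \<in> V \<and> w \<in> W} = UNIV" and U: "open U" "p \<in> U" and D: "openin (top_of_set V) D"
    and f: "f ` D \<subseteq> W" "smooth_on_subset (CkLL_on (Suc k)) D f" and graph: "X \<inter> U = (\<lambda>v. v + f v) ` D"
    using assms(1) unfolding smooth_graph_at_def by (elim exE conjE) (rule that; assumption)
  obtain \<pi> where \<pi>: "linear \<pi>" "\<And>x. \<pi> x \<in> V" "\<And>v w. v \<in> V \<Longrightarrow> w \<in> W \<Longrightarrow> \<pi> (v + w) = v"
    using projection_along[OF V(1) W] by metis
  have \<pi>V: "\<pi> v = v" if "v \<in> V" for v using \<pi>(3)[OF that subspace_0[OF W(1)]] by simp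
  have \<pi>W: "\<pi> w = 0" if "w \<in> W" for w using \<pi>(3)[OF subspace_0[OF V(1)] that] by simp
  have DV: "D \<subseteq> V" using openin_imp_subset[OF D] .
  obtain v0 where v0: "v0 \<in> D" "p = v0 + f v0" using assms(2) U(2) graph by auto
  obtain U0 F where U0: "open U0" "v0 \<in> U0" "CkLL_on (Suc k) U0 F" and Ff: "\<And>x. x \<in> D \<inter> U0 \<Longrightarrow> F x = f x"
    using f(2) v0(1) unfolding smooth_on_subset_def by metis
  have \<pi>g: "\<pi> (v + f v) = v" if "v \<in> D" for v using \<pi>(3) that DV f(1) by blast
  have cont: "continuous_on UNIV \<pi>"
    using \<pi>(1) by (intro linear_continuous_on) (simp add: linear_conv_bounded_linear)
  interpret C1_graph V "D \<inter> U0" X "U \<inter> \<pi> -` U0" U0 \<pi> F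
  proof (rule C1_graph.intro)
    show "openin (top_of_set V) (D \<inter> U0)" using D U0(1) by (simp add: openin_Int_open)
    show "\<pi> (F v) = 0" if "v \<in> D \<inter> U0" for v using Ff[OF that] \<pi>W f(1) that by auto
    show "open (U \<inter> \<pi> -` U0)" using U(1) open_vimage[OF U0(1) cont] by blast
    show "X \<inter> (U \<inter> \<pi> -` U0) = (\<lambda>v. v + F v) ` (D \<inter> U0)"
    proof (intro equalityI subsetI)
      fix x assume x: "x \<in> X \<inter> (U \<inter> \<pi> -` U0)"
      then obtain v where "v \<in> D" "x = v + f v" using graph by blast
      then show "x \<in> (\<lambda>v. v + F v) ` (D \<inter> U0)"
        using x \<pi>g[of v] Ff[of v] by (intro image_eqI[of _ _ v]) auto
    next
      fix x assume "x \<in> (\<lambda>v. v + F v) ` (D \<inter> U0)"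
      then obtain v where v: "v \<in> D" "v \<in> U0" "x = v + f v" using Ff by auto
      then have "x \<in> X \<inter> U" using graph by blast
      then show "x \<in> X \<inter> (U \<inter> \<pi> -` U0)" using v \<pi>g[of v] by auto
    qed
    show "Ck_on 1 U0 F" by (rule CkLL_on_SucD(1)[OF U0(3)])
  qed (use V(1) \<pi> \<pi>V U0(1) in auto)
  have p: "p \<in> X \<inter> (U \<inter> \<pi> -` U0)" using assms(2) U(2) v0 \<pi>g[OF v0(1)] U0(2) by auto
  have "tangent_space X p \<in> Gr d" using tangent_space_Gr[OF p] V(2) by (simp add: Gr_def)
  then show ?thesis
    by (rule_tac tangent_space_chart[OF p U0(3)]) (rule that; assumption)
qed

section \<open>From a submanifold to a smooth inverse of the Nash mapping\<close>

lemma smooth_graph_at_mono: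
  assumes "smooth_graph_at R d X p" "\<And>U F. R U F \<Longrightarrow> R' U F"
  shows "smooth_graph_at R' d X p"
proof -
  have "smooth_on_subset R' D f" if sm: "smooth_on_subset R D f" for D f
    unfolding smooth_on_subset_def
  proof
    fix q assume "q \<in> D"
    then obtain U F where "open U" "q \<in> U" "R U F" "\<forall>x\<in>D \<inter> U. F x = f x"
      using sm unfolding smooth_on_subset_def by metis
    then show "\<exists>U F. open U \<and> q \<in> U \<and> R' U F \<and> (\<forall>x\<in>D \<inter> U. F x = f x)" using assms(2) by blast
  qed
  then show ?thesis
    using assms(1) unfolding smooth_graph_at_def
    by (elim exE conjE) (intro exI conjI; (assumption | blast))
qed

proposition CkLL_submanifold_imp_nash:
  fixes X :: "(real ^ 'n) set"
  assumes "CkLL_submanifold (k + 1) d X"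
  shows "homeomorphic_map (nash_topology d X) (top_of_set X) fst"
    "smooth_on_subset (CkLL_into_RGr k d) X (nash_inverse d X)"
proof -
  have smooth: "smooth_graph_at (CkLL_on (Suc k)) d X p" if "p \<in> X" for p
    using assms that by (simp add: CkLL_submanifold_def)
  have Sing: "Sing1 X = {}"
    using smooth_graph_at_mono[OF smooth, of _ "Ck_on 1"] CkLL_on_SucD(1) by (fastforce simp: Sing1_def)
  define T where "T = tangent_space X"
  have T_Gr: "T p \<in> Gr d" and T_cont: "continuous (at p within X) (\<lambda>x. orth_proj (T x))" if p: "p \<in> X" for p
  proof -
    obtain M V A where M: "open M" "p \<in> M" "V \<in> Gr d" "CkLL_on k M A"
      "\<And>x v. x \<in> M \<Longrightarrow> v \<in> V \<Longrightarrow> A x *v v \<in> V\<^sup>\<bottom>"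
      "\<And>x w. x \<in> M \<Longrightarrow> w \<in> V\<^sup>\<bottom> \<Longrightarrow> A x *v w = 0"
      "\<And>x. x \<in> X \<inter> M \<Longrightarrow> tangent_space X x = graph_over V (A x)"
      by (rule smooth_graph_at_chart[OF smooth[OF p] p]) (rule that)
    have V: "subspace V" "dim V = d" using M(3) by (auto simp: Gr_def)
    show "T p \<in> Gr d"
      using graph_over_normal(1,2)[OF V(1) M(5)[OF M(2)]] M(7)[of p] p M(2) V(2) by (simp add: T_def Gr_def)
    have "continuous_on (X \<inter> M) (\<lambda>x. orth_proj (graph_over V (A x)))"
      by (intro continuous_on_orth_proj_graph_over V continuous_on_subset[OF CkLL_on_continuous[OF M(4)]] M(5)) auto
    then have "continuous_on (X \<inter> M) (\<lambda>x. orth_proj (T x))"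
      by (rule continuous_on_eq) (simp add: T_def M(7))
    then have "continuous (at p within X \<inter> M) (\<lambda>x. orth_proj (T x))"
      using p M(2) by (simp add: continuous_on_eq_continuous_within)
    moreover have "at p within X \<inter> M = at p within X"
      by (rule at_within_nhd[OF M(2,1)]) auto
    ultimately show "continuous (at p within X) (\<lambda>x. orth_proj (T x))" by simp
  qed
  have T_map: "continuous_map (top_of_set X) (Gr_topology d) T"
    by (intro continuous_map_Gr T_Gr) (simp add: continuous_on_eq_continuous_within T_cont)
  let ?N = "nash_transformation d X" and ?Y = "prod_topology (top_of_set X) (Gr_topology d)"
  \<comment> \<open>The graph of a continuous map into a Hausdorff space is closed, so the closure
    adds no points.\<close>
  have N: "?N = (\<lambda>x. (x, T x)) ` X"
    unfolding nash_transformation_def Sing T_def[symmetric] Diff_empty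
    using continuous_map_imp_closed_graph[OF T_map Hausdorff_Gr] by (simp add: closure_of_closedin)
  have emb: "homeomorphic_map (top_of_set X) (nash_topology d X) (\<lambda>x. (x, T x))"
    using embedding_map_graph[of "top_of_set X" "Gr_topology d" T] T_map
    unfolding embedding_map_def nash_topology_def N by simp
  then obtain g where g: "homeomorphic_maps (top_of_set X) (nash_topology d X) (\<lambda>x. (x, T x)) g"
    unfolding homeomorphic_map_maps by blast
  have top: "topspace (nash_topology d X) = ?N"
    unfolding nash_topology_def nash_transformation_def
    by (rule topspace_subtopology_subset[OF closure_of_subset_topspace])
  show "homeomorphic_map (nash_topology d X) (top_of_set X) fst"
  proof (rule homeomorphic_map_eq)
    show "homeomorphic_map (nash_topology d X) (top_of_set X) g"
      using g by (simp add: homeomorphic_maps_map)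
    show "g y = fst y" if "y \<in> topspace (nash_topology d X)" for y
      using g that unfolding top N homeomorphic_maps_map by auto
  qed
  have inv: "nash_inverse d X x = (x, T x)" if "x \<in> X" for x
    unfolding nash_inverse_def N by (rule inv_into_f_eq) (use that in \<open>auto simp: inj_on_def\<close>)
  show "smooth_on_subset (CkLL_into_RGr k d) X (nash_inverse d X)"
    unfolding smooth_on_subset_def
  proof
    fix p assume p: "p \<in> X"
    obtain M V A where M: "open M" "p \<in> M" "V \<in> Gr d" "CkLL_on k M A"
      "\<And>x v. x \<in> M \<Longrightarrow> v \<in> V \<Longrightarrow> A x *v v \<in> V\<^sup>\<bottom>"
      "\<And>x w. x \<in> M \<Longrightarrow> w \<in> V\<^sup>\<bottom> \<Longrightarrow> A x *v w = 0"
      "\<And>x. x \<in> X \<inter> M \<Longrightarrow> tangent_space X x = graph_over V (A x)"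
      by (rule smooth_graph_at_chart[OF smooth[OF p] p]) (rule that)
    have V: "subspace V" "dim V = d" using M(3) by (auto simp: Gr_def)
    \<comment> \<open>Off \<open>X\<close> this subspace is no tangent space; it merely extends the
      Gauss mapping to an open set.\<close>
    define F where "F x = (x, graph_over V (A x))" for x
    have dom: "graph_over V (A x) \<in> Gr_chart_domain V" if "x \<in> M" for x
      using graph_over_normal(4)[OF V(1) M(5)[OF that]] .
    have "CkLL_on k M (\<lambda>x. (x, A x))"
      by (intro CkLL_on_Pair M(1,4) CkLL_on_linear bounded_linear_ident)
    then have CF: "CkLL_on k M (\<lambda>x. (fst (F x), Gr_chart V (snd (F x))))"
      by (rule CkLL_on_cong[OF M(1), rotated]) (simp add: F_def Gr_chart_graph_over[OF V(1) M(5,6)])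
    have "CkLL_into_RGr k d M F"
      unfolding CkLL_into_RGr_def
    proof (intro conjI ballI)
      show "F ` M \<subseteq> UNIV \<times> Gr d" using dom V(2) by (auto simp: F_def Gr_chart_domain_def)
      show "\<exists>N V. open N \<and> q \<in> N \<and> N \<subseteq> M \<and> V \<in> Gr d \<and> (\<forall>x\<in>N. snd (F x) \<in> Gr_chart_domain V) \<and>
          CkLL_on k N (\<lambda>x. (fst (F x), Gr_chart V (snd (F x))))" if "q \<in> M" for q
        by (intro exI[of _ M] exI[of _ V]) (use M(1,3) that dom CF in \<open>auto simp: F_def\<close>)
    qed
    then show "\<exists>U F. open U \<and> p \<in> U \<and> CkLL_into_RGr k d U F \<and> (\<forall>x\<in>X \<inter> U. F x = nash_inverse d X x)"
      using M(1,2,7) inv by (intro exI[of _ M] exI[of _ F]) (auto simp: F_def T_def)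
  qed
qed

theorem theorem3p5:
  fixes X :: "(real ^ 'n) set" and S :: "nat \<Rightarrow> real list set set" and d k :: nat
  assumes "o_minimal S"
    and "locally closed X"
    and "pure_dimensional d X"
    and "locally_definable S X"
    and "coincide_linearly d X"
  shows "homeomorphic_map (nash_topology d X) (top_of_set X) fst \<and>
         smooth_on_subset (CkLL_into_RGr k d) X (nash_inverse d X)
     \<longleftrightarrow> CkLL_submanifold (k + 1) d X"
proof
  assume "homeomorphic_map (nash_topology d X) (top_of_set X) fst \<and>
    smooth_on_subset (CkLL_into_RGr k d) X (nash_inverse d X)"
  then show "CkLL_submanifold (k + 1) d X"
    using nash_imp_CkLL_submanifold assms(2,5) by blast
next
  assume "CkLL_submanifold (k + 1) d X"
  then show "homeomorphic_map (nash_topology d X) (top_of_set X) fst \<and>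
    smooth_on_subset (CkLL_into_RGr k d) X (nash_inverse d X)"
    using CkLL_submanifold_imp_nash by blast
qed

end
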